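(* Let $k>2$ be an even integer and fix constants $c_1,c_2>0$. For a positive integer $n$, $\kappa>0$ and $\alpha>0$ let \[S_2(n,\kappa,\alpha)=\sum_{\substack{l,f\geq1\\ lf^2\leq c_1 n^{\frac14-\kappa}}}\ \sum_{\substack{\xi\in\mathbb{Z}\\ 0<\xi\leq c_2 n^{\frac16+\kappa+\alpha}}}\tfrac{Kl_{l,f}(\xi,n)}{\sqrt l}\,\tfrac{I_{l,f}(\xi,n)}{(lf^2)^{3/2}}.\] Then for every $\kappa>0$ and $0<\alpha\leq\frac1{12}$, $S_2(n,\kappa,\alpha)\ll \log^2(n)\,n^{-\frac12-\kappa}$ for $n\geq 2$, where the implied constant depends only on $k,\kappa,\alpha$ (and $c_1,c_2$).
   Context: Write $e(x)=e^{2\pi i x}$. $\theta_\infty:\mathbb{R}\to\mathbb{R}$ is $\theta_\infty(x)=\tfrac{i}{2\pi}\{(x+\sqrt{x^2-1})^{k-1}-(x-\sqrt{x^2-1})^{k-1}\}$ for $|x|<1$, with $\sqrt{x^2-1}=i\sqrt{1-x^2}$, and $\theta_\infty(x)=0$ for $|x|\geq1$. $F(x)=\tfrac{1}{2K_0(2)}\int_x^\infty e^{-y-1/y}\tfrac{dy}{y}$ for $x>0$ ($K_0$ the modified Bessel function), $\tilde F$ its Mellin transform (meromorphically continued, only pole simple at $0$ with residue $1$), and for $y>0$, $H(y)=\tfrac{\sqrt\pi}{2\pi i}\int_{\Re(u)=1}\tfrac{\Gamma(\frac{1+u}{2})}{\Gamma(\frac{2-u}{2})}(\pi y)^{-u}\tilde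 F(u)\,du$. For positive integers $l,f,n$ and $\xi\in\mathbb{Z}$, with $t=\tfrac{lf^2(4n)^{-1/2}}{\sqrt{1-x^2}}$, \[I_{l,f}(\xi,n)=\int_{-1}^{1}\theta_\infty(x)\bigl\{F(t)+t\,H(t)\bigr\}e\Bigl(\tfrac{-x\xi\sqrt n}{2lf^2}\Bigr)dx,\quad Kl_{l,f}(\xi,n)=\sum_{\substack{a\bmod 4lf^2\\ a^2\equiv 4n\bmod f^2\\ (a^2-4n)/f^2\equiv 0,1\bmod 4}}\Bigl(\tfrac{(a^2-4n)/f^2}{l}\Bigr)e\Bigl(\tfrac{a\xi}{4lf^2}\Bigr),\] with $(\tfrac{\cdot}{l})$ the Kronecker symbol. *)

theory Defs
  imports "HOL-Analysis.Analysis" "HOL-Number_Theory.Number_Theory"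
begin

definition e_char :: "real \<Rightarrow> complex" where
  "e_char x = exp (2 * of_real pi * \<i> * of_real x)"

text \<open>The expression under \<open>Re\<close> is real; see \<open>of_real_theta_inf\<close> below.\<close>

definition theta_inf :: "nat \<Rightarrow> real \<Rightarrow> real" where
  "theta_inf k x =
     (if \<bar>x\<bar> < 1 then
        Re (\<i> / (2 * of_real pi) *
            ((of_real x + \<i> * of_real (sqrt (1 - x\<^sup>2))) ^ (k - 1)
             - (of_real x - \<i> * of_real (sqrt (1 - x\<^sup>2))) ^ (k - 1)))
      else 0)"

lemma of_real_theta_inf:
  assumes "\<bar>x\<bar> < 1"
  shows "complex_of_real (theta_inf k x) =
           \<i> / (2 * of_real pi) *
            ((of_real x + \<i> * of_real (sqrt (1 - x\<^sup>2))) ^ (k - 1)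
             - (of_real x - \<i> * of_real (sqrt (1 - x\<^sup>2))) ^ (k - 1))"
proof -
  define z where "z = (of_real x + \<i> * of_real (sqrt (1 - x\<^sup>2))) ^ (k - 1)"
  have "cnj z = (of_real x - \<i> * of_real (sqrt (1 - x\<^sup>2))) ^ (k - 1)"
    by (simp add: z_def)
  then have eq: "theta_inf k x = Re (\<i> / (2 * of_real pi) * (z - cnj z))"
    and rhs: "\<i> / (2 * of_real pi) *
            ((of_real x + \<i> * of_real (sqrt (1 - x\<^sup>2))) ^ (k - 1)
             - (of_real x - \<i> * of_real (sqrt (1 - x\<^sup>2))) ^ (k - 1)) =
            \<i> / (2 * of_real pi) * (z - cnj z)"
    using assms by (simp_all add: theta_inf_def z_def)
  have "\<i> / (2 * of_real pi) * (z - cnj z) = of_real (- Im z / pi)"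
    by (simp add: complex_diff_cnj field_simps)
  with eq rhs show ?thesis by simp
qed

text \<open>The modified Bessel function of the second kind of order 0 at a positive argument,
  by its classical integral representation.\<close>

definition bessel_K0 :: "real \<Rightarrow> real" where
  "bessel_K0 z = (LINT t:{0..}|lborel. exp (- z * cosh t))"

definition F_cutoff :: "real \<Rightarrow> real" where
  "F_cutoff x = 1 / (2 * bessel_K0 2) * (LINT y:{x<..}|lborel. exp (- y - 1 / y) / y)"

text \<open>The Mellin transform of \<open>F_cutoff\<close> in its half-plane of absolute convergence \<open>Re u > 0\<close>.
  It is only evaluated on the line \<open>Re u = 1\<close>, where it agrees with the meromorphic continuation.\<close>

definition F_mellin :: "complex \<Rightarrow> complex" where
  "F_mellin u = (LINT x:{0<..}|lborel. of_real (F_cutoff x) * of_real x powr (u - 1))"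

text \<open>Integral along the upward line \<open>Re u = c\<close>, with \<open>u = c + \<i>v\<close> and \<open>du = \<i> dv\<close>.\<close>

definition vertical_integral :: "real \<Rightarrow> (complex \<Rightarrow> complex) \<Rightarrow> complex" where
  "vertical_integral c g = (LINT v|lborel. g (Complex c v) * \<i>)"

definition H_fun :: "real \<Rightarrow> complex" where
  "H_fun y = of_real (sqrt pi) / (2 * of_real pi * \<i>) *
     vertical_integral 1 (\<lambda>u. Gamma ((1 + u) / 2) / Gamma ((2 - u) / 2)
        * of_real (pi * y) powr (- u) * F_mellin u)"

definition t_arg :: "nat \<Rightarrow> nat \<Rightarrow> nat \<Rightarrow> real \<Rightarrow> real" where
  "t_arg l f n x = real l * (real f)\<^sup>2 * (4 * real n) powr (- 1 / 2) / sqrt (1 - x\<^sup>2)"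

definition I_int :: "nat \<Rightarrow> nat \<Rightarrow> nat \<Rightarrow> int \<Rightarrow> nat \<Rightarrow> complex" where
  "I_int k l f \<xi> n =
     (LINT x:{-1..1}|lborel.
        of_real (theta_inf k x)
        * (of_real (F_cutoff (t_arg l f n x)) + of_real (t_arg l f n x) * H_fun (t_arg l f n x))
        * e_char (- x * of_int \<xi> * sqrt (real n) / (2 * real l * (real f)\<^sup>2)))"

definition kronecker_prime :: "int \<Rightarrow> nat \<Rightarrow> int" where
  "kronecker_prime a p =
     (if p = 2 then (if even a then 0 else if a mod 8 \<in> {1, 7} then 1 else - 1)
      else Legendre a (int p))"

text \<open>The Kronecker symbol \<open>(a / l)\<close> for positive \<open>l\<close>.\<close>

definition kronecker :: "int \<Rightarrow> nat \<Rightarrow> int" where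
  "kronecker a l = (\<Prod>p\<in>prime_factors l. kronecker_prime a p ^ multiplicity p l)"

definition Kl_sum :: "nat \<Rightarrow> nat \<Rightarrow> int \<Rightarrow> nat \<Rightarrow> complex" where
  "Kl_sum l f \<xi> n =
     (\<Sum>a | a \<in> {0..<4 * int l * (int f)\<^sup>2} \<and> [a\<^sup>2 = 4 * int n] (mod (int f)\<^sup>2)
            \<and> ((a\<^sup>2 - 4 * int n) div (int f)\<^sup>2) mod 4 \<in> {0, 1}.
        of_int (kronecker ((a\<^sup>2 - 4 * int n) div (int f)\<^sup>2) l)
        * e_char (of_int (a * \<xi>) / (4 * real l * (real f)\<^sup>2)))"

definition S2 :: "nat \<Rightarrow> real \<Rightarrow> real \<Rightarrow> nat \<Rightarrow> real \<Rightarrow> real \<Rightarrow> complex" where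
  "S2 k c1 c2 n \<kappa> \<alpha> =
     (\<Sum>(l, f) | l \<ge> 1 \<and> f \<ge> 1 \<and> real l * (real f)\<^sup>2 \<le> c1 * real n powr (1 / 4 - \<kappa>).
        \<Sum>\<xi> | 0 < \<xi> \<and> of_int \<xi> \<le> c2 * real n powr (1 / 6 + \<kappa> + \<alpha>).
          Kl_sum l f \<xi> n / of_real (sqrt (real l))
          * (I_int k l f \<xi> n / of_real ((real l * (real f)\<^sup>2) powr (3 / 2))))"

text \<open>Both index sets of \<open>S2\<close> are finite, so the sums are not vacuous.\<close>

lemma finite_S2_outer: "finite {(l::nat, f::nat). l \<ge> 1 \<and> f \<ge> 1 \<and> real l * (real f)\<^sup>2 \<le> B}"
proof (rule finite_subset)
  show "{(l::nat, f::nat). l \<ge> 1 \<and> f \<ge> 1 \<and> real l * (real f)\<^sup>2 \<le> B}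
          \<subseteq> {..nat \<lfloor>B\<rfloor>} \<times> {..nat \<lfloor>B\<rfloor>}"
  proof clarify
    fix l f :: nat
    assume lf: "1 \<le> l" "1 \<le> f" "real l * (real f)\<^sup>2 \<le> B"
    have "l * 1 \<le> l * f\<^sup>2" "1 * f \<le> l * f\<^sup>2"
      using lf by (intro mult_le_mono; simp add: power2_eq_square)+
    then have "real l \<le> real (l * f\<^sup>2)" "real f \<le> real (l * f\<^sup>2)"
      by (simp_all only: of_nat_le_iff mult_1 mult_1_right)
    moreover have "real (l * f\<^sup>2) \<le> B"
      using lf(3) by simp
    ultimately have "real l \<le> B" "real f \<le> B"
      by linarith+
    then show "l \<in> {..nat \<lfloor>B\<rfloor>} \<and> f \<in> {..nat \<lfloor>B\<rfloor>}"
      by (simp add: le_nat_floor)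
  qed
qed simp

lemma finite_S2_inner: "finite {\<xi>::int. 0 < \<xi> \<and> of_int \<xi> \<le> (B::real)}"
  by (rule finite_subset[of _ "{0..\<lfloor>B\<rfloor>}"]) (auto simp: le_floor_iff)

end

theory Submission
  imports "HOL-Algebra.Algebraic_Closure_Type" "Berlekamp_Zassenhaus.Finite_Field"
    "HOL-Probability.Sinc_Integral" Defs
begin

text \<open>
  No cancellation between the terms of the sum is needed.
  The integrand of \<open>I\<close> vanishes like a square root at \<open>\<plusminus>1\<close>, while
  \<open>F(t) + t H(t)\<close> is bounded and each derivative in \<open>x\<close> costs at most a factor \<open>1/(1 - x\<^sup>2)\<close>; for \<open>H\<close> this
  is seen by writing it as a superposition of the powers \<open>t\<^bsup>-iv\<^esup>\<close> against a rapidly decaying weight.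
  Hence \<open>I \<lless> (\<xi> \<surd>n / l f\<^sup>2)\<^bsup>-3/2\<^esup>\<close>, which cancels the denominator \<open>(l f\<^sup>2)\<^bsup>3/2\<^esup>\<close> and leaves
  \<open>n\<^bsup>-3/4\<^esup> \<Sum> \<xi>\<^bsup>-3/2\<^esup> |Kl| / \<surd>l\<close>.

  The sums \<open>Kl\<close> are multiplicative up to twisting \<open>\<xi>\<close>. At an odd prime not dividing the data the local
  factor is a Kloosterman sum, bounded by \<open>2 \<surd>p\<close>: its L-function is a quadratic polynomial whose
  reciprocal roots have product \<open>p\<close>, and Stepanov's auxiliary polynomials bound the even power sums of the
  roots by \<open>O(p\<^sup>s)\<close>. Averaging over \<open>l f\<^sup>2 \<le> Y\<close> then costs
  \<open>Y log Y log n\<close> times a power of the number of divisors of \<open>\<xi>\<close>, over which the sum against \<open>\<xi>\<^bsup>-3/2\<^esup>\<close>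
  converges. With \<open>Y = c\<^sub>1 n\<^bsup>1/4 - \<kappa>\<^esup>\<close> this is the claim.
\<close>

hide_const (open) Divisibility.prime Divisibility.irreducible Polynomials.degree UnivPoly.coeff
  UnivPoly.monom up Coset.order

section \<open>Weil's bound for Kloosterman sums by Stepanov's method\<close>

section \<open>The L-function of a multiplicative function on monic polynomials\<close>

text \<open>Weil's bound covers only the primes that divide \<open>l\<close> once and do not divide
  \<open>2 f\<close>. The rest of \<open>l\<close> is a divisor \<open>t\<close> of
  \<open>2 f\<close> times \<open>d * rad d\<close>, and it is bounded trivially. Two facts pay for
  this: the summand has a period shorter by the factor \<open>d\<close>, so the sum vanishes unless
  \<open>d\<close> divides \<open>\<xi>\<close>; and fixing \<open>t\<close> and \<open>d\<close>
  shortens the sum over the good part by their full size, while the trivial bound, after division by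
  \<open>sqrt l\<close>, loses only its square root. One logarithm comes from the divisor function
  on the good part, the other from counting square roots of \<open>4 n\<close> modulo
  \<open>f^2\<close>.

  Stepanov's method bounds from above the number of points of each trace. As the total number of
  points is known, these upper bounds already give a two-sided estimate of the character sum. Only
  fields of degree \<open>2 s\<close> are treated, since the construction uses a square root of
  Frobenius; even powers still determine the size of the two roots.

  The bounds for the integrals must be uniform in the scale of \<open>t\<close>, which is why
  derivatives are always measured in log t.\<close>

lemma finite_poly_degree_le: "finite {F :: 'a::{zero,finite} poly. degree F \<le> d}"
proof (rule finite_subset)
  show "{F :: 'a poly. degree F \<le> d} \<subseteq> Poly ` {xs. set xs \<subseteq> UNIV \<and> length xs \<le> Suc d}"
  proof
    fix F :: "'a poly" assume "F \<in> {F. degree F \<le> d}"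
    then have "length (coeffs F) \<le> Suc d"
      by (cases "F = 0") (auto simp: length_coeffs_degree)
    then show "F \<in> Poly ` {xs. set xs \<subseteq> UNIV \<and> length xs \<le> Suc d}"
      by (intro image_eqI[of _ _ "coeffs F"]) auto
  qed
  show "finite (Poly ` {xs :: 'a list. set xs \<subseteq> UNIV \<and> length xs \<le> Suc d})"
    by (intro finite_imageI finite_lists_length_le) auto
qed

text \<open>A nonzero constant term keeps 0 from being a root, where \<open>\<nu> / x\<close> has
  its pole. These are the effective divisors of degree \<open>d\<close> on the multiplicative
  group.\<close>

definition monic_unit :: "nat \<Rightarrow> 'a::prime_card mod_ring poly set" where
  "monic_unit d = {F. degree F = d \<and> lead_coeff F = 1 \<and> coeff F 0 \<noteq> 0}"

definition prime_unit :: "'a::prime_card mod_ring poly set" where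
  "prime_unit = {P. prime P \<and> coeff P 0 \<noteq> 0}"

definition degree_sum :: "('a::prime_card mod_ring poly \<Rightarrow> complex) \<Rightarrow> nat \<Rightarrow> complex" where
  "degree_sum \<Psi> d = (\<Sum>F\<in>monic_unit d. \<Psi> F)"

text \<open>If \<open>degree_sum \<Psi>\<close> lists the coefficients of a power series L(T), these
  are the coefficients of T L'(T) / L(T). A prime of degree dividing \<open>r\<close> is weighted by
  its degree, the number of its roots in the field with p^r elements.\<close>

definition point_sum :: "('a::prime_card mod_ring poly \<Rightarrow> complex) \<Rightarrow> nat \<Rightarrow> complex" where
  "point_sum \<Psi> r = (\<Sum>P | P \<in> prime_unit \<and> degree P dvd r.
      of_nat (degree P) * \<Psi> P ^ (r div degree P))"

lemma finite_monic_unit [simp]: "finite (monic_unit d)"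
  by (rule finite_subset[OF _ finite_poly_degree_le[of d]]) (auto simp: monic_unit_def)

lemma prime_poly_monic:
  fixes P :: "'a::prime_card mod_ring poly"
  assumes "prime P" shows "lead_coeff P = 1"
proof -
  have "P \<noteq> 0" "normalize P = P" using assms by auto
  then have "unit_factor P = 1"
    by (metis mult_cancel_right mult_1 unit_factor_mult_normalize)
  then show ?thesis
    by (simp add: unit_factor_poly_def unit_factor_mod_ring_def one_pCons)
qed

lemma prime_poly_degree_pos:
  fixes P :: "'a::prime_card mod_ring poly"
  assumes "prime P" shows "degree P > 0"
  using assms by (metis is_unit_iff_degree not_prime_0 not_prime_unit gr0I)

lemma finite_prime_unit_dvd: "r > 0 \<Longrightarrow> finite {P. P \<in> prime_unit \<and> degree P dvd r}"
  by (rule finite_subset[OF _ finite_poly_degree_le[of r]]) (auto dest: dvd_imp_le)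

lemma normalize_monic_poly:
  fixes F :: "'a::prime_card mod_ring poly"
  assumes "lead_coeff F = 1" shows "normalize F = F"
  using assms by (simp add: normalize_poly_eq_map_poly normalize_mod_ring_def map_poly_idI)

lemma degree_eq_sum_prime_factors:
  fixes F :: "'a::prime_card mod_ring poly"
  assumes "lead_coeff F = 1"
  shows "degree F = (\<Sum>P\<in>prime_factors F. multiplicity P F * degree P)"
proof -
  have nz: "F \<noteq> 0" using assms by auto
  have "F = (\<Prod>P\<in>prime_factors F. P ^ multiplicity P F)"
    using prod_prime_factors[OF nz] normalize_monic_poly[OF assms] by simp
  then have "degree F = degree (\<Prod>P\<in>prime_factors F. P ^ multiplicity P F)" by simp
  also have "\<dots> = (\<Sum>P\<in>prime_factors F. degree (P ^ multiplicity P F))"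
    by (intro degree_prod_eq_sum_degree) (auto simp: in_prime_factors_iff)
  also have "\<dots> = (\<Sum>P\<in>prime_factors F. multiplicity P F * degree P)"
    by (rule sum.cong[OF refl], rule Polynomial.degree_power_eq) (auto simp: in_prime_factors_iff)
  finally show ?thesis .
qed

text \<open>This is T L' = L * (T L' / L), coefficient by coefficient. It follows from the
  polynomial analogue of the identity that expresses log n through the von Mangoldt function: the
  degree of F is the sum of \<open>degree P\<close> over all prime powers \<open>P ^ j\<close>
  dividing F.\<close>

lemma degree_sum_recurrence:
  fixes \<Psi> :: "'a::prime_card mod_ring poly \<Rightarrow> complex"
  assumes mult: "\<And>F G. lead_coeff F = 1 \<Longrightarrow> lead_coeff G = 1 \<Longrightarrow> coeff F 0 \<noteq> 0 \<Longrightarrow> coeff G 0 \<noteq> 0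
      \<Longrightarrow> \<Psi> (F * G) = \<Psi> F * \<Psi> G"
    and one: "\<Psi> 1 = 1"
  shows "of_nat d * degree_sum \<Psi> d = (\<Sum>r=1..d. point_sum \<Psi> r * degree_sum \<Psi> (d - r))"
proof -
  define PP where "PP = {(P, j). P \<in> (prime_unit :: 'a mod_ring poly set) \<and> 1 \<le> j \<and> j * degree P \<le> d}"
  have degpos: "degree P > 0" if "P \<in> prime_unit" for P :: "'a mod_ring poly"
    using that prime_poly_degree_pos by (auto simp: prime_unit_def)
  have finPP: "finite PP"
  proof (rule finite_subset)
    show "PP \<subseteq> {P. degree P \<le> d} \<times> {..d}"
    proof clarify
      fix P j assume "(P, j) \<in> PP"
      then have *: "P \<in> prime_unit" "1 \<le> j" "j * degree P \<le> d" by (auto simp: PP_def)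
      have "1 * degree P \<le> j * degree P" "j * 1 \<le> j * degree P"
        using * degpos[OF *(1)] by (intro mult_le_mono; simp)+
      then have "degree P \<le> d" "j \<le> d" using *(3) by linarith+
      then show "P \<in> {P. degree P \<le> d} \<and> j \<in> {..d}" by simp
    qed
  qed (auto intro: finite_poly_degree_le)
  have powP: "lead_coeff (P ^ j) = 1" "coeff (P ^ j) 0 \<noteq> 0" "\<Psi> (P ^ j) = \<Psi> P ^ j"
    if "P \<in> prime_unit" for P j
  proof -
    have P: "lead_coeff P = 1" "coeff P 0 \<noteq> 0"
      using that prime_poly_monic by (auto simp: prime_unit_def)
    show l: "lead_coeff (P ^ j) = 1" for j using P by (simp add: lead_coeff_power)
    show c: "coeff (P ^ j) 0 \<noteq> 0" for j using P by (simp add: coeff_0_power)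
    show "\<Psi> (P ^ j) = \<Psi> P ^ j"
      by (induction j) (use P l c mult one in auto)
  qed
  have deg: "d = (\<Sum>(P, j) | (P, j) \<in> PP \<and> P ^ j dvd F. degree P)" if F: "F \<in> monic_unit d" for F
  proof -
    have F': "degree F = d" "lead_coeff F = 1" "coeff F 0 \<noteq> 0" using F by (auto simp: monic_unit_def)
    have nz: "F \<noteq> 0" using F' by auto
    have iff: "(P, j) \<in> PP \<and> P ^ j dvd F \<longleftrightarrow> P \<in> prime_factors F \<and> j \<in> {1..multiplicity P F}" for P j
    proof
      assume "(P, j) \<in> PP \<and> P ^ j dvd F"
      then have "(P, j) \<in> PP" "P ^ j dvd F" by auto
      then have *: "prime P" "j \<ge> 1" by (auto simp: PP_def prime_unit_def)
      have "j \<le> multiplicity P F"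
        using \<open>P ^ j dvd F\<close> nz * power_dvd_iff_le_multiplicity[of F P j] prime_poly_degree_pos[of P] by (auto dest: not_prime_unit)
      moreover have "P dvd F" using \<open>P ^ j dvd F\<close> *(2) by (meson dvd_power dvd_trans less_le_trans zero_less_one)
      ultimately show "P \<in> prime_factors F \<and> j \<in> {1..multiplicity P F}"
        using * nz by (auto simp: in_prime_factors_iff)
    next
      assume "P \<in> prime_factors F \<and> j \<in> {1..multiplicity P F}"
      then have P: "P \<in> prime_factors F" and j: "j \<in> {1..multiplicity P F}" by auto
      have pr: "prime P" "P dvd F" using P by (auto simp: in_prime_factors_iff)
      have dv: "P ^ j dvd F" using j by (simp add: multiplicity_dvd')
      have "coeff P 0 \<noteq> 0"
        using pr(2) F'(3) by (auto simp: dvd_def coeff_mult_0)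
      moreover have "j * degree P \<le> d"
        using dvd_imp_degree_le[OF dv nz] F'(1) pr by (simp add: Polynomial.degree_power_eq)
      ultimately show "(P, j) \<in> PP \<and> P ^ j dvd F"
        using pr j dv by (auto simp: PP_def prime_unit_def)
    qed
    have eq: "{(P, j). (P, j) \<in> PP \<and> P ^ j dvd F} = Sigma (prime_factors F) (\<lambda>P. {1..multiplicity P F})"
      unfolding iff by auto
    have "(\<Sum>(P, j) | (P, j) \<in> PP \<and> P ^ j dvd F. degree P)
        = (\<Sum>(P, j)\<in>Sigma (prime_factors F) (\<lambda>P. {1..multiplicity P F}). degree P)"
      by (simp only: eq)
    also have "\<dots> = (\<Sum>P\<in>prime_factors F. \<Sum>j\<in>{1..multiplicity P F}. degree P)"
      by (subst sum.Sigma) auto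
    also have "\<dots> = d" using degree_eq_sum_prime_factors[OF F'(2)] F'(1) by simp
    finally show ?thesis by simp
  qed
  have inner: "(\<Sum>F | F \<in> monic_unit d \<and> P ^ j dvd F. \<Psi> F) = \<Psi> P ^ j * degree_sum \<Psi> (d - j * degree P)"
    if "(P, j) \<in> PP" for P j
  proof -
    have P: "P \<in> prime_unit" "j * degree P \<le> d" using that by (auto simp: PP_def)
    note pw = powP[OF P(1), of j]
    have degPj: "degree (P ^ j) = j * degree P"
      using P(1) by (intro Polynomial.degree_power_eq) (auto simp: prime_unit_def)
    have nzP: "P ^ j \<noteq> 0" using pw(2) by (metis coeff_0)
    have "(\<Sum>F | F \<in> monic_unit d \<and> P ^ j dvd F. \<Psi> F) = (\<Sum>G\<in>monic_unit (d - j * degree P). \<Psi> (P ^ j * G))"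
    proof (rule sum.reindex_bij_witness[of _ "\<lambda>G. P ^ j * G" "\<lambda>F. F div P ^ j"])
      fix F assume "F \<in> {F. F \<in> monic_unit d \<and> P ^ j dvd F}"
      then have F: "degree F = d" "lead_coeff F = 1" "coeff F 0 \<noteq> 0" "P ^ j dvd F"
        by (auto simp: monic_unit_def)
      from F(4) obtain G where G: "F = P ^ j * G" by (rule dvdE)
      show "P ^ j * (F div P ^ j) = F" using F by simp
      then show "\<Psi> (P ^ j * (F div P ^ j)) = \<Psi> F" by simp
      have FG: "F div P ^ j = G" using G nzP by simp
      have "G \<noteq> 0" using G F by auto
      then have "degree G = d - j * degree P"
        using F(1) G degPj nzP by (simp add: degree_mult_eq)
      moreover have "lead_coeff G = 1" using F(2) G pw by (simp add: lead_coeff_mult)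
      moreover have "coeff G 0 \<noteq> 0" using F(3) G by (simp add: coeff_mult_0)
      ultimately show "F div P ^ j \<in> monic_unit (d - j * degree P)" by (simp add: FG monic_unit_def)
    next
      fix G :: "'a mod_ring poly" assume "G \<in> monic_unit (d - j * degree P)"
      then have G: "degree G = d - j * degree P" "lead_coeff G = 1" "coeff G 0 \<noteq> 0" by (auto simp: monic_unit_def)
      then have "G \<noteq> 0" by auto
      show "P ^ j * G div P ^ j = G" using nzP by simp
      show "P ^ j * G \<in> {F. F \<in> monic_unit d \<and> P ^ j dvd F}"
      proof -
        have "degree (P ^ j * G) = d"
          using G P(2) nzP \<open>G \<noteq> 0\<close> degPj by (simp add: degree_mult_eq)
        moreover have "lead_coeff (P ^ j * G) = 1"
          by (simp only: lead_coeff_mult pw G(2) mult_1)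
        moreover have "coeff (P ^ j * G) 0 \<noteq> 0"
          using pw G by (simp add: coeff_mult_0)
        ultimately show ?thesis by (simp add: monic_unit_def)
      qed
    qed
    also have "\<dots> = (\<Sum>G\<in>monic_unit (d - j * degree P). \<Psi> P ^ j * \<Psi> G)"
      by (intro sum.cong refl) (use pw mult in \<open>auto simp: monic_unit_def\<close>)
    finally show ?thesis by (simp add: degree_sum_def sum_distrib_left)
  qed
  have "of_nat d * degree_sum \<Psi> d = (\<Sum>F\<in>monic_unit d. \<Psi> F * of_nat d)"
    by (simp add: degree_sum_def sum_distrib_left mult.commute)
  also have "\<dots> = (\<Sum>F\<in>monic_unit d. \<Sum>(P, j)\<in>PP. if P ^ j dvd F then \<Psi> F * of_nat (degree P) else 0)"
  proof (rule sum.cong[OF refl])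
    fix F :: "'a mod_ring poly" assume F: "F \<in> monic_unit d"
    have s: "{(P, j). (P, j) \<in> PP \<and> P ^ j dvd F} = {x\<in>PP. case x of (P, j) \<Rightarrow> P ^ j dvd F}" by auto
    have "\<Psi> F * of_nat d = (\<Sum>x\<in>{x\<in>PP. case x of (P, j) \<Rightarrow> P ^ j dvd F}. \<Psi> F * of_nat (degree (fst x)))"
      by (subst deg[OF F]) (simp add: s sum_distrib_left case_prod_unfold)
    also have "\<dots> = (\<Sum>x\<in>PP. if (case x of (P, j) \<Rightarrow> P ^ j dvd F) then \<Psi> F * of_nat (degree (fst x)) else 0)"
      by (rule sum.inter_filter[OF finPP])
    finally show "\<Psi> F * of_nat d = (\<Sum>(P, j)\<in>PP. if P ^ j dvd F then \<Psi> F * of_nat (degree P) else 0)"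
      by (simp add: case_prod_unfold)
  qed
  also have "\<dots> = (\<Sum>(P, j)\<in>PP. \<Sum>F\<in>monic_unit d. if P ^ j dvd F then \<Psi> F * of_nat (degree P) else 0)"
    by (subst sum.swap) (simp add: case_prod_unfold)
  also have "\<dots> = (\<Sum>(P, j)\<in>PP. of_nat (degree P) * (\<Psi> P ^ j * degree_sum \<Psi> (d - j * degree P)))"
  proof (rule sum.cong[OF refl], clarify)
    fix P j assume PP: "(P, j) \<in> PP"
    have "(\<Sum>F\<in>monic_unit d. if P ^ j dvd F then \<Psi> F * of_nat (degree P) else 0)
        = (\<Sum>F | F \<in> monic_unit d \<and> P ^ j dvd F. \<Psi> F * of_nat (degree P))"
      by (rule sum.inter_filter[symmetric]) simp
    then show "(\<Sum>F\<in>monic_unit d. if P ^ j dvd F then \<Psi> F * of_nat (degree P) else 0)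
        = of_nat (degree P) * (\<Psi> P ^ j * degree_sum \<Psi> (d - j * degree P))"
      using inner[OF PP] by (simp add: sum_distrib_right[symmetric] mult.commute)
  qed
  \<comment> \<open>The prime powers are regrouped by their degree
    \<open>r = j * degree P\<close>.\<close>
  also have "\<dots> = (\<Sum>(r, P)\<in>Sigma {1..d} (\<lambda>r. {P. P \<in> prime_unit \<and> degree P dvd r}).
       of_nat (degree P) * \<Psi> P ^ (r div degree P) * degree_sum \<Psi> (d - r))"
  proof (rule sum.reindex_bij_witness[of _ "\<lambda>(r, P). (P, r div degree P)" "\<lambda>(P, j). (j * degree P, P)"])
    fix x assume "x \<in> PP"
    then obtain P j where x: "x = (P, j)" "P \<in> prime_unit" "1 \<le> j" "j * degree P \<le> d"
      by (auto simp: PP_def)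
    have dp: "degree P > 0" using degpos x by auto
    show "(case case x of (P, j) \<Rightarrow> (j * degree P, P) of (r, P) \<Rightarrow> (P, r div degree P)) = x"
      using dp x by simp
    show "(case x of (P, j) \<Rightarrow> (j * degree P, P)) \<in> Sigma {1..d} (\<lambda>r. {P. P \<in> prime_unit \<and> degree P dvd r})"
      using dp x by (simp add: Suc_le_eq)
    show "(case case x of (P, j) \<Rightarrow> (j * degree P, P) of (r, P) \<Rightarrow>
        of_nat (degree P) * \<Psi> P ^ (r div degree P) * degree_sum \<Psi> (d - r)) =
        (case x of (P, j) \<Rightarrow> of_nat (degree P) * (\<Psi> P ^ j * degree_sum \<Psi> (d - j * degree P)))"
      using dp x by simp
  next
    fix y :: "nat \<times> 'a mod_ring poly" assume "y \<in> Sigma {1..d} (\<lambda>r. {P. P \<in> prime_unit \<and> degree P dvd r})"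
    then obtain r P where y: "y = (r, P)" "1 \<le> r" "r \<le> d" "P \<in> prime_unit" "degree P dvd r" by auto
    show "(case case y of (r, P) \<Rightarrow> (P, r div degree P) of (P, j) \<Rightarrow> (j * degree P, P)) = y"
      using y by simp
    show "(case y of (r, P) \<Rightarrow> (P, r div degree P)) \<in> PP"
      using y degpos[of P] by (auto simp: PP_def Suc_le_eq div_greater_zero_iff dvd_imp_le)
  qed
  also have "\<dots> = (\<Sum>r\<in>{1..d}. \<Sum>P | P \<in> prime_unit \<and> degree P dvd r.
       of_nat (degree P) * \<Psi> P ^ (r div degree P) * degree_sum \<Psi> (d - r))"
    by (subst sum.Sigma) (auto intro: finite_prime_unit_dvd)
  finally show ?thesis
    by (simp add: point_sum_def sum_distrib_right)
qed

section \<open>Frobenius orbits of roots\<close>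

text \<open>For monic F with nonzero roots this is the sum of \<open>y + \<nu> / y\<close> over the
  roots y with multiplicity. \<open>reflect_poly\<close> supplies the coefficient below the leading
  one and gives 0 in degree 0, where \<open>coeff F (degree F - 1)\<close> would give 1.\<close>

definition trace_coeff :: "'a::field \<Rightarrow> 'a poly \<Rightarrow> 'a" where
  "trace_coeff \<nu> F = - coeff (reflect_poly F) 1 - \<nu> * coeff F 1 / coeff F 0"

lemma coeff_mult_1: "coeff (F * G) 1 = coeff F 0 * coeff G 1 + coeff F 1 * coeff G (0::nat)"
  by (simp add: coeff_mult)

lemma trace_coeff_mult:
  fixes F G :: "'a::field poly"
  assumes "lead_coeff F = 1" "lead_coeff G = 1" "coeff F 0 \<noteq> 0" "coeff G 0 \<noteq> 0"
  shows "trace_coeff \<nu> (F * G) = trace_coeff \<nu> F + trace_coeff \<nu> G"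
proof -
  have "coeff (reflect_poly (F * G)) 1 = coeff (reflect_poly G) 1 + coeff (reflect_poly F) 1"
    using assms by (simp only: reflect_poly_mult coeff_mult_1) simp
  moreover have "\<nu> * coeff (F * G) 1 / coeff (F * G) 0 = \<nu> * coeff F 1 / coeff F 0 + \<nu> * coeff G 1 / coeff G 0"
    using assms by (simp only: coeff_mult_1 coeff_mult_0) (simp add: field_simps)
  ultimately show ?thesis by (simp add: trace_coeff_def)
qed

lemma trace_coeff_one: "trace_coeff \<nu> 1 = 0"
  by (simp add: trace_coeff_def)

lemma trace_coeff_linear: "y \<noteq> 0 \<Longrightarrow> trace_coeff \<nu> [:- y, 1:] = y + \<nu> / (y :: 'a::field)"
  by (simp add: trace_coeff_def coeff_reflect_poly)

lemma trace_coeff_prod_linear: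
  fixes y :: "nat \<Rightarrow> 'a::field"
  assumes "\<And>i. y i \<noteq> 0"
  shows "trace_coeff \<nu> (\<Prod>i<e. [:- y i, 1:]) = (\<Sum>i<e. y i + \<nu> / y i)"
proof (induction e)
  case (Suc e)
  have "lead_coeff (\<Prod>i<e. [:- y i, 1:]) = 1" by (simp add: lead_coeff_prod)
  moreover have "coeff (\<Prod>i<e. [:- y i, 1:]) 0 \<noteq> 0"
    using assms by (simp flip: poly_0_coeff_0 add: poly_prod)
  ultimately show ?case
    using assms Suc
    by (simp add: trace_coeff_mult trace_coeff_linear del: mult_pCons_left mult_pCons_right)
qed (simp add: trace_coeff_one)

lemma trace_coeff_to_ac:
  "trace_coeff (to_ac \<nu>) (map_poly to_ac F) = to_ac (trace_coeff \<nu> F)"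
  by (simp add: trace_coeff_def coeff_reflect_poly coeff_map_poly degree_map_poly)

lemma prime_CHAR_ac: "prime CHAR('a::prime_card mod_ring alg_closure)"
  by (simp add: prime_card)

lemma CHAR_ac: "CHAR('a::prime_card mod_ring alg_closure) = CARD('a)"
  by simp

lemma frobenius_add:
  fixes x y :: "'a::prime_card mod_ring alg_closure"
  shows "(x + y) ^ (CARD('a) ^ i) = x ^ (CARD('a) ^ i) + y ^ (CARD('a) ^ i)"
  by (rule freshmans_dream'[OF prime_CHAR_ac]) (simp add: CHAR_ac)

lemma frobenius_sum:
  fixes f :: "'b \<Rightarrow> 'a::prime_card mod_ring alg_closure"
  shows "(\<Sum>x\<in>A. f x) ^ (CARD('a) ^ i) = (\<Sum>x\<in>A. f x ^ (CARD('a) ^ i))"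
  by (rule freshmans_dream_sum'[OF prime_CHAR_ac]) (simp add: CHAR_ac)

lemma frobenius_diff:
  fixes x y :: "'a::prime_card mod_ring alg_closure"
  shows "(x - y) ^ (CARD('a) ^ i) = x ^ (CARD('a) ^ i) - y ^ (CARD('a) ^ i)"
  using frobenius_add[of "x - y" y i] by (simp add: algebra_simps)

lemma mod_ring_frobenius: "(c :: 'a::prime_card mod_ring) ^ (CARD('a) ^ i) = c"
proof (induction i)
  case (Suc i)
  have "c ^ (CARD('a) ^ Suc i) = (c ^ (CARD('a) ^ i)) ^ CARD('a mod_ring)"
    by (simp add: power_mult[symmetric] mult.commute)
  also have "\<dots> = c" by (simp only: finite_field_power_card_eq_same Suc)
  finally show ?case .
qed simp

lemma to_ac_frobenius: "to_ac (c :: 'a::prime_card mod_ring) ^ (CARD('a) ^ i) = to_ac c"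
  by (metis mod_ring_frobenius to_ac_power)

text \<open>The prime field already supplies p roots of X^p - X, so this polynomial has no
  others.\<close>

lemma frobenius_fixed_imp_to_ac:
  fixes c :: "'a::prime_card mod_ring alg_closure"
  assumes "c ^ CARD('a) = c"
  shows "c \<in> range to_ac"
proof -
  define p where "p = CARD('a)"
  have p2: "p \<ge> 2" unfolding p_def using prime_card prime_ge_2_nat by blast
  define R :: "'a mod_ring alg_closure poly" where "R = monom 1 p - monom 1 1"
  have "coeff R p = 1" using p2 by (simp add: R_def)
  then have R0: "R \<noteq> 0" by auto
  have "degree R \<le> p" unfolding R_def by (intro degree_diff_le) (use p2 in \<open>auto simp: degree_monom_eq\<close>)
  then have "card {y. poly R y = 0} \<le> p" using card_poly_roots_bound[OF R0] by linarith
  moreover have "range to_ac \<subseteq> {y. poly R y = 0}"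
    using to_ac_frobenius[of _ 1] by (auto simp: R_def poly_monom p_def)
  moreover have "card (range (to_ac :: 'a mod_ring \<Rightarrow> _)) = p"
    by (simp add: card_image inj_to_ac p_def)
  ultimately have "range to_ac = {y. poly R y = 0}"
    using poly_roots_finite[OF R0] by (intro card_seteq) auto
  moreover have "poly R c = 0" using assms by (simp add: R_def poly_monom p_def)
  ultimately show ?thesis by blast
qed

lemma poly_to_ac_frobenius:
  fixes F :: "'a::prime_card mod_ring poly"
  shows "poly (map_poly to_ac F) x ^ (CARD('a) ^ i) = poly (map_poly to_ac F) (x ^ (CARD('a) ^ i))"
  unfolding poly_altdef
  by (simp add: frobenius_sum power_mult_distrib coeff_map_poly to_ac_frobenius degree_map_poly)
     (simp add: power_mult[symmetric] mult.commute)

interpretation to_ac_poly: map_poly_comm_ring_hom "to_ac :: 'a::field \<Rightarrow> 'a alg_closure"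
  by unfold_locales auto

text \<open>Otherwise a Bezout identity for P and F, carried to the algebraic closure and evaluated
  at the common root, would read 0 = 1.\<close>

lemma prime_dvd_if_common_root:
  fixes P F :: "'a::prime_card mod_ring poly"
  assumes P: "prime P" and "poly (map_poly to_ac P) x = 0" "poly (map_poly to_ac F) x = 0"
  shows "P dvd F"
proof (rule ccontr)
  assume "\<not> P dvd F"
  then have "coprime P F" using P by (simp add: prime_imp_coprime)
  then obtain a b where "a * P + b * F = 1"
    using bezout_coefficients_fst_snd[of P F] by (metis coprime_imp_gcd_eq_1)
  then have "map_poly to_ac (a * P + b * F) = 1" by (simp add: to_ac_poly.hom_one)
  then have "map_poly to_ac a * map_poly to_ac P + map_poly to_ac b * map_poly to_ac F = 1"
    by (simp only: to_ac_poly.hom_add to_ac_poly.hom_mult)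
  then have "poly (map_poly to_ac a * map_poly to_ac P + map_poly to_ac b * map_poly to_ac F) x = 1"
    by simp
  then show False using assms by simp
qed

text \<open>The minimal polynomial of a root x over the prime field is the product over the
  Frobenius orbit of x. That product is fixed by Frobenius, so its coefficients lie in the prime
  field and P divides it; conversely the orbit consists of roots of P, so the degrees agree.\<close>

lemma prime_poly_frobenius_orbit:
  fixes P :: "'a::prime_card mod_ring poly"
  assumes P: "prime P" "coeff P 0 \<noteq> 0"
  obtains x where "x \<noteq> 0" "poly (map_poly to_ac P) x = 0" "x ^ (CARD('a) ^ degree P) = x"
    "map_poly to_ac P = (\<Prod>i<degree P. [:- (x ^ (CARD('a) ^ i)), 1:])"
proof -
  define p where "p = CARD('a)"
  define q where "q = map_poly to_ac P"
  have degq: "degree q = degree P" by (simp add: q_def degree_map_poly)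
  have "degree P > 0" using P prime_poly_degree_pos by blast
  then obtain x where x: "poly q x = 0"
    using alg_closed_imp_poly_has_root[of q] degq by auto
  have q0: "q \<noteq> 0" using degq \<open>degree P > 0\<close> by auto
  have x0: "x \<noteq> 0"
  proof
    assume "x = 0"
    then have "coeff q 0 = 0" using x by (simp add: poly_0_coeff_0)
    then show False using P by (simp add: q_def coeff_map_poly)
  qed
  have roots: "poly q (x ^ (p ^ i)) = 0" for i
    using poly_to_ac_frobenius[of P x i] x by (simp add: q_def p_def power_0_left)
  \<comment> \<open>Frobenius is injective, so the orbit is purely periodic and returns to x
    itself.\<close>
  have cancel: "x ^ (p ^ (j - i)) = x" if "x ^ (p ^ i) = x ^ (p ^ j)" "i \<le> j" for i j
  proof -
    have "(x ^ (p ^ (j - i)) - x) ^ (p ^ i) = x ^ (p ^ j) - x ^ (p ^ i)"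
      unfolding p_def frobenius_diff using that(2)
      by (simp add: power_mult[symmetric] power_add[symmetric])
    then show ?thesis using that(1) by simp
  qed
  have "\<not> inj (\<lambda>i. x ^ (p ^ i))"
  proof
    assume "inj (\<lambda>i. x ^ (p ^ i))"
    then have "infinite (range (\<lambda>i. x ^ (p ^ i)))" by (simp add: range_inj_infinite)
    moreover have "range (\<lambda>i. x ^ (p ^ i)) \<subseteq> {y. poly q y = 0}" using roots by auto
    ultimately show False using poly_roots_finite[OF q0] finite_subset by blast
  qed
  then obtain i j where "x ^ (p ^ i) = x ^ (p ^ j)" "i < j"
    by (auto simp: inj_def) (metis linorder_neqE_nat)
  then have ex: "\<exists>e>0. x ^ (p ^ e) = x" using cancel[of i j] by (intro exI[of _ "j - i"]) auto
  define e where "e = (LEAST e. e > 0 \<and> x ^ (p ^ e) = x)"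
  have e: "e > 0" "x ^ (p ^ e) = x"
    using LeastI_ex[OF ex] by (auto simp: e_def)
  have emin: "e \<le> k" if "k > 0" "x ^ (p ^ k) = x" for k
    unfolding e_def using that by (intro Least_le) auto
  have inj: "inj_on (\<lambda>i. x ^ (p ^ i)) {..<e}"
  proof (rule linorder_inj_onI')
    fix i j assume *: "i \<in> {..<e}" "j \<in> {..<e}" "i < j"
    show "x ^ (p ^ i) \<noteq> x ^ (p ^ j)"
    proof
      assume "x ^ (p ^ i) = x ^ (p ^ j)"
      then have "e \<le> j - i" using cancel[of i j] * by (intro emin) auto
      then show False using * by auto
    qed
  qed
  have "e = card ((\<lambda>i. x ^ (p ^ i)) ` {..<e})" using inj by (simp add: card_image)
  also have "\<dots> \<le> card {y. poly q y = 0}"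
    using roots by (intro card_mono poly_roots_finite[OF q0]) auto
  also have "\<dots> \<le> degree P" using card_poly_roots_bound[OF q0] degq by simp
  finally have e_le: "e \<le> degree P" .
  define m where "m = (\<Prod>i<e. [:- (x ^ (p ^ i)), 1:])"
  \<comment> \<open>Frobenius acting on coefficients: it permutes the linear factors of
    \<open>m\<close> cyclically.\<close>
  interpret fr: map_poly_comm_ring_hom "\<lambda>c :: 'a mod_ring alg_closure. c ^ p"
    by unfold_locales (use frobenius_add[of _ _ 1] in \<open>auto simp: p_def power_mult_distrib\<close>)
  have "map_poly (\<lambda>c. c ^ p) m = (\<Prod>i<e. map_poly (\<lambda>c. c ^ p) [:- (x ^ (p ^ i)), 1:])"
    unfolding m_def by (simp add: fr.hom_prod)
  also have "\<dots> = (\<Prod>i<e. [:- (x ^ (p ^ Suc i)), 1:])"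
  proof (rule prod.cong[OF refl])
    fix i
    have "(- (x ^ (p ^ i))) ^ p = - (x ^ (p ^ Suc i))"
      using frobenius_diff[of 0 "x ^ (p ^ i)" 1] by (simp add: p_def power_mult[symmetric] power_0_left mult.commute)
    then show "map_poly (\<lambda>c. c ^ p) [:- (x ^ (p ^ i)), 1:] = [:- (x ^ (p ^ Suc i)), 1:]"
      by (simp add: map_poly_pCons p_def)
  qed
  also have "\<dots> = m"
  proof -
    define g where "g i = [:- (x ^ (p ^ i)), 1:]" for i
    have "g 0 * (\<Prod>i<e. g (Suc i)) = (\<Prod>i<Suc e. g i)" by (simp only: prod.lessThan_Suc_shift)
    also have "\<dots> = (\<Prod>i<e. g i) * g e" by simp
    also have "g e = g 0" using e by (simp add: g_def)
    finally have "g 0 * (\<Prod>i<e. g (Suc i)) = g 0 * (\<Prod>i<e. g i)" by (simp only: mult.commute)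
    moreover have "g 0 \<noteq> 0" by (simp add: g_def)
    ultimately have "(\<Prod>i<e. g (Suc i)) = (\<Prod>i<e. g i)" by (metis mult_left_cancel)
    then show ?thesis by (simp only: m_def g_def)
  qed
  finally have fixm: "map_poly (\<lambda>c. c ^ p) m = m" .
  have "coeff m k \<in> range to_ac" for k
  proof (rule frobenius_fixed_imp_to_ac)
    have "coeff (map_poly (\<lambda>c. c ^ p) m) k = coeff m k ^ p" by (rule coeff_map_poly) (simp add: p_def)
    then show "coeff m k ^ CARD('a) = coeff m k" using fixm by (simp add: p_def)
  qed
  then have mac: "map_poly to_ac (map_poly of_ac m) = m"
    by (intro poly_eqI) (simp add: coeff_map_poly to_ac_of_ac)
  define m0 where "m0 = map_poly of_ac m"
  have degm: "degree m = e" by (simp add: m_def degree_prod_eq_sum_degree)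
  have lm: "lead_coeff m = 1" by (simp add: m_def lead_coeff_prod)
  have degm0: "degree m0 = e" 
    using degm degree_map_poly[of to_ac m0] by (simp add: m0_def mac)
  have lm0: "lead_coeff m0 = 1"
    using lm degm degm0 coeff_map_poly[of to_ac m0 e] by (simp add: m0_def mac)
  have "poly m x = 0"
    unfolding m_def poly_prod using e(1) by (intro prod_zero) (auto intro!: bexI[of _ 0])
  then have "poly (map_poly to_ac m0) x = 0" by (simp add: m0_def mac)
  then have "P dvd m0" using prime_dvd_if_common_root[OF P(1) x[unfolded q_def]] by blast
  then obtain r where r: "m0 = P * r" by (rule dvdE)
  have r0: "r \<noteq> 0" "P \<noteq> 0" using r lm0 by auto
  then have "e = degree P + degree r" using r degm0 by (simp add: degree_mult_eq)
  then have eP: "e = degree P" and "degree r = 0" using e_le by auto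
  moreover have "lead_coeff r = 1" using r lm0 prime_poly_monic[OF P(1)] by (simp add: lead_coeff_mult)
  ultimately have "r = 1" by (metis degree_0_id one_poly_eq_simps(1) pCons_one)
  then have "q = m" using r mac by (simp add: q_def m0_def)
  show ?thesis
    by (rule that[of x]) (use x0 x e eP \<open>q = m\<close> in \<open>auto simp: q_def m_def p_def\<close>)
qed

lemma sum_periodic_blocks:
  fixes g :: "nat \<Rightarrow> 'a::comm_semiring_1"
  assumes "\<And>i. g (i + d) = g i"
  shows "(\<Sum>i<m * d. g i) = of_nat m * (\<Sum>i<d. g i)"
proof (induction m)
  case (Suc m)
  have per: "g (m * d + i) = g i" for i
  proof (induction m)
    case (Suc m) then show ?case using assms[of "m * d + i"] by (simp add: add_ac)
  qed simp
  have "(\<Sum>i<Suc m * d. g i) = (\<Sum>i<m * d. g i) + (\<Sum>i<d. g (m * d + i))"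
    using sum.nat_group[of g d "Suc m"] sum.nat_group[of g d m]
    by (simp add: sum.shift_bounds_nat_ivl[of g 0 "m * d" d, simplified] lessThan_atLeast0 add.commute)
  then show ?case using Suc per by (simp add: algebra_simps)
qed simp

text \<open>x lies in the field with p^r elements, and the left-hand sum is the trace of
  \<open>x + \<nu> / x\<close> down to the prime field. The Frobenius orbit of x has length
  \<open>degree P\<close> and is run through \<open>r div degree P\<close> times.\<close>

lemma prime_poly_root_trace:
  fixes P :: "'a::prime_card mod_ring poly"
  assumes P: "P \<in> prime_unit" and r: "degree P dvd r"
  obtains x where "x \<noteq> 0" "poly (map_poly to_ac P) x = 0" "x ^ (CARD('a) ^ r) = x"
    "(\<Sum>i<r. (x + to_ac \<nu> / x) ^ (CARD('a) ^ i)) = to_ac (of_nat (r div degree P) * trace_coeff \<nu> P)"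
proof -
  define p where "p = CARD('a)"
  have P': "prime P" "coeff P 0 \<noteq> 0" using P by (auto simp: prime_unit_def)
  from prime_poly_frobenius_orbit[OF this] obtain x where x: "x \<noteq> 0" "poly (map_poly to_ac P) x = 0"
    "x ^ (p ^ degree P) = x" "map_poly to_ac P = (\<Prod>i<degree P. [:- (x ^ (p ^ i)), 1:])"
    unfolding p_def by metis
  define g where "g i = (x + to_ac \<nu> / x) ^ (p ^ i)" for i
  have g: "g i = x ^ (p ^ i) + to_ac \<nu> / x ^ (p ^ i)" for i
    unfolding g_def p_def frobenius_add by (simp add: power_divide to_ac_frobenius)
  have per: "g (i + degree P) = g i" for i
  proof -
    have "x ^ (p ^ (i + degree P)) = (x ^ (p ^ degree P)) ^ (p ^ i)"
      by (simp add: power_mult[symmetric] power_add mult.commute)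
    then show ?thesis using x(3) by (simp add: g)
  qed
  obtain m where m: "r = m * degree P" using r by (metis dvd_def mult.commute)
  have dpos: "degree P > 0" using P' prime_poly_degree_pos by blast
  have "(\<Sum>i<degree P. g i) = trace_coeff (to_ac \<nu>) (map_poly to_ac P)"
    unfolding x(4) using x(1) by (subst trace_coeff_prod_linear) (simp_all add: g)
  also have "\<dots> = to_ac (trace_coeff \<nu> P)" by (rule trace_coeff_to_ac)
  finally have "(\<Sum>i<r. g i) = to_ac (of_nat (r div degree P) * trace_coeff \<nu> P)"
    using sum_periodic_blocks[of g "degree P" m, OF per] m dpos by simp
  moreover have "x ^ (p ^ r) = x"
  proof -
    have "x ^ (p ^ (k * degree P)) = x" for k
    proof (induction k)
      case (Suc k)
      have "x ^ (p ^ (Suc k * degree P)) = (x ^ (p ^ degree P)) ^ (p ^ (k * degree P))"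
        by (simp add: power_mult[symmetric] power_add mult.commute)
      then show ?case using Suc x(3) by simp
    qed simp
    then show ?thesis using m by simp
  qed
  ultimately show ?thesis using that[of x] x by (simp add: g_def p_def)
qed

section \<open>Stepanov's bound for the number of points of given trace\<close>

text \<open>Distinct degrees make the family linearly independent: the largest index with a nonzero
  coefficient fixes the leading term.\<close>

lemma sum_ne_0_if_increasing_degree:
  fixes E :: "nat \<Rightarrow> 'a::idom poly"
  assumes deg: "\<And>N. N < U \<Longrightarrow> degree (E N) = N + d" and nz: "\<And>N. N < U \<Longrightarrow> E N \<noteq> 0"
    and \<alpha>: "N0 < U" "\<alpha> N0 \<noteq> 0"
  shows "(\<Sum>N<U. smult (\<alpha> N) (E N)) \<noteq> 0"
proof -
  define M where "M = Max {N. N < U \<and> \<alpha> N \<noteq> 0}"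
  have fin: "finite {N. N < U \<and> \<alpha> N \<noteq> 0}" by auto
  have "M \<in> {N. N < U \<and> \<alpha> N \<noteq> 0}"
    unfolding M_def using \<alpha> by (intro Max_in[OF fin]) auto
  then have M: "M < U" "\<alpha> M \<noteq> 0" by auto
  have gt: "\<alpha> N = 0" if "N < U" "N > M" for N
    using Max_ge[OF fin, of N] that by (fastforce simp: M_def)
  have "coeff (\<Sum>N<U. smult (\<alpha> N) (E N)) (M + d) = (\<Sum>N<U. \<alpha> N * coeff (E N) (M + d))"
    by (simp add: coeff_sum)
  also have "\<dots> = (\<Sum>N\<in>{M}. \<alpha> N * coeff (E N) (M + d))"
  proof (rule sum.mono_neutral_right)
    show "\<forall>N\<in>{..<U} - {M}. \<alpha> N * coeff (E N) (M + d) = 0"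
    proof
      fix N assume N: "N \<in> {..<U} - {M}"
      show "\<alpha> N * coeff (E N) (M + d) = 0"
      proof (cases "N > M")
        case True then show ?thesis using gt N by auto
      next
        case False
        then have "degree (E N) < M + d" using deg N by auto
        then show ?thesis by (simp add: coeff_eq_0)
      qed
    qed
  qed (use M in auto)
  also have "\<dots> = \<alpha> M * lead_coeff (E M)" using deg M by simp
  also have "\<dots> \<noteq> 0" using nz M by auto
  finally show ?thesis by auto
qed

text \<open>There are more polynomials than the dimension of the space that holds them. Over a
  finite field two coefficient vectors with the same image exist by counting, and their difference
  is the relation.\<close>

lemma poly_pigeonhole:
  fixes Z :: "nat \<Rightarrow> 'a::prime_card mod_ring poly"
  assumes "\<And>N. N < U \<Longrightarrow> degree (Z N) < D" and "D < U"
  obtains \<alpha> N0 where "N0 < U" "\<alpha> N0 \<noteq> 0" "(\<Sum>N<U. smult (\<alpha> N) (Z N)) = 0"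
proof -
  define \<Phi> where "\<Phi> \<alpha> = (\<lambda>i\<in>{..<D}. coeff (\<Sum>N<U. smult (\<alpha> N) (Z N)) i)" for \<alpha> :: "nat \<Rightarrow> 'a mod_ring"
  let ?A = "PiE {..<U} (\<lambda>_. UNIV :: 'a mod_ring set)" and ?B = "PiE {..<D} (\<lambda>_. UNIV :: 'a mod_ring set)"
  have p: "CARD('a) > 1" using prime_card prime_gt_1_nat by blast
  have "card ?B < card ?A" using assms(2) p by (simp add: card_PiE)
  moreover have "\<Phi> ` ?A \<subseteq> ?B" by (auto simp: \<Phi>_def)
  moreover have "finite ?A" "finite ?B" by (auto intro: finite_PiE)
  ultimately have "\<not> inj_on \<Phi> ?A" by (metis card_inj_on_le leD)
  then obtain \<beta> \<gamma> where bg: "\<beta> \<in> ?A" "\<gamma> \<in> ?A" "\<Phi> \<beta> = \<Phi> \<gamma>" "\<beta> \<noteq> \<gamma>" by (auto simp: inj_on_def)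
  define \<alpha> where "\<alpha> N = \<beta> N - \<gamma> N" for N
  have "\<exists>N0<U. \<beta> N0 \<noteq> \<gamma> N0"
  proof (rule ccontr)
    assume "\<not> ?thesis"
    then have "\<beta> = \<gamma>" using bg(1,2) by (intro PiE_ext) auto
    then show False using bg by simp
  qed
  then obtain N0 where N0: "N0 < U" "\<alpha> N0 \<noteq> 0" by (auto simp: \<alpha>_def)
  have "(\<Sum>N<U. smult (\<alpha> N) (Z N)) = 0"
  proof (rule poly_eqI)
    fix i
    have eq: "(\<Sum>N<U. smult (\<alpha> N) (Z N)) = (\<Sum>N<U. smult (\<beta> N) (Z N)) - (\<Sum>N<U. smult (\<gamma> N) (Z N))"
      by (simp add: \<alpha>_def smult_diff_left sum_subtractf)
    show "coeff (\<Sum>N<U. smult (\<alpha> N) (Z N)) i = coeff 0 i"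
    proof (cases "i < D")
      case True
      then have "coeff (\<Sum>N<U. smult (\<beta> N) (Z N)) i = coeff (\<Sum>N<U. smult (\<gamma> N) (Z N)) i"
        using fun_cong[OF bg(3), of i] by (simp add: \<Phi>_def)
      then show ?thesis unfolding eq by simp
    next
      case False
      then have "coeff (Z N) i = 0" if "N < U" for N using assms(1)[OF that] by (simp add: coeff_eq_0)
      then show ?thesis by (simp add: coeff_sum)
    qed
  qed
  then show ?thesis using that N0 by blast
qed

text \<open>At a point x of trace c, let Q = p^s and let \<eta> be the first half of the trace sum.
  Then \<open>\<eta> ^ Q = to_ac c - \<eta>\<close> and \<open>x ^ (Q * Q) = x\<close>, so the Q-th
  power of a combination of terms x^a \<eta>^v x^(j Q) equals a combination of much lower degree.
  The coefficients are chosen to make the latter vanish identically; then the former vanishes at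
  every such point without being the zero polynomial.\<close>

lemma stepanov_polynomial:
  fixes \<nu> c :: "'a::prime_card mod_ring" and s :: nat
  assumes s: "s > 0"
  obtains R :: "'a mod_ring poly" where "R \<noteq> 0"
    "degree R \<le> CARD('a) ^ (2 * s - 1) + 5 * CARD('a) ^ s"
    "\<And>x. x \<noteq> 0 \<Longrightarrow> x ^ (CARD('a) ^ (2 * s)) = x \<Longrightarrow>
       (\<Sum>i<2 * s. (x + to_ac \<nu> / x) ^ (CARD('a) ^ i)) = to_ac c \<Longrightarrow> poly (map_poly to_ac R) x = 0"
proof -
  define p where "p = CARD('a)"
  have p2: "p \<ge> 2" unfolding p_def using prime_card prime_ge_2_nat by blast
  define K where "K = p ^ (s - 1)"
  define Q where "Q = p ^ s"
  have Q: "Q = p * K" using s by (simp add: Q_def K_def power_eq_if)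
  have K0: "K > 0" using p2 by (simp add: K_def)
  \<comment> \<open>\<open>U\<close> counts the unknowns and \<open>D\<close> the conditions. Their
    common main term is \<open>K * Q\<close>; the surplus 4 in \<open>J\<close> makes
    \<open>D < U\<close> and adds only a multiple of \<open>Q\<close> to the degree of
    \<open>R\<close>.\<close>
  define J where "J = K + 4"
  define U where "U = Q * J"
  define D where "D = K * Q + Q + J"
  have "2 * K \<le> Q" using p2 Q by simp
  then have DU: "D < U" using K0 by (simp add: D_def U_def J_def algebra_simps)
  \<comment> \<open>\<open>h = X\<^sup>K \<Sum>\<^sub>i\<^sub><\<^sub>s (X + \<nu>/X)^(p^i)\<close>, a polynomial since \<open>p^i \<le> K\<close>\<close>
  define h :: "'a mod_ring poly" where "h = (\<Sum>i<s. monom 1 (K + p ^ i) + monom \<nu> (K - p ^ i))"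
  have pK: "p ^ i \<le> K" if "i < s" for i
    unfolding K_def using that p2 by (intro power_increasing) auto
  have hdeg_le: "degree h \<le> 2 * K"
    unfolding h_def
  proof (intro degree_sum_le degree_add_le)
    fix i assume "i \<in> {..<s}"
    then show "degree (monom 1 (K + p ^ i) :: 'a mod_ring poly) \<le> 2 * K" using pK[of i]
      by (intro order_trans[OF degree_monom_le]) auto
    show "degree (monom \<nu> (K - p ^ i)) \<le> 2 * K"
      by (intro order_trans[OF degree_monom_le]) auto
  qed simp
  have "coeff h (2 * K) = (\<Sum>i<s. if i = s - 1 then 1 else 0)"
    unfolding h_def coeff_sum
  proof (rule sum.cong[OF refl])
    fix i assume i: "i \<in> {..<s}"
    have "p ^ i = K \<longleftrightarrow> i = s - 1"
      unfolding K_def using p2 by (simp add: power_inject_exp)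
    then have "K + p ^ i = 2 * K \<longleftrightarrow> i = s - 1" by auto
    moreover have "K - p ^ i \<noteq> 2 * K" using K0 by auto
    ultimately show "coeff (monom 1 (K + p ^ i) + monom \<nu> (K - p ^ i)) (2 * K) = (if i = s - 1 then 1 else 0)"
      by simp
  qed
  also have "\<dots> = 1" using s by simp
  finally have hc: "coeff h (2 * K) = 1" .
  then have hdeg: "degree h = 2 * K" using hdeg_le le_degree[of h "2 * K"] by force
  have h0: "h \<noteq> 0" using hc by auto
  \<comment> \<open>The index is read in mixed radix,
    \<open>N = N mod K + K * v N + Q * j N\<close>, and for \<open>N < U\<close> the digits lie
    below \<open>K\<close>, \<open>p\<close> and \<open>J\<close>.\<close>
  define v where "v N = (N div K) mod p" for N
  define j where "j N = (N div K) div p" for N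
  \<comment> \<open>The padding \<open>monom 1 (K * (p - 1 - v N))\<close> completes the factor x^K
    hidden in each \<open>h\<close> to \<open>x ^ (K * (p - 1))\<close> for every N. As
    \<open>h\<close> has degree \<open>2 * K\<close>, the degree of \<open>E N\<close> is exactly N
    plus a constant.\<close>
  define E where "E N = monom 1 (N mod K) * h ^ v N * monom 1 (K * (p - 1 - v N)) * monom 1 (j N * Q)" for N
  \<comment> \<open>Up to the same factor \<open>x ^ (K * (p - 1))\<close>, the value at a point of
    trace c of the Q-th power of the unpadded term of \<open>E N\<close>.\<close>
  define Z where "Z N = monom 1 ((N mod K) * Q) * (monom c K - h) ^ v N * monom 1 (K * (p - 1 - v N)) * monom 1 (j N)" for N
  have vlt: "v N < p" for N using p2 by (simp add: v_def)
  have Kv: "K * v N + K * (p - 1 - v N) = K * (p - 1)" for N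
  proof -
    have "v N + (p - 1 - v N) = p - 1" using vlt[of N] by simp
    then show ?thesis by (metis add_mult_distrib2)
  qed
  have Ndec: "N = N mod K + K * v N + Q * j N" for N
  proof -
    have "N div K = p * j N + v N" by (simp add: v_def j_def)
    then have "N = N mod K + K * (p * j N + v N)" by (metis mod_mult_div_eq add.commute mult.commute div_mult_mod_eq)
    then show ?thesis by (simp add: Q algebra_simps)
  qed
  have Edeg: "degree (E N) = N + K * (p - 1)" and E0: "E N \<noteq> 0" for N
  proof -
    show "E N \<noteq> 0" using h0 by (simp add: E_def monom_eq_0_iff)
    have "degree (E N) = N mod K + v N * (2 * K) + K * (p - 1 - v N) + j N * Q"
      unfolding E_def using h0
      by (simp add: degree_mult_eq degree_power_eq monom_eq_0_iff degree_monom_eq hdeg)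
    also have "\<dots> = (N mod K + K * v N + Q * j N) + (K * v N + K * (p - 1 - v N))"
      by (simp only: algebra_simps mult_2 mult_2_right)
    also have "\<dots> = (N mod K + K * v N + Q * j N) + K * (p - 1)"
      by (simp only: Kv)
    also have "\<dots> = N + K * (p - 1)" using Ndec[of N] by simp
    finally show "degree (E N) = N + K * (p - 1)" .
  qed
  have Zdeg: "degree (Z N) < D" if "N < U" for N
  proof -
    have g: "degree (monom c K - h) \<le> 2 * K"
      by (intro degree_diff_le order_trans[OF degree_monom_le]) (use hdeg in auto)
    have jJ: "j N < J"
    proof -
      have "N div K div p < J"
        using that K0 p2 unfolding U_def Q by (simp add: div_mult2_eq[symmetric] less_mult_imp_div_less mult.commute)
      then show ?thesis by (simp add: j_def)
    qed
    have "degree (Z N) \<le> (N mod K) * Q + 2 * K * v N + K * (p - 1 - v N) + j N"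
      unfolding Z_def
      by (intro order_trans[OF degree_mult_le] add_mono order_trans[OF degree_monom_le]
          order_trans[OF degree_power_le] mult_right_mono g) auto
    also have "\<dots> = (N mod K) * Q + K * v N + (K * v N + K * (p - 1 - v N)) + j N" by simp
    also have "K * v N + K * (p - 1 - v N) = K * (p - 1)" by (rule Kv)
    also have "(N mod K) * Q + K * v N + K * (p - 1) + j N < D"
    proof -
      have "N mod K \<le> K - 1" using K0 by (simp add: Suc_leI less_Suc_eq_le[symmetric])
      then have "(N mod K) * Q \<le> (K - 1) * Q" by (rule mult_right_mono) simp
      also have "(K - 1) * Q = K * Q - Q" by (simp add: diff_mult_distrib)
      finally have 1: "(N mod K) * Q + Q \<le> K * Q" using K0 by (cases K) auto
      have 2: "K * v N \<le> Q" using vlt[of N] by (simp add: Q mult.commute)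
      have 3: "K * (p - 1) \<le> Q" by (simp add: Q mult.commute)
      show ?thesis using 1 2 3 jJ unfolding D_def by linarith
    qed
    finally show ?thesis .
  qed
  from poly_pigeonhole[of U Z D, OF Zdeg DU] obtain \<alpha> N0
    where \<alpha>: "N0 < U" "\<alpha> N0 \<noteq> 0" and Z0: "(\<Sum>N<U. smult (\<alpha> N) (Z N)) = 0" by blast
  define R where "R = (\<Sum>N<U. smult (\<alpha> N) (E N))"
  have R0: "R \<noteq> 0" unfolding R_def
    by (rule sum_ne_0_if_increasing_degree[of U E "K * (p - 1)" N0]) (use Edeg E0 \<alpha> in auto)
  have "degree R \<le> U + K * (p - 1)"
    unfolding R_def by (intro degree_sum_le order_trans[OF degree_smult_le]) (auto simp: Edeg)
  also have "\<dots> \<le> K * Q + 5 * Q" by (simp add: U_def J_def Q algebra_simps)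
  also have "K * Q = p ^ (2 * s - 1)" using s by (simp add: K_def Q_def power_add[symmetric] mult_2)
  finally have Rdeg: "degree R \<le> p ^ (2 * s - 1) + 5 * p ^ s" by (simp add: Q_def)
  have van: "poly (map_poly to_ac R) x = 0"
    if x: "x \<noteq> 0" "x ^ (p ^ (2 * s)) = x" "(\<Sum>i<2 * s. (x + to_ac \<nu> / x) ^ (p ^ i)) = to_ac c" for x
  proof -
    define y where "y i = (x + to_ac \<nu> / x) ^ (p ^ i)" for i
    define \<eta> where "\<eta> = (\<Sum>i<s. y i)"
    have y: "y i = x ^ (p ^ i) + to_ac \<nu> / x ^ (p ^ i)" for i
      unfolding y_def p_def frobenius_add by (simp add: power_divide to_ac_frobenius)
    have xQ: "x ^ (Q * Q) = x" using x(2) by (simp add: Q_def power_add[symmetric] mult_2)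
    have "\<eta> ^ Q = (\<Sum>i<s. y i ^ Q)" unfolding \<eta>_def Q_def p_def by (rule frobenius_sum)
    also have "\<dots> = (\<Sum>i<s. y (i + s))"
      by (simp add: y_def Q_def power_mult[symmetric] power_add)
    also have "\<dots> = to_ac c - \<eta>"
    proof -
      have "(\<Sum>i<2 * s. y i) = (\<Sum>i<s. y i) + (\<Sum>i<s. y (i + s))"
        using sum.shift_bounds_nat_ivl[of y 0 s s] sum.atLeastLessThan_concat[of 0 s "2 * s" y]
        by (simp add: lessThan_atLeast0 mult_2)
      then show ?thesis using x(3) by (simp add: \<eta>_def y_def)
    qed
    finally have \<eta>Q: "\<eta> ^ Q = to_ac c - \<eta>" .
    have hx: "poly (map_poly to_ac h) x = x ^ K * \<eta>"
    proof -
      have "poly (map_poly to_ac h) x = (\<Sum>i<s. x ^ (K + p ^ i) + to_ac \<nu> * x ^ (K - p ^ i))"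
        by (simp add: h_def to_ac_poly.hom_sum to_ac_poly.hom_add poly_sum poly_monom map_poly_monom)
      also have "\<dots> = (\<Sum>i<s. x ^ K * y i)"
      proof (rule sum.cong[OF refl])
        fix i assume "i \<in> {..<s}"
        then have e: "x ^ K = x ^ (K - p ^ i) * x ^ (p ^ i)" using pK[of i] by (simp flip: power_add)
        have "x ^ K * y i = x ^ K * x ^ (p ^ i) + x ^ K * (to_ac \<nu> / x ^ (p ^ i))"
          by (simp only: y distrib_left)
        also have "x ^ K * (to_ac \<nu> / x ^ (p ^ i)) = to_ac \<nu> * x ^ (K - p ^ i)"
          unfolding e using x(1) by simp
        finally show "x ^ (K + p ^ i) + to_ac \<nu> * x ^ (K - p ^ i) = x ^ K * y i"
          by (simp only: power_add)
      qed
      finally show ?thesis by (simp add: \<eta>_def sum_distrib_left)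
    qed
    have xK: "(x ^ K) ^ v N * x ^ (K * (p - 1 - v N)) = x ^ (K * (p - 1))" for N
      by (metis Kv power_add power_mult)
    have Ex: "poly (map_poly to_ac (E N)) x = x ^ (K * (p - 1)) * (x ^ (N mod K) * \<eta> ^ v N * x ^ (j N * Q))" for N
    proof -
      have "poly (map_poly to_ac (E N)) x = x ^ (N mod K) * (x ^ K * \<eta>) ^ v N * x ^ (K * (p - 1 - v N)) * x ^ (j N * Q)"
        by (simp add: E_def to_ac_poly.hom_mult to_ac_poly.hom_power map_poly_monom poly_monom poly_power hx)
      also have "\<dots> = ((x ^ K) ^ v N * x ^ (K * (p - 1 - v N))) * (x ^ (N mod K) * \<eta> ^ v N * x ^ (j N * Q))"
        by (simp only: power_mult_distrib mult_ac)
      finally show ?thesis by (simp only: xK)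
    qed
    have Zx: "poly (map_poly to_ac (Z N)) x = x ^ (K * (p - 1)) * (x ^ (N mod K * Q) * (to_ac c - \<eta>) ^ v N * x ^ j N)" for N
    proof -
      have "poly (map_poly to_ac (monom c K - h)) x = x ^ K * (to_ac c - \<eta>)"
        by (simp add: to_ac_poly.hom_minus map_poly_monom poly_monom hx algebra_simps)
      then have "poly (map_poly to_ac (Z N)) x
          = x ^ (N mod K * Q) * (x ^ K * (to_ac c - \<eta>)) ^ v N * x ^ (K * (p - 1 - v N)) * x ^ j N"
        by (simp add: Z_def to_ac_poly.hom_mult to_ac_poly.hom_power map_poly_monom poly_monom poly_power)
      also have "\<dots> = ((x ^ K) ^ v N * x ^ (K * (p - 1 - v N))) * (x ^ (N mod K * Q) * (to_ac c - \<eta>) ^ v N * x ^ j N)"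
        by (simp only: power_mult_distrib mult_ac)
      finally show ?thesis by (simp only: xK)
    qed
    define W where "W = (\<Sum>N<U. to_ac (\<alpha> N) * (x ^ (N mod K) * \<eta> ^ v N * x ^ (j N * Q)))"
    have "W ^ Q = (\<Sum>N<U. (to_ac (\<alpha> N) * (x ^ (N mod K) * \<eta> ^ v N * x ^ (j N * Q))) ^ Q)"
      unfolding W_def Q_def p_def by (rule frobenius_sum)
    also have "\<dots> = (\<Sum>N<U. to_ac (\<alpha> N) * (x ^ (N mod K * Q) * (to_ac c - \<eta>) ^ v N * x ^ j N))"
    proof (rule sum.cong[OF refl])
      fix N
      have "to_ac (\<alpha> N) ^ Q = to_ac (\<alpha> N)" unfolding Q_def p_def by (rule to_ac_frobenius)
      moreover have "(x ^ (N mod K)) ^ Q = x ^ (N mod K * Q)" by (simp add: power_mult)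
      moreover have "(\<eta> ^ v N) ^ Q = (to_ac c - \<eta>) ^ v N" by (metis \<eta>Q power_mult mult.commute)
      moreover have "(x ^ (j N * Q)) ^ Q = x ^ j N"
        by (metis xQ power_mult mult.assoc mult.commute)
      ultimately show "(to_ac (\<alpha> N) * (x ^ (N mod K) * \<eta> ^ v N * x ^ (j N * Q))) ^ Q
          = to_ac (\<alpha> N) * (x ^ (N mod K * Q) * (to_ac c - \<eta>) ^ v N * x ^ j N)"
        by (simp only: power_mult_distrib)
    qed
    also have "x ^ (K * (p - 1)) * \<dots> = poly (map_poly to_ac (\<Sum>N<U. smult (\<alpha> N) (Z N))) x"
      by (simp add: to_ac_poly.hom_sum map_poly_smult poly_sum Zx sum_distrib_left mult_ac)
    then have "(\<Sum>N<U. to_ac (\<alpha> N) * (x ^ (N mod K * Q) * (to_ac c - \<eta>) ^ v N * x ^ j N)) = 0"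
      using x(1) by (simp add: Z0)
    finally have "W ^ Q = 0" .
    then have "W = 0" by simp
    moreover have "poly (map_poly to_ac R) x = x ^ (K * (p - 1)) * W"
      by (simp add: R_def W_def to_ac_poly.hom_sum map_poly_smult poly_sum Ex sum_distrib_left mult_ac)
    ultimately show ?thesis by simp
  qed
  show ?thesis
    by (rule that[of R]) (use R0 Rdeg van in \<open>auto simp: p_def\<close>)
qed

text \<open>The left-hand side counts, orbit by orbit, the nonzero x in the field with p^(2 s)
  elements for which \<open>x + \<nu> / x\<close> has trace c. Each such P shares a root with the
  auxiliary polynomial and so divides it; distinct primes are coprime, so the degree of that
  polynomial bounds the count.\<close>

lemma stepanov_bound:
  fixes \<nu> c :: "'a::prime_card mod_ring" and s :: nat
  assumes s: "s > 0"
  shows "(\<Sum>P | P \<in> prime_unit \<and> degree P dvd 2 * s \<and> of_nat (2 * s div degree P) * trace_coeff \<nu> P = c. degree P)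
     \<le> CARD('a) ^ (2 * s - 1) + 5 * CARD('a) ^ s"
proof -
  from stepanov_polynomial[OF s, of \<nu> c] obtain R :: "'a mod_ring poly" where R: "R \<noteq> 0"
    "degree R \<le> CARD('a) ^ (2 * s - 1) + 5 * CARD('a) ^ s"
    "\<And>x. x \<noteq> 0 \<Longrightarrow> x ^ (CARD('a) ^ (2 * s)) = x \<Longrightarrow>
       (\<Sum>i<2 * s. (x + to_ac \<nu> / x) ^ (CARD('a) ^ i)) = to_ac c \<Longrightarrow> poly (map_poly to_ac R) x = 0"
    by blast
  define A where "A = {P. P \<in> prime_unit \<and> degree P dvd 2 * s \<and> of_nat (2 * s div degree P) * trace_coeff \<nu> P = c}"
  have fin: "finite A"
    by (rule finite_subset[OF _ finite_prime_unit_dvd[of "2 * s"]]) (use s in \<open>auto simp: A_def\<close>)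
  have dvd: "P dvd R" if "P \<in> A" for P
  proof -
    have P: "P \<in> prime_unit" "degree P dvd 2 * s" "of_nat (2 * s div degree P) * trace_coeff \<nu> P = c"
      using that by (auto simp: A_def)
    from prime_poly_root_trace[OF P(1,2), of \<nu>] obtain x where
      "x \<noteq> 0" "poly (map_poly to_ac P) x = 0" "x ^ (CARD('a) ^ (2 * s)) = x"
      "(\<Sum>i<2 * s. (x + to_ac \<nu> / x) ^ (CARD('a) ^ i)) = to_ac c" using P(3) by metis
    then show ?thesis using R(3)[of x] prime_dvd_if_common_root[of P x R] P(1) by (auto simp: prime_unit_def)
  qed
  have prod_dvd: "finite B \<Longrightarrow> B \<subseteq> A \<Longrightarrow> \<Prod>B dvd R" for B
  proof (induction B rule: finite_induct)
    case (insert P B)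
    have "coprime P (\<Prod>B)"
    proof (rule prod_coprime_right)
      fix P' assume "P' \<in> B"
      then have "P \<noteq> P'" "prime P" "prime P'" using insert by (auto simp: A_def prime_unit_def)
      then show "coprime P P'" by (simp add: primes_coprime)
    qed
    then show ?case using insert dvd by (simp add: divides_mult)
  qed simp
  have "(\<Sum>P\<in>A. degree P) = degree (\<Prod>A)"
    by (subst degree_prod_eq_sum_degree) (auto simp: A_def prime_unit_def)
  also have "\<dots> \<le> degree R" using prod_dvd[OF fin] R(1) by (intro dvd_imp_degree_le) auto
  finally show ?thesis using R(2) by (simp add: A_def)
qed

section \<open>Weil's bound for Kloosterman sums\<close>

text \<open>If \<alpha> were larger than sqrt p, then \<beta> would be smaller, and \<alpha>^(2 s)
  would outgrow every multiple of p^s.\<close>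

lemma norm_le_sqrt_if_power_sums_bounded:
  fixes \<alpha> \<beta> :: complex and p C :: real
  assumes p: "p > 0" and prod: "\<alpha> * \<beta> = of_real p"
    and bd: "\<And>s. s > 0 \<Longrightarrow> norm (\<alpha> ^ (2 * s) + \<beta> ^ (2 * s)) \<le> C * p ^ s"
  shows "norm \<alpha> \<le> sqrt p"
proof (rule ccontr)
  assume "\<not> ?thesis"
  then have "sqrt p < norm \<alpha>" by simp
  then have a: "p < norm \<alpha> ^ 2" using p by (metis real_sqrt_less_iff real_sqrt_abs abs_norm_cancel)
  have "norm \<alpha> ^ 2 * norm \<beta> ^ 2 = p ^ 2"
    using prod p by (metis norm_mult norm_of_real power_mult_distrib abs_of_pos)
  moreover have "norm \<beta> ^ 2 \<le> p"
  proof (rule ccontr)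
    assume "\<not> ?thesis"
    then have "p * p < norm \<alpha> ^ 2 * norm \<beta> ^ 2" using a p by (intro mult_strict_mono) auto
    then show False using \<open>norm \<alpha> ^ 2 * norm \<beta> ^ 2 = p ^ 2\<close> by (simp add: power2_eq_square)
  qed
  ultimately have b: "norm \<beta> ^ 2 \<le> p" by simp
  have main: "(norm \<alpha> ^ 2 / p) ^ s \<le> C + 1" if "s > 0" for s
  proof -
    have "norm (\<alpha> ^ (2 * s)) \<le> norm (\<alpha> ^ (2 * s) + \<beta> ^ (2 * s)) + norm (\<beta> ^ (2 * s))"
      by (metis norm_diff_ineq add.commute diff_add_cancel norm_triangle_sub norm_minus_commute add_diff_cancel_left' norm_triangle_ineq4)
    also have "\<dots> \<le> C * p ^ s + p ^ s"
      using bd[OF that] power_mono[OF b, of s] by (simp add: norm_power power_mult)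
    finally have "(norm \<alpha> ^ 2) ^ s \<le> C * p ^ s + p ^ s" by (simp only: norm_power power_mult)
    then show ?thesis using p by (simp add: power_divide divide_le_eq algebra_simps)
  qed
  have "norm \<alpha> ^ 2 / p > 1" using a p by simp
  then obtain s where s: "C + 1 < (norm \<alpha> ^ 2 / p) ^ s" using real_arch_pow by blast
  also have "\<dots> \<le> (norm \<alpha> ^ 2 / p) ^ Suc s"
    using \<open>norm \<alpha> ^ 2 / p > 1\<close> by (intro power_increasing) auto
  finally show False using main[of "Suc s"] by simp
qed

text \<open>Newton's identities for 1 + B T + P T^2, whose reciprocal roots are \<alpha> and
  \<beta>.\<close>

lemma linear_recurrence_power_sums:
  fixes S :: "nat \<Rightarrow> complex"
  assumes "\<alpha> + \<beta> = - B" "\<alpha> * \<beta> = P"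
    and "S 1 = B" "S 2 = 2 * P - B ^ 2" "\<And>d. d \<ge> 3 \<Longrightarrow> S d = - B * S (d - 1) - P * S (d - 2)"
  shows "d > 0 \<Longrightarrow> S d = - (\<alpha> ^ d + \<beta> ^ d)"
proof (induction d rule: less_induct)
  case (less d)
  consider "d = 1" | "d = 2" | "d \<ge> 3" using less by linarith
  then show ?case
  proof cases
    case 1 then show ?thesis using assms(3) by (simp add: assms(1))
  next
    case 2
    have "B = - (\<alpha> + \<beta>)" using assms(1) by simp
    then have "S 2 = 2 * (\<alpha> * \<beta>) - (- (\<alpha> + \<beta>)) ^ 2" by (simp only: assms(2,4))
    then show ?thesis by (simp add: 2 power2_eq_square algebra_simps)
  next
    case 3
    then obtain e where e: "d = Suc (Suc e)" "e > 0" by (metis Suc_diff_Suc Suc_le_lessD diff_zero gr0I less_antisym not_less_eq numeral_2_eq_2 numeral_3_eq_3 old.nat.exhaust Suc_less_eq zero_less_Suc)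
    have B: "B = - (\<alpha> + \<beta>)" using assms(1) by simp
    have "S d = - B * - (\<alpha> ^ Suc e + \<beta> ^ Suc e) - P * - (\<alpha> ^ e + \<beta> ^ e)"
      using assms(5)[OF 3] less.IH[of "Suc e"] less.IH[of e] e by simp
    also have "\<dots> = - (\<alpha> ^ Suc (Suc e) + \<beta> ^ Suc (Suc e))"
      by (simp add: B assms(2)[symmetric] algebra_simps)
    finally show ?thesis using e by simp
  qed
qed

lemma card_monic_degree:
  "card {F :: 'a::prime_card mod_ring poly. degree F = d \<and> lead_coeff F = 1} = CARD('a) ^ d"
proof (induction d)
  case 0
  have "{F :: 'a mod_ring poly. degree F = 0 \<and> lead_coeff F = 1} = {1}"
    by (auto elim!: degree_eq_zeroE)
  then show ?case by simp
next
  case (Suc d)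
  let ?M = "\<lambda>d. {F :: 'a mod_ring poly. degree F = d \<and> lead_coeff F = 1}"
  have "bij_betw (\<lambda>(c, G). pCons c G) (UNIV \<times> ?M d) (?M (Suc d))"
    unfolding bij_betw_def
  proof (intro conjI subset_antisym subsetI)
    show "inj_on (\<lambda>(c, G). pCons c G) (UNIV \<times> ?M d)" by (auto simp: inj_on_def)
  next
    fix F assume "F \<in> (\<lambda>(c, G). pCons c G) ` (UNIV \<times> ?M d)"
    then show "F \<in> ?M (Suc d)" by (auto simp: degree_pCons_eq_if monic_unit_def)
  next
    fix F assume F: "F \<in> ?M (Suc d)"
    obtain c G where cG: "F = pCons c G" by (cases F)
    then have "(c, G) \<in> UNIV \<times> ?M d"
      using F by (auto simp: degree_pCons_eq_if monic_unit_def split: if_splits)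
    then show "F \<in> (\<lambda>(c, G). pCons c G) ` (UNIV \<times> ?M d)" using cG by (auto intro!: image_eqI[of _ _ "(c, G)"])
  qed
  then have "card (?M (Suc d)) = card ((UNIV :: 'a mod_ring set) \<times> ?M d)" by (simp add: bij_betw_same_card)
  then show ?case using Suc by (simp add: card_cartesian_product)
qed

lemma card_monic_unit:
  "card (monic_unit (Suc d) :: 'a::prime_card mod_ring poly set) = (CARD('a) - 1) * CARD('a) ^ d"
proof -
  let ?M = "\<lambda>d. {F :: 'a mod_ring poly. degree F = d \<and> lead_coeff F = 1}"
  have "bij_betw (\<lambda>(c, G). pCons c G) ((UNIV - {0}) \<times> ?M d) (monic_unit (Suc d))"
    unfolding bij_betw_def
  proof (intro conjI subset_antisym subsetI)
    show "inj_on (\<lambda>(c, G). pCons c G) ((UNIV - {0}) \<times> ?M d)" by (auto simp: inj_on_def)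
  next
    fix F assume "F \<in> (\<lambda>(c, G). pCons c G) ` ((UNIV - {0}) \<times> ?M d)"
    then show "F \<in> monic_unit (Suc d)" by (auto simp: degree_pCons_eq_if monic_unit_def)
  next
    fix F :: "'a mod_ring poly" assume F: "F \<in> monic_unit (Suc d)"
    obtain c G where cG: "F = pCons c G" by (cases F)
    then have "(c, G) \<in> (UNIV - {0}) \<times> ?M d"
      using F by (auto simp: degree_pCons_eq_if monic_unit_def split: if_splits)
    then show "F \<in> (\<lambda>(c, G). pCons c G) ` ((UNIV - {0}) \<times> ?M d)" using cG by (auto intro!: image_eqI[of _ _ "(c, G)"])
  qed
  then have "card (monic_unit (Suc d) :: 'a mod_ring poly set) = card ((UNIV - {0 :: 'a mod_ring}) \<times> ?M d)"
    by (simp add: bij_betw_same_card)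
  then show ?thesis by (simp add: card_cartesian_product card_monic_degree card_Diff_subset)
qed

lemma sum_geometric_weights:
  fixes p :: complex
  shows "(\<Sum>r=1..d. (p ^ r - 1) * ((p - 1) * p ^ (d - r))) = of_nat d * (p - 1) * p ^ d - p ^ d + 1"
proof -
  have "(\<Sum>r=1..d. (p ^ r - 1) * ((p - 1) * p ^ (d - r))) = (\<Sum>r=1..d. (p - 1) * p ^ d) - (p - 1) * (\<Sum>r=1..d. p ^ (d - r))"
    unfolding sum_distrib_left sum_subtractf[symmetric]
  proof (rule sum.cong[OF refl])
    fix r assume "r \<in> {1..d}"
    then have "p ^ d = p ^ r * p ^ (d - r)" by (simp flip: power_add)
    then show "(p ^ r - 1) * ((p - 1) * p ^ (d - r)) = (p - 1) * p ^ d - (p - 1) * p ^ (d - r)"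
      by (simp add: algebra_simps)
  qed
  also have "(\<Sum>r=1..d. p ^ (d - r)) = (\<Sum>i<d. p ^ i)"
    by (rule sum.reindex_bij_witness[of _ "\<lambda>i. d - i" "\<lambda>r. d - r"]) auto
  also have "(p - 1) * \<dots> = p ^ d - 1" by (simp add: power_diff_1_eq)
  finally show ?thesis by simp
qed

text \<open>This counts the nonzero elements of the field with p^r elements without constructing it:
  for the trivial \<Psi> the degree sums are known in closed form, and the recurrence then
  determines the point sums.\<close>

lemma sum_degree_prime_unit:
  assumes "r > 0"
  shows "(\<Sum>P | P \<in> (prime_unit :: 'a::prime_card mod_ring poly set) \<and> degree P dvd r. degree P) = CARD('a) ^ r - 1"
proof -
  define p where "p = CARD('a)"
  have p2: "p \<ge> 2" unfolding p_def using prime_card prime_ge_2_nat by blast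
  define \<Psi> where "\<Psi> = (\<lambda>_ :: 'a mod_ring poly. 1 :: complex)"
  have B0: "degree_sum \<Psi> 0 = 1"
  proof -
    have "monic_unit 0 = {1 :: 'a mod_ring poly}" by (auto simp: monic_unit_def elim!: degree_eq_zeroE)
    then show ?thesis by (simp add: degree_sum_def \<Psi>_def)
  qed
  have B: "degree_sum \<Psi> (Suc d) = (of_nat p - 1) * of_nat p ^ d" for d
    using p2 by (simp add: degree_sum_def \<Psi>_def card_monic_unit p_def of_nat_diff)
  have S: "point_sum \<Psi> r = of_nat p ^ r - 1" if "r > 0" for r using that
  proof (induction r rule: less_induct)
    case (less r)
    then obtain d where d: "r = Suc d" by (cases r) auto
    have "of_nat r * degree_sum \<Psi> r = (\<Sum>i=1..r. point_sum \<Psi> i * degree_sum \<Psi> (r - i))"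
      by (rule degree_sum_recurrence) (auto simp: \<Psi>_def)
    also have "\<dots> = (\<Sum>i=1..d. point_sum \<Psi> i * degree_sum \<Psi> (r - i)) + point_sum \<Psi> r"
      by (simp add: d B0)
    also have "(\<Sum>i=1..d. point_sum \<Psi> i * degree_sum \<Psi> (r - i)) = (\<Sum>i=1..d. (of_nat p ^ i - 1) * ((of_nat p - 1) * of_nat p ^ (d - i)))"
      using less.IH by (intro sum.cong refl arg_cong2[where f = "(*)"]) (auto simp: d Suc_diff_le B)
    finally have "of_nat (Suc d) * ((of_nat p - 1) * of_nat p ^ d) = (of_nat d * (of_nat p - 1) * of_nat p ^ d - of_nat p ^ d + 1) + point_sum \<Psi> r"
      by (simp only: sum_geometric_weights d B)
    then show ?case by (simp add: d algebra_simps)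
  qed
  have "of_nat (\<Sum>P | P \<in> (prime_unit :: 'a mod_ring poly set) \<and> degree P dvd r. degree P) = point_sum \<Psi> r"
    by (simp add: point_sum_def \<Psi>_def)
  also have "\<dots> = of_nat (p ^ r - 1)" using p2 by (subst S[OF assms]) (simp add: of_nat_diff)
  finally show ?thesis by (simp only: of_nat_eq_iff p_def)
qed

text \<open>Nontriviality is witnessed by the parameter \<open>t0\<close>, because shifting by
  \<open>t0\<close> is what makes complete sums vanish.\<close>

locale additive_char =
  fixes \<psi> :: "'a::prime_card mod_ring \<Rightarrow> complex" and t0 :: "'a mod_ring"
  assumes add: "\<psi> (x + y) = \<psi> x * \<psi> y" and norm1: "norm (\<psi> x) = 1" and nontriv: "\<psi> t0 \<noteq> 1"
begin

lemma zero: "\<psi> 0 = 1"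
proof -
  have "\<psi> 0 * \<psi> 0 = \<psi> 0 * 1" using add[of 0 0] by simp
  moreover have "\<psi> 0 \<noteq> 0" using norm1[of 0] by force
  ultimately show ?thesis by (metis mult_left_cancel)
qed

lemma power: "\<psi> x ^ m = \<psi> (of_nat m * x)"
  by (induction m) (simp_all add: zero add algebra_simps)

lemma sum_UNIV: "(\<Sum>x\<in>UNIV. \<psi> x) = 0"
proof -
  have "(\<Sum>x\<in>UNIV. \<psi> x) = (\<Sum>x\<in>UNIV. \<psi> (t0 + x))"
    by (rule sum.reindex_bij_witness[of _ "\<lambda>x. t0 + x" "\<lambda>x. x - t0"]) auto
  also have "\<dots> = \<psi> t0 * (\<Sum>x\<in>UNIV. \<psi> x)" by (simp add: add sum_distrib_left)
  finally have "(1 - \<psi> t0) * (\<Sum>x\<in>UNIV. \<psi> x) = 0" by (simp add: left_diff_distrib)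
  then show ?thesis using nontriv by simp
qed

lemma sum_UNIV_mult: "(\<Sum>x\<in>UNIV. \<psi> (x * u)) = (if u = 0 then of_nat CARD('a) else 0)"
proof (cases "u = 0")
  case False
  have "(\<Sum>x\<in>UNIV. \<psi> (x * u)) = (\<Sum>x\<in>UNIV. \<psi> x)"
    by (rule sum.reindex_bij_witness[of _ "\<lambda>x. x / u" "\<lambda>x. x * u"]) (use False in auto)
  then show ?thesis using False by (simp add: sum_UNIV)
qed (simp add: zero)

text \<open>The L-function of \<open>\<Psi>\<close> is the polynomial 1 + B T + p T^2 with B the
  Kloosterman sum. So B is minus the sum of the two reciprocal roots, and each of these has absolute
  value at most sqrt p.\<close>

theorem kloosterman_bound:
  assumes \<nu>: "\<nu> \<noteq> 0"
  shows "norm (\<Sum>x\<in>UNIV - {0}. \<psi> (x + \<nu> / x)) \<le> 2 * sqrt (real CARD('a))"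
proof -
  define p where "p = CARD('a)"
  have p2: "p \<ge> 2" unfolding p_def using prime_card prime_ge_2_nat by blast
  define \<Psi> where "\<Psi> F = \<psi> (trace_coeff \<nu> F)" for F
  have rec: "of_nat d * degree_sum \<Psi> d = (\<Sum>r=1..d. point_sum \<Psi> r * degree_sum \<Psi> (d - r))" for d
    by (rule degree_sum_recurrence) (auto simp: \<Psi>_def trace_coeff_mult add trace_coeff_one zero)
  define B where "B = (\<Sum>x\<in>UNIV - {0}. \<psi> (x + \<nu> / x))"
  have D0: "degree_sum \<Psi> 0 = 1"
  proof -
    have "monic_unit 0 = {1 :: 'a mod_ring poly}" by (auto simp: monic_unit_def elim!: degree_eq_zeroE)
    then show ?thesis by (simp add: degree_sum_def \<Psi>_def trace_coeff_one zero)
  qed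
  have D1: "degree_sum \<Psi> 1 = B"
    unfolding degree_sum_def B_def
  proof (rule sum.reindex_bij_witness[of _ "\<lambda>x. [:- x, 1:]" "\<lambda>F. - coeff F 0"])
    fix F :: "'a mod_ring poly" assume "F \<in> monic_unit 1"
    then have F: "degree F = 1" "lead_coeff F = 1" "coeff F 0 \<noteq> 0" by (auto simp: monic_unit_def)
    then show *: "[:- (- coeff F 0), 1:] = F"
      by (auto intro!: poly_eqI simp: coeff_pCons coeff_eq_0 split: nat.splits)
    show "- coeff F 0 \<in> UNIV - {0}" using F by simp
    show "\<psi> (- coeff F 0 + \<nu> / (- coeff F 0)) = \<Psi> F"
      using trace_coeff_linear[of "- coeff F 0" \<nu>] F(3) unfolding * \<Psi>_def by simp
  qed (auto simp: monic_unit_def)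
  \<comment> \<open>The linear coefficient b runs freely, and the sum over b vanishes unless the
    constant term is \<open>- \<nu>\<close>.\<close>
  have D2: "degree_sum \<Psi> 2 = of_nat p"
  proof -
    have "degree_sum \<Psi> 2 = (\<Sum>(c, b)\<in>(UNIV - {0}) \<times> UNIV. \<psi> (b * (- (1 + \<nu> / c))))"
      unfolding degree_sum_def
    proof (rule sum.reindex_bij_witness[of _ "\<lambda>(c, b). [:c, b, 1:]" "\<lambda>F. (coeff F 0, coeff F 1)"])
      fix F :: "'a mod_ring poly" assume "F \<in> monic_unit 2"
      then have F: "degree F = 2" "lead_coeff F = 1" "coeff F 0 \<noteq> 0" by (auto simp: monic_unit_def)
      then show "(case (coeff F 0, coeff F 1) of (c, b) \<Rightarrow> [:c, b, 1:]) = F"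
        by (auto intro!: poly_eqI simp: coeff_pCons coeff_eq_0 numeral_2_eq_2 split: nat.splits)
      show "(coeff F 0, coeff F 1) \<in> (UNIV - {0}) \<times> UNIV" using F by simp
      show "(case (coeff F 0, coeff F 1) of (c, b) \<Rightarrow> \<psi> (b * (- (1 + \<nu> / c)))) = \<Psi> F"
        using F by (simp add: \<Psi>_def trace_coeff_def coeff_reflect_poly algebra_simps)
    qed (auto simp: monic_unit_def)
    also have "\<dots> = (\<Sum>c\<in>UNIV - {0}. if c = - \<nu> then of_nat p else 0)"
    proof (subst sum.cartesian_product[symmetric], rule sum.cong[OF refl])
      fix c :: "'a mod_ring" assume "c \<in> UNIV - {0}"
      then have "- (1 + \<nu> / c) = 0 \<longleftrightarrow> c = - \<nu>" by (auto simp: field_simps eq_neg_iff_add_eq_0)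
      then show "(\<Sum>b\<in>UNIV. \<psi> (b * (- (1 + \<nu> / c)))) = (if c = - \<nu> then of_nat p else 0)"
        by (simp only: sum_UNIV_mult p_def)
    qed
    also have "\<dots> = of_nat p" using \<nu> by simp
    finally show ?thesis .
  qed
  \<comment> \<open>From degree 3 on, the coefficient of X^(d-1) is distinct from the coefficients 0
    and 1, so changing it by \<open>- t0\<close> shifts \<open>trace_coeff\<close> by
    \<open>t0\<close> and has no other effect.\<close>
  have D3: "degree_sum \<Psi> d = 0" if d: "d \<ge> 3" for d
  proof -
    have "degree_sum \<Psi> d = (\<Sum>F\<in>monic_unit d. \<Psi> (F + monom (- t0) (d - 1)))"
      unfolding degree_sum_def
    proof (rule sum.reindex_bij_witness[of _ "\<lambda>F. F + monom (- t0) (d - 1)" "\<lambda>F. F + monom t0 (d - 1)"])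
      have *: "F + monom c (d - 1) \<in> monic_unit d" if "F \<in> monic_unit d" for F :: "'a mod_ring poly" and c
      proof -
        have "degree (monom c (d - 1)) < degree F" using that d
          by (intro le_less_trans[OF degree_monom_le]) (auto simp: monic_unit_def)
        then show ?thesis using that d by (auto simp: monic_unit_def degree_add_eq_left)
      qed
      then show "F + monom (- t0) (d - 1) \<in> monic_unit d" "F + monom t0 (d - 1) \<in> monic_unit d" if "F \<in> monic_unit d" for F
        using that by auto
    qed (auto simp: add.assoc simp flip: minus_monom)
    also have "\<dots> = (\<Sum>F\<in>monic_unit d. \<psi> t0 * \<Psi> F)"
    proof (rule sum.cong[OF refl])
      fix F :: "'a mod_ring poly" assume F: "F \<in> monic_unit d"
      have dF: "degree F = d" using F by (auto simp: monic_unit_def)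
      have "degree (monom (- t0) (d - 1)) < degree F" using dF d
          by (intro le_less_trans[OF degree_monom_le]) auto
      then have "degree (F + monom (- t0) (d - 1)) = d" using dF by (simp add: degree_add_eq_left)
      then have "trace_coeff \<nu> (F + monom (- t0) (d - 1)) = t0 + trace_coeff \<nu> F"
        using dF d by (simp add: trace_coeff_def coeff_reflect_poly algebra_simps)
      then show "\<Psi> (F + monom (- t0) (d - 1)) = \<psi> t0 * \<Psi> F" by (simp add: \<Psi>_def add)
    qed
    also have "\<dots> = \<psi> t0 * degree_sum \<Psi> d" by (simp add: degree_sum_def sum_distrib_left)
    finally show ?thesis using nontriv by simp
  qed
  define S where "S = point_sum \<Psi>"
  have S1: "S 1 = B" using rec[of 1] D1 D0 by (simp add: S_def)
  have S2: "S 2 = 2 * of_nat p - B ^ 2"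
  proof -
    have "{1..2::nat} = {1, 2}" by auto
    then show ?thesis using rec[of 2] D1 D0 D2 S1 by (simp add: S_def power2_eq_square algebra_simps)
  qed
  have S3: "S d = - B * S (d - 1) - of_nat p * S (d - 2)" if d: "d \<ge> 3" for d
  proof -
    have "0 = (\<Sum>r=1..d. S r * degree_sum \<Psi> (d - r))" using rec[of d] D3[OF d] by (simp add: S_def)
    also have "\<dots> = (\<Sum>r\<in>{d - 2, d - 1, d}. S r * degree_sum \<Psi> (d - r))"
      by (rule sum.mono_neutral_right) (use d in \<open>auto simp: D3\<close>)
    also have "\<dots> = S (d - 2) * of_nat p + S (d - 1) * B + S d"
    proof -
      have "d - (d - 2) = 2" "d - (d - 1) = 1" "d - 2 \<noteq> d - 1" "d - 2 \<noteq> d" "d - 1 \<noteq> d" using d by auto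
      then show ?thesis using D0 D1 D2 by simp
    qed
    finally show ?thesis by (simp add: algebra_simps eq_neg_iff_add_eq_0)
  qed
  define \<alpha> where "\<alpha> = (- B + csqrt (B ^ 2 - 4 * of_nat p)) / 2"
  define \<beta> where "\<beta> = (- B - csqrt (B ^ 2 - 4 * of_nat p)) / 2"
  have ab: "\<alpha> + \<beta> = - B" by (simp add: \<alpha>_def \<beta>_def field_simps)
  have "\<alpha> * \<beta> = (B ^ 2 - csqrt (B ^ 2 - 4 * of_nat p) ^ 2) / 4"
    by (simp add: \<alpha>_def \<beta>_def field_simps power2_eq_square)
  then have ab': "\<alpha> * \<beta> = of_nat p" by simp
  have Spow: "S d = - (\<alpha> ^ d + \<beta> ^ d)" if "d > 0" for d
    by (rule linear_recurrence_power_sums[OF ab ab' S1 S2 S3 that])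
  have bd: "norm (\<alpha> ^ (2 * s) + \<beta> ^ (2 * s)) \<le> (6 * real p) * real p ^ s" if s: "s > 0" for s
  proof -
    define T where "T = {P. P \<in> (prime_unit :: 'a mod_ring poly set) \<and> degree P dvd 2 * s}"
    have finT: "finite T" unfolding T_def using s by (intro finite_prime_unit_dvd) auto
    define w where "w P = of_nat (2 * s div degree P) * trace_coeff \<nu> P" for P
    define M where "M = p ^ (2 * s - 1) + 5 * p ^ s"
    define N where "N c = (\<Sum>P | P \<in> T \<and> w P = c. degree P)" for c
    have N: "N c \<le> M" for c
      using stepanov_bound[OF s, of \<nu> c] by (simp add: N_def M_def T_def w_def p_def conj_assoc)
    have "(\<Sum>c\<in>UNIV. N c) = (\<Sum>P\<in>T. degree P)"
      unfolding N_def by (rule sum.group[OF finT]) auto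
    also have "\<dots> = p ^ (2 * s) - 1" unfolding T_def p_def using s by (intro sum_degree_prime_unit) auto
    finally have Ntot: "(\<Sum>c\<in>UNIV. N c) = p ^ (2 * s) - 1" .
    have "S (2 * s) = (\<Sum>P\<in>T. of_nat (degree P) * \<psi> (w P))"
      by (simp add: S_def point_sum_def T_def \<Psi>_def power w_def)
    also have "\<dots> = (\<Sum>c\<in>UNIV. \<Sum>P | P \<in> T \<and> w P = c. of_nat (degree P) * \<psi> (w P))"
      by (rule sum.group[OF finT, symmetric]) auto
    also have "\<dots> = (\<Sum>c\<in>UNIV. of_nat (N c) * \<psi> c)"
      by (intro sum.cong refl) (simp add: N_def sum_distrib_right)
    \<comment> \<open>Subtracting the constant \<open>M\<close> is free because
      \<open>\<psi>\<close> sums to 0. All differences \<open>M - N c\<close> are nonnegative, so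
      the triangle inequality gives \<open>p * M\<close> minus the known total number of points, and
      the main term \<open>p ^ (2 * s)\<close> cancels.\<close>
    also have "\<dots> = (\<Sum>c\<in>UNIV. of_nat (N c) * \<psi> c - of_nat M * \<psi> c)"
      by (simp add: sum_subtractf sum_distrib_left[symmetric] sum_UNIV)
    finally have "norm (S (2 * s)) \<le> (\<Sum>c\<in>(UNIV :: 'a mod_ring set). norm (of_nat (N c) * \<psi> c - of_nat M * \<psi> c))"
      by (simp only: norm_sum)
    also have "\<dots> = (\<Sum>c\<in>(UNIV :: 'a mod_ring set). real M - real (N c))"
    proof (rule sum.cong[OF refl])
      fix c
      have "norm (of_nat (N c) * \<psi> c - of_nat M * \<psi> c) = norm (of_real (real (N c) - real M) * \<psi> c)"
        by (simp add: algebra_simps)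
      also have "\<dots> = \<bar>real (N c) - real M\<bar>" by (simp only: norm_mult norm1 norm_of_real mult_1_right)
      finally show "norm (of_nat (N c) * \<psi> c - of_nat M * \<psi> c) = real M - real (N c)" using N[of c] by simp
    qed
    also have "\<dots> = real p * real M - real (\<Sum>c\<in>UNIV. N c)" by (simp add: sum_subtractf p_def)
    also have "\<dots> = real p * real M - (real p ^ (2 * s) - 1)" unfolding Ntot using p2 by (simp add: of_nat_diff)
    also have "real p * real M = real p ^ (2 * s) + 5 * real p * real p ^ s"
      using s by (simp add: M_def algebra_simps flip: power_Suc)
    also have "real p ^ (2 * s) + 5 * real p * real p ^ s - (real p ^ (2 * s) - 1) = 5 * real p * real p ^ s + 1" by simp
    also have "\<dots> \<le> 6 * real p * real p ^ s"
    proof -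
      have "1 * 1 \<le> real p * real p ^ s" using p2 by (intro mult_mono) (auto intro: one_le_power)
      then show ?thesis by simp
    qed
    finally show ?thesis using Spow[of "2 * s"] s by (simp only: norm_minus_cancel)
  qed
  have "norm \<alpha> \<le> sqrt (real p)" "norm \<beta> \<le> sqrt (real p)"
    using norm_le_sqrt_if_power_sums_bounded[of "real p" \<alpha> \<beta>, OF _ _ bd]
      norm_le_sqrt_if_power_sums_bounded[of "real p" \<beta> \<alpha> "6 * real p"] bd ab' p2
    by (simp_all add: mult.commute add.commute)
  then have "norm (\<alpha> + \<beta>) \<le> 2 * sqrt (real p)" using norm_triangle_ineq[of \<alpha> \<beta>] by linarith
  then show ?thesis unfolding ab by (simp add: B_def p_def)
qed

end

section \<open>The sums Kl: local factors, twisted multiplicativity and pointwise bounds\<close>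

section \<open>Kloosterman sums as quadratic character sums\<close>

definition quad_char_sum :: "nat \<Rightarrow> int \<Rightarrow> int \<Rightarrow> complex" where
  "quad_char_sum p n \<xi> =
     (\<Sum>a\<in>{0..<int p}. of_int (Legendre (a\<^sup>2 - 4 * n) (int p)) * e_char (of_int (a * \<xi>) / real p))"

lemma norm_e_char [simp]: "norm (e_char x) = 1"
  unfolding e_char_def by (simp add: norm_exp_eq_Re)

lemma e_char_add: "e_char (x + y) = e_char x * e_char y"
  unfolding e_char_def by (simp add: exp_add[symmetric] algebra_simps)

lemma e_char_eq_1_iff: "e_char x = 1 \<longleftrightarrow> x \<in> \<int>"
proof -
  have "e_char x = 1 \<longleftrightarrow> (\<exists>n::int. 2 * pi * x = of_int (2 * n) * pi)"
    unfolding e_char_def exp_eq_1 by simp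
  also have "\<dots> \<longleftrightarrow> (\<exists>n::int. x = of_int n)" by simp
  finally show ?thesis by (auto simp: Ints_def)
qed

lemma e_char_of_int [simp]: "e_char (of_int k) = 1"
  by (simp add: e_char_eq_1_iff)

lemma e_char_cong:
  assumes "[a = b] (mod m)" "m \<noteq> 0"
  shows "e_char (of_int a / of_int m) = e_char (of_int b / of_int m)"
proof -
  have "m dvd a - b" using assms(1) by (simp add: cong_iff_dvd_diff)
  then obtain k where "a - b = m * k" by (rule dvdE)
  then have k: "a = b + m * k" by simp
  have "(of_int a :: real) = of_int b + of_int m * of_int k" unfolding k by simp
  then have "of_int a / of_int m = (of_int b / of_int m + of_int k :: real)"
    using assms(2) by (simp add: add_divide_distrib)
  then show ?thesis by (simp add: e_char_add)
qed

lemma of_int_mod_ring_eq_iff: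
  "(of_int a :: 'a::prime_card mod_ring) = of_int b \<longleftrightarrow> [a = b] (mod int CARD('a))"
  unfolding of_int_of_int_mod_ring by transfer (simp add: Cong.cong_def)

lemma of_int_mod_ring_eq_0_iff:
  "(of_int a :: 'a::prime_card mod_ring) = 0 \<longleftrightarrow> int CARD('a) dvd a"
  using of_int_mod_ring_eq_iff[of a 0] by (simp add: cong_0_iff)

lemma of_int_to_int_mod_ring: "of_int (to_int_mod_ring x) = (x :: 'a::prime_card mod_ring)"
  by (simp add: of_int_of_int_mod_ring)

lemma to_int_mod_ring_range: "to_int_mod_ring (x :: 'a::prime_card mod_ring) \<in> {0..<int CARD('a)}"
  by transfer simp

lemma card_square_roots_mod_ring:
  assumes odd: "CARD('a::prime_card) \<noteq> 2"
  shows "int (card {y :: 'a mod_ring. y\<^sup>2 = of_int d}) = 1 + Legendre d (int CARD('a))"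
proof -
  let ?S = "{y :: 'a mod_ring. y\<^sup>2 = of_int d}"
  have two: "(2 :: 'a mod_ring) \<noteq> 0"
  proof
    assume "(2 :: 'a mod_ring) = 0"
    then have "of_nat 2 = (0 :: 'a mod_ring)" by simp
    then have "CARD('a) dvd 2" by (rule of_nat_0_mod_ring_dvd)
    then show False using odd prime_card[where 'a = 'a]
      by (metis two_is_prime_nat primes_dvd_imp_eq)
  qed
  show ?thesis
  proof (cases "int CARD('a) dvd d")
    case True
    then have "(of_int d :: 'a mod_ring) = 0" by (simp add: of_int_mod_ring_eq_0_iff)
    then have "?S = {0}" by auto
    then show ?thesis using True by (simp add: Legendre_def cong_0_iff)
  next
    case False
    then have d0: "(of_int d :: 'a mod_ring) \<noteq> 0" by (simp add: of_int_mod_ring_eq_0_iff)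
    have QR: "QuadRes (int CARD('a)) d \<longleftrightarrow> ?S \<noteq> {}"
    proof
      assume "QuadRes (int CARD('a)) d"
      then obtain y where "[y\<^sup>2 = d] (mod int CARD('a))" by (auto simp: QuadRes_def)
      then have "(of_int y :: 'a mod_ring)\<^sup>2 = of_int d"
        by (simp flip: of_int_power add: of_int_mod_ring_eq_iff)
      then show "?S \<noteq> {}" by blast
    next
      assume "?S \<noteq> {}"
      then obtain y :: "'a mod_ring" where y: "y\<^sup>2 = of_int d" by auto
      have "(of_int ((to_int_mod_ring y)\<^sup>2) :: 'a mod_ring) = of_int d"
        using y by (simp add: of_int_to_int_mod_ring)
      then show "QuadRes (int CARD('a)) d" unfolding of_int_mod_ring_eq_iff QuadRes_def by blast
    qed
    show ?thesis
    proof (cases "?S = {}")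
      case True
      then show ?thesis using QR False by (simp add: Legendre_def cong_0_iff)
    next
      case ne: False
      then obtain y :: "'a mod_ring" where y: "y\<^sup>2 = of_int d" by auto
      have "y \<noteq> 0" using y d0 by auto
      then have "2 * y \<noteq> 0" using two by simp
      then have "y + y \<noteq> 0" by (simp only: mult_2 not_False_eq_True)
      then have "y \<noteq> - y" using iffD1[OF eq_neg_iff_add_eq_0] by blast
      have "?S = {y, - y}" unfolding y[symmetric] by (auto simp: power2_eq_iff)
      then have "card ?S = 2" using \<open>y \<noteq> - y\<close> by simp
      then show ?thesis using QR ne False by (simp add: Legendre_def cong_0_iff)
    qed
  qed
qed

text \<open>\<open>1 + Legendre\<close> counts the x with x^2 - a x + n = 0, that is, with a = x + n
  / x, because n is nonzero modulo the prime. Exchanging the sums over a and x yields the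
  Kloosterman sum; the term 1 contributes a complete character sum, which is 0.\<close>

lemma quad_char_sum_bound_type:
  assumes odd: "CARD('a::prime_card) \<noteq> 2" and n: "\<not> int CARD('a) dvd n" and \<xi>: "\<not> int CARD('a) dvd \<xi>"
  shows "norm (quad_char_sum CARD('a) n \<xi>) \<le> 2 * sqrt (real CARD('a))"
proof -
  define p where "p = CARD('a)"
  have p2: "p \<ge> 2" unfolding p_def using prime_card prime_ge_2_nat by blast
  define \<psi> where "\<psi> x = e_char (of_int (to_int_mod_ring x * \<xi>) / of_int (int p))" for x :: "'a mod_ring"
  have \<psi>: "\<psi> (of_int a) = e_char (of_int (a * \<xi>) / of_int (int p))" for a
    unfolding \<psi>_def using p2
    by (intro e_char_cong cong_scalar_right) (auto simp flip: of_int_mod_ring_eq_iff[where 'a = 'a] simp: p_def of_int_to_int_mod_ring)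
  interpret additive_char \<psi> 1
  proof
    fix x y :: "'a mod_ring"
    have "\<psi> (of_int (to_int_mod_ring x) + of_int (to_int_mod_ring y)) = \<psi> (of_int (to_int_mod_ring x)) * \<psi> (of_int (to_int_mod_ring y))"
      unfolding of_int_add[symmetric] \<psi> by (simp add: e_char_add[symmetric] add_divide_distrib distrib_right)
    then show "\<psi> (x + y) = \<psi> x * \<psi> y" by (simp only: of_int_to_int_mod_ring)
    show "norm (\<psi> x) = 1" by (simp add: \<psi>_def)
    have "\<psi> 1 = e_char (of_int \<xi> / of_int (int p))" using \<psi>[of 1] by simp
    moreover have "(of_int \<xi> / of_int (int p) :: real) \<notin> \<int>"
    proof
      assume "(of_int \<xi> / of_int (int p) :: real) \<in> \<int>"
      then obtain k where "of_int \<xi> / of_int (int p) = (of_int k :: real)" by (auto elim: Ints_cases)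
      then have "(of_int \<xi> :: real) = of_int (k * int p)" using p2 by (simp add: field_simps)
      then have "\<xi> = k * int p" by (simp only: of_int_eq_iff)
      then show False using \<xi> by (simp add: p_def)
    qed
    ultimately show "\<psi> 1 \<noteq> 1" by (simp add: e_char_eq_1_iff)
  qed
  define \<nu> :: "'a mod_ring" where "\<nu> = of_int n"
  have \<nu>0: "\<nu> \<noteq> 0" using n by (simp add: \<nu>_def of_int_mod_ring_eq_0_iff)
  have two: "(2 :: 'a mod_ring) \<noteq> 0"
  proof
    assume "(2 :: 'a mod_ring) = 0"
    then have "of_nat 2 = (0 :: 'a mod_ring)" by simp
    then have "CARD('a) dvd 2" by (rule of_nat_0_mod_ring_dvd)
    then show False using odd prime_card[where 'a = 'a]
      by (metis two_is_prime_nat primes_dvd_imp_eq)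
  qed
  define V where "V A = {x :: 'a mod_ring. x\<^sup>2 - A * x + \<nu> = 0}" for A
  have cardV: "of_int (Legendre (a\<^sup>2 - 4 * n) (int p)) = (of_nat (card (V (of_int a))) - 1 :: complex)" for a
  proof -
    \<comment> \<open>Completing the square, which is where the prime must be odd.\<close>
    have "bij_betw (\<lambda>x. 2 * x - of_int a) (V (of_int a)) {y. y\<^sup>2 = of_int (a\<^sup>2 - 4 * n)}"
    proof (rule bij_betwI[where g = "\<lambda>y. (y + of_int a) / 2"])
      have e: "(2 * x - of_int a)\<^sup>2 - of_int (a\<^sup>2 - 4 * n) = 4 * (x\<^sup>2 - of_int a * x + \<nu>)" for x :: "'a mod_ring"
        by (simp add: \<nu>_def power2_eq_square algebra_simps)
      show "(\<lambda>x. 2 * x - of_int a) \<in> V (of_int a) \<rightarrow> {y. y\<^sup>2 = of_int (a\<^sup>2 - 4 * n)}"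
      proof
        fix x assume "x \<in> V (of_int a)"
        then have "x\<^sup>2 - of_int a * x + \<nu> = 0" by (simp add: V_def)
        then have "(2 * x - of_int a)\<^sup>2 - of_int (a\<^sup>2 - 4 * n) = 0" by (simp only: e mult_zero_right)
        then show "2 * x - of_int a \<in> {y. y\<^sup>2 = of_int (a\<^sup>2 - 4 * n)}"
          by (simp only: right_minus_eq mem_Collect_eq)
      qed
      have four: "(4 :: 'a mod_ring) \<noteq> 0"
        using two by (metis mult_eq_0_iff numeral_Bit0_eq_double)
      show "(\<lambda>y. (y + of_int a) / 2) \<in> {y. y\<^sup>2 = of_int (a\<^sup>2 - 4 * n)} \<rightarrow> V (of_int a)"
      proof
        fix y :: "'a mod_ring" assume "y \<in> {y. y\<^sup>2 = of_int (a\<^sup>2 - 4 * n)}"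
        then have "y\<^sup>2 - of_int (a\<^sup>2 - 4 * n) = 0" by simp
        moreover have "2 * ((y + of_int a) / 2) - of_int a = y" using two by simp
        ultimately have "4 * (((y + of_int a) / 2)\<^sup>2 - of_int a * ((y + of_int a) / 2) + \<nu>) = 0"
          using e[of "(y + of_int a) / 2"] by simp
        then show "(y + of_int a) / 2 \<in> V (of_int a)" using four
          by (simp only: V_def mem_Collect_eq mult_eq_0_iff simp_thms)
      qed
    qed (use two in auto)
    then have "card (V (of_int a)) = card {y :: 'a mod_ring. y\<^sup>2 = of_int (a\<^sup>2 - 4 * n)}"
      by (rule bij_betw_same_card)
    then have "int (card (V (of_int a))) = 1 + Legendre (a\<^sup>2 - 4 * n) (int p)"
      using card_square_roots_mod_ring[OF odd, of "a\<^sup>2 - 4 * n"] by (simp only: p_def)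
    then show ?thesis by (metis add_diff_cancel_left' of_int_diff of_int_of_nat_eq of_int_1)
  qed
  have "quad_char_sum p n \<xi> = (\<Sum>a\<in>{0..<int p}. (of_nat (card (V (of_int a))) - 1) * \<psi> (of_int a))"
    unfolding quad_char_sum_def cardV \<psi> by simp
  also have "\<dots> = (\<Sum>A\<in>UNIV. (of_nat (card (V A)) - 1) * \<psi> A)"
  proof (rule sum.reindex_bij_witness[of _ to_int_mod_ring of_int])
    fix a assume a: "a \<in> {0..<int p}"
    have "[to_int_mod_ring (of_int a :: 'a mod_ring) = a] (mod int CARD('a))"
      by (simp flip: of_int_mod_ring_eq_iff[where 'a = 'a] add: of_int_to_int_mod_ring)
    then show "to_int_mod_ring (of_int a :: 'a mod_ring) = a"
      using a to_int_mod_ring_range[of "of_int a :: 'a mod_ring"]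
      by (simp add: p_def Cong.cong_def)
  next
    show "to_int_mod_ring A \<in> {0..<int p}" for A :: "'a mod_ring"
      unfolding p_def by (rule to_int_mod_ring_range)
  qed (simp_all add: of_int_to_int_mod_ring)
  also have "\<dots> = (\<Sum>A\<in>UNIV. of_nat (card (V A)) * \<psi> A)"
    by (simp add: left_diff_distrib sum_subtractf sum_UNIV)
  also have "\<dots> = (\<Sum>A\<in>UNIV. \<Sum>x\<in>V A. \<psi> A)" by simp
  also have "\<dots> = (\<Sum>(A, x)\<in>Sigma UNIV V. \<psi> A)" by (rule sum.Sigma) auto
  also have "\<dots> = (\<Sum>x\<in>UNIV - {0}. \<psi> (x + \<nu> / x))"
  proof (rule sum.reindex_bij_witness[of _ "\<lambda>x. (x + \<nu> / x, x)" snd])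
    fix z assume "z \<in> Sigma UNIV V"
    then obtain A x where z: "z = (A, x)" "x\<^sup>2 - A * x + \<nu> = 0" by (auto simp: V_def)
    have "x \<noteq> 0" using z(2) \<nu>0 by auto
    have z2: "x * x - A * x + \<nu> = 0" using z(2) by (simp only: power2_eq_square)
    have "A * x = x * x + \<nu> - (x * x - A * x + \<nu>)" by simp
    then have "A * x = x * x + \<nu>" unfolding z2 by simp
    then have "A = (x * x + \<nu>) / x" using \<open>x \<noteq> 0\<close> by (metis nonzero_mult_div_cancel_right)
    also have "\<dots> = x + \<nu> / x" 
      unfolding add_divide_distrib nonzero_mult_div_cancel_right[OF \<open>x \<noteq> 0\<close>] ..
    finally have "A = x + \<nu> / x" .
    then show "(snd z + \<nu> / snd z, snd z) = z" "snd z \<in> UNIV - {0}"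
      "\<psi> (snd z + \<nu> / snd z) = (case z of (A, x) \<Rightarrow> \<psi> A)"
      using z \<open>x \<noteq> 0\<close> by auto
  next
    fix x assume "x \<in> UNIV - {0 :: 'a mod_ring}"
    then have "(x + \<nu> / x) * x = x * x + \<nu>" by (simp only: distrib_right) simp
    then have "x\<^sup>2 - (x + \<nu> / x) * x + \<nu> = x * x - (x * x + \<nu>) + \<nu>" by (simp only: power2_eq_square)
    then show "(x + \<nu> / x, x) \<in> Sigma UNIV V" by (simp add: V_def)
  qed auto
  finally show ?thesis using kloosterman_bound[OF \<nu>0] by (simp add: p_def)
qed

text \<open>Types cannot depend on the prime \<open>p\<close>. Instead, a type is built for one prime chosen such that
  it violates the bound whenever some prime does.\<close>

definition exceptional :: "nat \<Rightarrow> bool" where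
  "exceptional p \<longleftrightarrow> prime p \<and> p \<noteq> 2 \<and>
     (\<exists>n \<xi>. \<not> int p dvd n \<and> \<not> int p dvd \<xi> \<and> norm (quad_char_sum p n \<xi>) > 2 * sqrt (real p))"

text \<open>The fallback 2 keeps the value prime, so that the type built from it always belongs to
  the class \<open>prime_card\<close>.\<close>

definition chosen_prime :: nat where
  "chosen_prime = (if \<exists>p. exceptional p then SOME p. exceptional p else 2)"

lemma prime_chosen_prime: "prime chosen_prime"
proof (cases "\<exists>p. exceptional p")
  case True
  then have "exceptional chosen_prime" unfolding chosen_prime_def by (simp add: someI_ex)
  then show ?thesis by (simp add: exceptional_def)
next
  case False
  then show ?thesis unfolding chosen_prime_def by (subst if_not_P) auto
qed

typedef chosen_residue = "{0..<chosen_prime}"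
  using prime_chosen_prime prime_gt_0_nat by (intro exI[of _ 0]) auto

lemma CARD_chosen_residue: "CARD(chosen_residue) = chosen_prime"
  using type_definition.card[OF type_definition_chosen_residue] by simp

instance chosen_residue :: finite
proof
  show "finite (UNIV :: chosen_residue set)"
    using CARD_chosen_residue prime_chosen_prime prime_gt_0_nat by (metis card.infinite less_irrefl)
qed

instance chosen_residue :: prime_card
  by standard (simp add: CARD_chosen_residue prime_chosen_prime)

theorem quad_char_sum_bound:
  assumes "prime p" "p \<noteq> 2" "\<not> int p dvd n" "\<not> int p dvd \<xi>"
  shows "norm (quad_char_sum p n \<xi>) \<le> 2 * sqrt (real p)"
proof (rule ccontr)
  assume "\<not> ?thesis"
  then have "exceptional p" using assms by (auto simp: exceptional_def not_le)
  then have "exceptional chosen_prime" using someI_ex[of exceptional] by (auto simp: chosen_prime_def)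
  then obtain m \<eta> where "chosen_prime \<noteq> 2" "\<not> int chosen_prime dvd m" "\<not> int chosen_prime dvd \<eta>"
      "norm (quad_char_sum chosen_prime m \<eta>) > 2 * sqrt (real chosen_prime)"
    by (auto simp: exceptional_def)
  then show False
    using quad_char_sum_bound_type[where 'a = chosen_residue, unfolded CARD_chosen_residue, of m \<eta>]
    by simp
qed

section \<open>Twisted multiplicativity\<close>

definition twisted_sum :: "(int \<Rightarrow> complex) \<Rightarrow> int \<Rightarrow> int \<Rightarrow> complex" where
  "twisted_sum g M \<xi> = (\<Sum>a\<in>{0..<M}. g a * e_char (of_int (a * \<xi>) / of_int M))"

lemma sum_periodic_shift:
  fixes G :: "int \<Rightarrow> complex"
  assumes M: "M > 0" and per: "\<And>a b. [a = b] (mod M) \<Longrightarrow> G a = G b"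
  shows "(\<Sum>a\<in>{0..<M}. G (a + c)) = (\<Sum>a\<in>{0..<M}. G a)"
proof (rule sum.reindex_bij_witness[of _ "\<lambda>a. (a - c) mod M" "\<lambda>a. (a + c) mod M"])
  fix a assume a: "a \<in> {0..<M}"
  show "((a + c) mod M - c) mod M = a" "((a - c) mod M + c) mod M = a"
    using a by (simp_all add: mod_simps)
  show "(a + c) mod M \<in> {0..<M}" "(a - c) mod M \<in> {0..<M}" using M by simp_all
  show "G ((a + c) mod M) = G (a + c)" by (rule per) simp
qed

text \<open>\<open>g\<close> has period \<open>P\<close>, so shifting the variable by
  \<open>P\<close> multiplies the sum by \<open>e_char (\<xi> / d)\<close>, which differs from
  1.\<close>

lemma twisted_sum_eq_0:
  assumes P: "P > 0" and d: "d > 0" and per: "\<And>a b. [a = b] (mod P) \<Longrightarrow> g a = g b"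
    and nd: "\<not> d dvd \<xi>"
  shows "twisted_sum g (P * d) \<xi> = 0"
proof -
  define M where "M = P * d"
  have M: "M > 0" using P d by (simp add: M_def)
  define G where "G a = g a * e_char (of_int (a * \<xi>) / of_int M)" for a
  have perG: "G a = G b" if "[a = b] (mod M)" for a b
  proof -
    have "[a = b] (mod P)" using that unfolding M_def by (rule cong_modulus_mult)
    moreover have "[a * \<xi> = b * \<xi>] (mod M)" using that by (rule cong_scalar_right)
    ultimately show ?thesis using per e_char_cong[of "a * \<xi>" "b * \<xi>" M] M by (simp add: G_def)
  qed
  have step: "G (a + P) = e_char (of_int \<xi> / of_int d) * G a" for a
  proof -
    have "g (a + P) = g a" by (rule per) (simp add: Cong.cong_def)
    moreover have "(of_int ((a + P) * \<xi>) / of_int M :: real) = of_int \<xi> / of_int d + of_int (a * \<xi>) / of_int M"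
      using P d by (simp add: M_def add_divide_distrib distrib_right)
    ultimately show ?thesis by (simp add: G_def e_char_add)
  qed
  have "twisted_sum g M \<xi> = (\<Sum>a\<in>{0..<M}. G a)" by (simp add: twisted_sum_def G_def)
  also have "\<dots> = (\<Sum>a\<in>{0..<M}. G (a + P))" by (rule sum_periodic_shift[OF M perG, symmetric])
  also have "\<dots> = e_char (of_int \<xi> / of_int d) * (\<Sum>a\<in>{0..<M}. G a)" by (simp add: step sum_distrib_left)
  also have "(\<Sum>a\<in>{0..<M}. G a) = twisted_sum g M \<xi>" by (simp add: twisted_sum_def G_def)
  finally have "twisted_sum g M \<xi> = e_char (of_int \<xi> / of_int d) * twisted_sum g M \<xi>" .
  then have "(1 - e_char (of_int \<xi> / of_int d)) * twisted_sum g M \<xi> = 0" by (simp add: left_diff_distrib)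
  moreover have "e_char (of_int \<xi> / of_int d) \<noteq> 1"
  proof
    assume "e_char (of_int \<xi> / of_int d) = 1"
    then obtain k where "of_int \<xi> / of_int d = (of_int k :: real)" by (auto simp: e_char_eq_1_iff elim: Ints_cases)
    then have "(of_int \<xi> :: real) = of_int (k * d)" using d by (simp add: divide_eq_eq)
    then have "\<xi> = k * d" by (simp only: of_int_eq_iff)
    then show False using nd by simp
  qed
  ultimately show ?thesis by (simp add: M_def)
qed

text \<open>Writing a = b N N' + d M M' splits the fraction a / (M N) into b N' / M + d M' / N
  modulo 1. This is how the inverses enter the frequencies.\<close>

lemma twisted_sum_crt:
  assumes M: "M > 0" and N: "N > 0" and inv: "[N * N' = 1] (mod M)" "[M * M' = 1] (mod N)"
    and g: "\<And>a b. [a = b] (mod M) \<Longrightarrow> g a = g b" and h: "\<And>a b. [a = b] (mod N) \<Longrightarrow> h a = h b"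
  shows "twisted_sum (\<lambda>a. g a * h a) (M * N) \<xi> = twisted_sum g M (\<xi> * N') * twisted_sum h N (\<xi> * M')"
proof -
  have MN: "M * N > 0" using M N by simp
  have cop: "coprime M N"
    using inv(1) by (metis coprime_iff_invertible_int coprime_commute cong_sym mult.commute)
  define c where "c b d = b * (N * N') + d * (M * M')" for b d
  have cM: "[c b d = b] (mod M)" for b d
  proof -
    have "[b * (N * N') + d * (M * M') = b * 1 + 0] (mod M)"
      by (intro cong_add cong_scalar_left inv(1)) (simp add: cong_0_iff)
    then show ?thesis by (simp add: c_def)
  qed
  have cN: "[c b d = d] (mod N)" for b d
  proof -
    have "[b * (N * N') + d * (M * M') = 0 + d * 1] (mod N)"
      by (intro cong_add cong_scalar_left inv(2)) (simp add: cong_0_iff)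
    then show ?thesis by (simp add: c_def)
  qed
  have "twisted_sum g M (\<xi> * N') * twisted_sum h N (\<xi> * M')
     = (\<Sum>(b, d)\<in>{0..<M} \<times> {0..<N}. (g b * e_char (of_int (b * (\<xi> * N')) / of_int M)) * (h d * e_char (of_int (d * (\<xi> * M')) / of_int N)))"
    by (simp add: twisted_sum_def sum_product sum.cartesian_product)
  also have "\<dots> = (\<Sum>a\<in>{0..<M * N}. (g a * h a) * e_char (of_int (a * \<xi>) / of_int (M * N)))"
  proof (rule sum.reindex_bij_witness[of _ "\<lambda>a. (a mod M, a mod N)" "\<lambda>(b, d). c b d mod (M * N)"])
    fix z assume "z \<in> {0..<M} \<times> {0..<N}"
    then obtain b d where z: "z = (b, d)" "0 \<le> b" "b < M" "0 \<le> d" "d < N" by auto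
    have 1: "[c b d mod (M * N) = b] (mod M)"
      using cM[of b d] by (simp add: Cong.cong_def mod_mod_cancel)
    have 2: "[c b d mod (M * N) = d] (mod N)"
      using cN[of b d] by (simp add: Cong.cong_def mod_mod_cancel)
    show "(case z of (b, d) \<Rightarrow> c b d mod (M * N)) \<in> {0..<M * N}" using MN z by simp
    show "((case z of (b, d) \<Rightarrow> c b d mod (M * N)) mod M, (case z of (b, d) \<Rightarrow> c b d mod (M * N)) mod N) = z"
      using 1 2 z by (simp add: Cong.cong_def)
    have "e_char (of_int (c b d mod (M * N) * \<xi>) / of_int (M * N)) = e_char (of_int (c b d * \<xi>) / of_int (M * N))"
      using MN by (intro e_char_cong cong_scalar_right) auto
    also have "c b d * \<xi> = b * (\<xi> * N') * N + d * (\<xi> * M') * M"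
      by (simp add: c_def algebra_simps)
    also have "(of_int (b * (\<xi> * N') * N + d * (\<xi> * M') * M) / of_int (M * N) :: real)
        = of_int (b * (\<xi> * N')) / of_int M + of_int (d * (\<xi> * M')) / of_int N"
      using M N by (simp add: add_divide_distrib)
    finally show "(g (case z of (b, d) \<Rightarrow> c b d mod (M * N)) * h (case z of (b, d) \<Rightarrow> c b d mod (M * N)))
        * e_char (of_int ((case z of (b, d) \<Rightarrow> c b d mod (M * N)) * \<xi>) / of_int (M * N))
      = (case z of (b, d) \<Rightarrow> (g b * e_char (of_int (b * (\<xi> * N')) / of_int M)) * (h d * e_char (of_int (d * (\<xi> * M')) / of_int N)))"
      using g[OF 1] h[OF 2] z by (simp add: e_char_add)
  next
    fix a assume a: "a \<in> {0..<M * N}"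
    show "(a mod M, a mod N) \<in> {0..<M} \<times> {0..<N}" using M N by simp
    have "[c (a mod M) (a mod N) = a] (mod M)" using cM[of "a mod M" "a mod N"] by (simp add: Cong.cong_def)
    moreover have "[c (a mod M) (a mod N) = a] (mod N)" using cN[of "a mod M" "a mod N"] by (simp add: Cong.cong_def)
    ultimately have "[c (a mod M) (a mod N) = a] (mod (M * N))" using cop by (simp add: coprime_cong_mult)
    then show "(case (a mod M, a mod N) of (b, d) \<Rightarrow> c b d mod (M * N)) = a" using a by (simp add: Cong.cong_def)
  qed
  finally show ?thesis by (simp add: twisted_sum_def)
qed

lemma norm_twisted_sum_le:
  assumes "\<And>a. norm (g a) \<le> 1"
  shows "norm (twisted_sum g M \<xi>) \<le> real (card {a\<in>{0..<M}. g a \<noteq> 0})"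
proof -
  have "norm (twisted_sum g M \<xi>) \<le> (\<Sum>a\<in>{0..<M}. norm (g a))"
    unfolding twisted_sum_def by (rule order_trans[OF norm_sum]) (simp add: norm_mult)
  also have "\<dots> \<le> (\<Sum>a\<in>{0..<M}. if g a \<noteq> 0 then 1 else 0)"
    by (intro sum_mono) (use assms in auto)
  also have "\<dots> = real (card {a\<in>{0..<M}. g a \<noteq> 0})"
    by (simp add: sum.inter_filter[symmetric])
  finally show ?thesis .
qed

lemma Legendre_cong:
  assumes "[a = b] (mod p)" shows "Legendre a p = Legendre b p"
proof -
  have "[a = 0] (mod p) \<longleftrightarrow> [b = 0] (mod p)" using assms by (meson cong_sym cong_trans)
  moreover have "QuadRes p a \<longleftrightarrow> QuadRes p b" unfolding QuadRes_def using assms by (meson cong_sym cong_trans)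
  ultimately show ?thesis by (simp add: Legendre_def)
qed

lemma abs_Legendre_le: "\<bar>Legendre a p\<bar> \<le> 1"
  by (simp add: Legendre_def)

lemma Legendre_square_mult:
  assumes p: "prime p" and f: "\<not> p dvd f"
  shows "Legendre (a * f\<^sup>2) p = Legendre a (p :: int)"
proof -
  have cop: "coprime f p" using p f by (metis coprime_commute prime_imp_coprime)
  then obtain f' where f': "[f * f' = 1] (mod p)" using cong_solve_coprime_int by blast
  have "[a * f\<^sup>2 = 0] (mod p) \<longleftrightarrow> [a = 0] (mod p)"
    using p f by (simp add: cong_0_iff prime_dvd_mult_iff prime_dvd_power_iff)
  moreover have "QuadRes p (a * f\<^sup>2) \<longleftrightarrow> QuadRes p a"
  proof
    assume "QuadRes p a"
    then obtain y where "[y\<^sup>2 = a] (mod p)" by (auto simp: QuadRes_def)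
    then have "[(y * f)\<^sup>2 = a * f\<^sup>2] (mod p)" by (simp add: power_mult_distrib cong_scalar_right)
    then show "QuadRes p (a * f\<^sup>2)" unfolding QuadRes_def by blast
  next
    assume "QuadRes p (a * f\<^sup>2)"
    then obtain y where "[y\<^sup>2 = a * f\<^sup>2] (mod p)" by (auto simp: QuadRes_def)
    then have "[y\<^sup>2 * f'\<^sup>2 = a * f\<^sup>2 * f'\<^sup>2] (mod p)" by (rule cong_scalar_right)
    moreover have "[a * (f * f')\<^sup>2 = a * 1\<^sup>2] (mod p)" by (intro cong_scalar_left cong_pow f')
    moreover have "a * f\<^sup>2 * f'\<^sup>2 = a * (f * f')\<^sup>2" by (simp add: power_mult_distrib)
    ultimately have "[(y * f')\<^sup>2 = a] (mod p)" by (simp add: power_mult_distrib) (meson cong_trans)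
    then show "QuadRes p a" unfolding QuadRes_def by blast
  qed
  ultimately show ?thesis by (simp add: Legendre_def)
qed

section \<open>The sums Kl\<close>

text \<open>The side conditions are turned into zero values, which makes the summand a periodic
  function on all integers.\<close>

definition kl_weight :: "nat \<Rightarrow> nat \<Rightarrow> nat \<Rightarrow> int \<Rightarrow> complex" where
  "kl_weight l f n a =
     (if [a\<^sup>2 = 4 * int n] (mod (int f)\<^sup>2) \<and> ((a\<^sup>2 - 4 * int n) div (int f)\<^sup>2) mod 4 \<in> {0, 1}
      then of_int (kronecker ((a\<^sup>2 - 4 * int n) div (int f)\<^sup>2) l) else 0)"

lemma Kl_sum_eq_twisted_sum:
  "Kl_sum l f \<xi> n = twisted_sum (kl_weight l f n) (4 * int l * (int f)\<^sup>2) \<xi>"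
proof -
  let ?M = "4 * int l * (int f)\<^sup>2"
  let ?P = "\<lambda>a. [a\<^sup>2 = 4 * int n] (mod (int f)\<^sup>2) \<and> ((a\<^sup>2 - 4 * int n) div (int f)\<^sup>2) mod 4 \<in> {0, 1}"
  have "Kl_sum l f \<xi> n = (\<Sum>a\<in>{a\<in>{0..<?M}. ?P a}. kl_weight l f n a * e_char (of_int (a * \<xi>) / of_int ?M))"
    unfolding Kl_sum_def by (rule sum.cong) (auto simp: kl_weight_def)
  also have "\<dots> = twisted_sum (kl_weight l f n) ?M \<xi>"
    unfolding twisted_sum_def by (rule sum.mono_neutral_left) (auto simp: kl_weight_def)
  finally show ?thesis .
qed

lemma abs_kronecker_prime_le: "\<bar>kronecker_prime a p\<bar> \<le> 1"
  by (simp add: kronecker_prime_def abs_Legendre_le)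

lemma abs_kronecker_le: "\<bar>kronecker a l\<bar> \<le> 1"
  unfolding kronecker_def abs_prod power_abs
  by (intro prod_le_1) (auto simp: abs_kronecker_prime_le power_le_one)

lemma norm_kl_weight_le: "norm (kl_weight l f n a) \<le> 1"
proof -
  have "norm (of_int (kronecker b l) :: complex) = of_int \<bar>kronecker b l\<bar>" for b
    by (simp only: norm_of_int of_int_abs)
  also have "\<dots> b \<le> 1" for b using abs_kronecker_le[of b l] by simp
  finally show ?thesis by (simp add: kl_weight_def)
qed

lemma kronecker_prime_cong:
  assumes "[a = b] (mod 8 * int r)" "p dvd r"
  shows "kronecker_prime a p = kronecker_prime b p"
proof (cases "p = 2")
  case True
  have 8: "a mod 8 = b mod 8" using assms(1) by (metis Cong.cong_def cong_modulus_mult)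
  then have "even a \<longleftrightarrow> even b" by presburger
  then show ?thesis using 8 by (simp add: kronecker_prime_def True)
next
  case False
  have "int p dvd 8 * int r" using assms(2) by (simp add: dvd_mult)
  then have "[a = b] (mod int p)" using assms(1) by (rule cong_dvd_modulus[rotated])
  then show ?thesis using False by (simp add: kronecker_prime_def Legendre_cong)
qed

text \<open>Replacing a by a + 4 r f^2 k changes (a^2 - 4 n) / f^2 by a multiple of 8 r. The
  Kronecker symbol depends only on the residues modulo 8 and modulo the primes dividing
  \<open>l\<close>, so any \<open>r\<close> containing these primes will do. When \<open>l\<close>
  has repeated primes this period can be shorter than 4 l f^2.\<close>

lemma kl_weight_periodic:
  assumes f: "f > 0" and r: "\<And>p. p \<in> prime_factors l \<Longrightarrow> p dvd r"
    and ab: "[a = b] (mod 4 * int r * (int f)\<^sup>2)"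
  shows "kl_weight l f n a = kl_weight l f n b"
proof -
  define F where "F = (int f)\<^sup>2"
  have F: "F > 0" using f by (simp add: F_def)
  have "4 * int r * F dvd a - b" using ab by (simp add: cong_iff_dvd_diff F_def)
  then obtain k where "a - b = 4 * int r * F * k" by (rule dvdE)
  then have a: "a = b + 4 * int r * F * k" by simp
  define w where "w = b * k + 2 * int r * F * k\<^sup>2"
  have sq: "a\<^sup>2 - 4 * int n = (b\<^sup>2 - 4 * int n) + (8 * int r * w) * F"
    unfolding a w_def by (simp add: power2_eq_square algebra_simps)
  have D: "(a\<^sup>2 - 4 * int n) div F = 8 * int r * w + (b\<^sup>2 - 4 * int n) div F"
    unfolding sq using F by (simp only: div_mult_self1[OF less_imp_neq[OF F, symmetric]])
  have c1: "[a\<^sup>2 = 4 * int n] (mod F) \<longleftrightarrow> [b\<^sup>2 = 4 * int n] (mod F)"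
    unfolding cong_iff_dvd_diff sq by (simp add: dvd_add_left_iff)
  have c2: "((a\<^sup>2 - 4 * int n) div F) mod 4 = ((b\<^sup>2 - 4 * int n) div F) mod 4"
    unfolding D by (simp add: mod_eq_dvd_iff)
  have "[8 * int r * w + (b\<^sup>2 - 4 * int n) div F = (b\<^sup>2 - 4 * int n) div F] (mod 8 * int r)"
    by (simp add: cong_iff_dvd_diff)
  then have c3: "kronecker ((a\<^sup>2 - 4 * int n) div F) l = kronecker ((b\<^sup>2 - 4 * int n) div F) l"
    unfolding D kronecker_def
    by (intro prod.cong refl arg_cong2[where f = "(^)"] kronecker_prime_cong[of _ _ r] r) auto
  show ?thesis unfolding kl_weight_def F_def[symmetric] c1 c2 c3 ..
qed

lemma kronecker_mult_prime:
  assumes p: "prime p" "\<not> p dvd l" and l: "l > 0"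
  shows "kronecker a (p * l) = kronecker_prime a p * kronecker a l"
proof -
  have p0: "p \<noteq> 0" using p by auto
  have pf: "prime_factors (p * l) = insert p (prime_factors l)"
    using p l p0 by (simp add: prime_factors_product prime_factorization_prime)
  have np: "p \<notin> prime_factors l" using p by auto
  have mp: "multiplicity p (p * l) = 1"
    using p l p0 by (simp add: prime_elem_multiplicity_mult_distrib not_dvd_imp_multiplicity_0)
  have mq: "multiplicity q (p * l) = multiplicity q l" if "q \<in> prime_factors l" for q
  proof -
    have "q \<noteq> p" "prime q" using that np by auto
    then have "multiplicity q p = 0" using p by (simp add: prime_multiplicity_other)
    then show ?thesis using \<open>prime q\<close> l p0 by (simp add: prime_elem_multiplicity_mult_distrib)
  qed
  have "kronecker a (p * l) = kronecker_prime a p ^ multiplicity p (p * l) * (\<Prod>q\<in>prime_factors l. kronecker_prime a q ^ multiplicity q (p * l))"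
    unfolding kronecker_def pf using np by (subst prod.insert) auto
  also have "(\<Prod>q\<in>prime_factors l. kronecker_prime a q ^ multiplicity q (p * l)) = kronecker a l"
    unfolding kronecker_def by (intro prod.cong refl) (simp add: mq)
  finally show ?thesis by (simp add: mp)
qed

text \<open>\<open>f\<close> is invertible modulo \<open>p\<close>, so dividing the discriminant by
  its square does not change the Legendre symbol.\<close>

lemma kl_weight_mult_prime:
  assumes p: "prime p" "p \<noteq> 2" "\<not> p dvd l" "\<not> p dvd f" and l: "l > 0"
  shows "kl_weight (p * l) f n a = of_int (Legendre (a\<^sup>2 - 4 * int n) (int p)) * kl_weight l f n a"
proof (cases "[a\<^sup>2 = 4 * int n] (mod (int f)\<^sup>2)")
  case True
  define D where "D = (a\<^sup>2 - 4 * int n) div (int f)\<^sup>2"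
  have "(int f)\<^sup>2 dvd a\<^sup>2 - 4 * int n" using True by (simp add: cong_iff_dvd_diff)
  then have "a\<^sup>2 - 4 * int n = D * (int f)\<^sup>2" by (simp add: D_def)
  moreover have "Legendre (D * (int f)\<^sup>2) (int p) = Legendre D (int p)"
    using p by (intro Legendre_square_mult) auto
  ultimately have "Legendre (a\<^sup>2 - 4 * int n) (int p) = Legendre D (int p)" by (simp only:)
  moreover have "kronecker D (p * l) = Legendre D (int p) * kronecker D l"
    using kronecker_mult_prime[OF p(1,3) l] p(2) by (simp add: kronecker_prime_def)
  ultimately show ?thesis by (auto simp: kl_weight_def D_def[symmetric])
qed (simp add: kl_weight_def)

text \<open>The summand has period 4 r f^2, and the range of summation consists of \<open>d\<close>
  such periods.\<close>

lemma Kl_sum_eq_0: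
  assumes f: "f > 0" and l: "l = r * d" "l > 0" and r: "\<And>p. p \<in> prime_factors l \<Longrightarrow> p dvd r"
    and nd: "\<not> int d dvd \<xi>"
  shows "Kl_sum l f \<xi> n = 0"
proof -
  have "twisted_sum (kl_weight l f n) (4 * int r * (int f)\<^sup>2 * int d) \<xi> = 0"
    using l f nd by (intro twisted_sum_eq_0 kl_weight_periodic[OF f r]) auto
  then show ?thesis unfolding Kl_sum_eq_twisted_sum using l(1) by (simp add: mult_ac)
qed

lemma sum_e_char_eq_0:
  assumes "prime p" "\<not> int p dvd \<eta>"
  shows "(\<Sum>a\<in>{0..<int p}. e_char (of_int (a * \<eta>) / real p)) = 0"
  using twisted_sum_eq_0[of 1 "int p" "\<lambda>_. 1" \<eta>] assms prime_gt_0_nat by (simp add: twisted_sum_def)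

text \<open>Weil's bound needs \<open>p\<close> to divide neither argument. If \<open>p\<close>
  divides \<open>\<xi>\<close>, the trivial bound is taken; if \<open>p\<close> divides only
  \<open>n\<close>, the Legendre symbol is 1 except at 0, and the sum is -1.\<close>

lemma norm_quad_char_sum_le:
  assumes p: "prime p" "p \<noteq> 2"
  shows "norm (quad_char_sum p n \<xi>) \<le> (if int p dvd \<xi> then real p else 2 * sqrt (real p))"
proof -
  have p2: "p \<ge> 2" using p prime_ge_2_nat by blast
  show ?thesis
  proof (cases "int p dvd \<xi>")
    case True
    have "norm (quad_char_sum p n \<xi>) \<le> (\<Sum>a\<in>{0..<int p}. 1)"
      unfolding quad_char_sum_def
      by (intro sum_norm_le) (simp add: norm_mult abs_Legendre_le flip: of_int_abs)
    then show ?thesis using True by simp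
  next
    case False
    show ?thesis
    proof (cases "int p dvd n")
      case pn: True
      have "quad_char_sum p n \<xi> = (\<Sum>a\<in>{0..<int p}. e_char (of_int (a * \<xi>) / real p) - (if a = 0 then 1 else 0))"
        unfolding quad_char_sum_def
      proof (rule sum.cong[OF refl])
        fix a assume a: "a \<in> {0..<int p}"
        have "[a\<^sup>2 - 4 * n = a\<^sup>2] (mod int p)" using pn by (simp add: cong_iff_dvd_diff)
        then have L: "Legendre (a\<^sup>2 - 4 * n) (int p) = Legendre (a\<^sup>2) (int p)" by (rule Legendre_cong)
        have "Legendre (a\<^sup>2) (int p) = (if a = 0 then 0 else 1)"
        proof (cases "a = 0")
          case False
          then have "\<not> int p dvd a" using a by (auto dest: zdvd_imp_le)
          then have "\<not> int p dvd a\<^sup>2" using p by (simp add: prime_dvd_power_iff)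
          moreover have "QuadRes (int p) (a\<^sup>2)" unfolding QuadRes_def by (rule exI[of _ a]) simp
          ultimately show ?thesis using False by (simp add: Legendre_def cong_0_iff)
        qed (simp add: Legendre_def)
        then show "of_int (Legendre (a\<^sup>2 - 4 * n) (int p)) * e_char (of_int (a * \<xi>) / real p)
            = e_char (of_int (a * \<xi>) / real p) - (if a = 0 then 1 else 0)"
          unfolding L using e_char_of_int[of 0] by simp
      qed
      also have "\<dots> = - 1"
        unfolding sum_subtractf sum_e_char_eq_0[OF p(1) False] using p2 by simp
      finally have "norm (quad_char_sum p n \<xi>) = 1" by simp
      also have "1 \<le> 2 * sqrt (real p)"
      proof -
        have "1 \<le> sqrt (real p)" using p2 by simp
        then show ?thesis by linarith
      qed
      finally show ?thesis using False by simp
    next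
      case pn: False
      then show ?thesis using quad_char_sum_bound[OF p pn False] False by simp
    qed
  qed
qed

definition sqrt_count :: "nat \<Rightarrow> nat \<Rightarrow> nat" where
  "sqrt_count f n = card {a \<in> {0..<(int f)\<^sup>2}. [a\<^sup>2 = 4 * int n] (mod (int f)\<^sup>2)}"

text \<open>Each square root of 4 n modulo f^2 has 4 l lifts to the range of summation, and every
  term has absolute value at most 1.\<close>

lemma norm_Kl_sum_trivial:
  assumes f: "f > 0"
  shows "norm (Kl_sum l f \<xi> n) \<le> 4 * real l * real (sqrt_count f n)"
proof -
  define F where "F = (int f)\<^sup>2"
  have F: "F > 0" using f by (simp add: F_def)
  let ?S = "{a \<in> {0..<F}. [a\<^sup>2 = 4 * int n] (mod F)}"
  let ?T = "{a\<in>{0..<4 * int l * F}. kl_weight l f n a \<noteq> 0}"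
  have finS: "finite ?S" by (rule finite_subset[of _ "{0..<F}"]) auto
  have "norm (Kl_sum l f \<xi> n) \<le> real (card ?T)"
    unfolding Kl_sum_eq_twisted_sum F_def by (rule norm_twisted_sum_le[OF norm_kl_weight_le])
  also have "card ?T \<le> card ({0..<4 * int l} \<times> ?S)"
  proof (rule card_inj_on_le[of "\<lambda>a. (a div F, a mod F)"])
    show "inj_on (\<lambda>a. (a div F, a mod F)) ?T"
      by (rule inj_onI) (metis Pair_inject div_mult_mod_eq)
    show "(\<lambda>a. (a div F, a mod F)) ` ?T \<subseteq> {0..<4 * int l} \<times> ?S"
    proof clarify
      fix a assume a: "a \<in> {0..<4 * int l * F}" "kl_weight l f n a \<noteq> 0"
      have "[a\<^sup>2 = 4 * int n] (mod F)" using a(2) by (auto simp: kl_weight_def F_def split: if_splits)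
      then have "[(a mod F)\<^sup>2 = 4 * int n] (mod F)" by (simp add: Cong.cong_def power_mod)
      moreover have "a div F < 4 * int l"
      proof -
        have "a div F * F \<le> a" using F by (simp flip: minus_mod_eq_div_mult)
        then have "a div F * F < 4 * int l * F" using a(1) by simp
        then show ?thesis using F by (simp only: mult_less_cancel_right_pos)
      qed
      moreover have "0 \<le> a div F" using a(1) F by (simp add: pos_imp_zdiv_nonneg_iff)
      ultimately show "a div F \<in> {0..<4 * int l} \<and> a mod F \<in> ?S" using F by auto
    qed
    show "finite ({0..<4 * int l} \<times> ?S)" using finS by simp
  qed
  also have "card ({0..<4 * int l} \<times> ?S) = 4 * l * sqrt_count f n"
    by (simp add: card_cartesian_product sqrt_count_def F_def nat_mult_distrib)
  finally show ?thesis by simp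
qed

text \<open>Induction over the good primes, each split off by the Chinese remainder theorem, with
  the trivial bound for what is left. The frequency must stay arbitrary because each stage
  multiplies it by inverses; these are units modulo the primes concerned, so divisibility of
  \<open>\<xi>\<close> by them is preserved.\<close>

lemma norm_Kl_sum_le:
  assumes "finite A" and "\<And>p. p \<in> A \<Longrightarrow> prime p \<and> p \<noteq> 2 \<and> \<not> p dvd f \<and> \<not> p dvd s" and f: "f > 0" and s: "s > 0"
  shows "norm (Kl_sum (\<Prod>A * s) f \<xi> n) \<le>
    (\<Prod>p\<in>A. if int p dvd \<xi> then real p else 2 * sqrt (real p)) * (4 * real s * real (sqrt_count f n))"
  using assms(1,2)
proof (induction A arbitrary: \<xi> rule: finite_induct)
  case empty
  then show ?case using norm_Kl_sum_trivial[OF f, of s \<xi> n] by simp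
next
  case (insert p A)
  define l where "l = \<Prod>A * s"
  have p: "prime p" "p \<noteq> 2" "\<not> p dvd f" "\<not> p dvd s" using insert by auto
  have A0: "\<Prod>A > 0" using insert by (intro prod_pos) (auto simp: prime_gt_0_nat)
  then have l: "l > 0" using s by (simp add: l_def)
  have pA: "\<not> p dvd \<Prod>A"
  proof
    assume "p dvd \<Prod>A"
    then obtain q where "q \<in> A" "p dvd q" using p(1) insert(1) by (auto simp: prime_dvd_prod_iff)
    then show False using p(1) insert by (metis insertCI primes_dvd_imp_eq)
  qed
  then have pl: "\<not> p dvd l" using p by (simp add: l_def prime_dvd_mult_iff)
  define N where "N = 4 * int l * (int f)\<^sup>2"
  have N: "N > 0" using l f by (simp add: N_def)
  have "\<not> p dvd 4 * l * f\<^sup>2"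
  proof
    assume "p dvd 4 * l * f\<^sup>2"
    then have "p dvd 2\<^sup>2" using p pl by (simp add: prime_dvd_mult_iff prime_dvd_power_iff)
    then have "p dvd 2" using p(1) prime_dvd_power by blast
    then show False using p by (metis primes_dvd_imp_eq two_is_prime_nat)
  qed
  then have "coprime p (4 * l * f\<^sup>2)" by (rule prime_imp_coprime[OF p(1)])
  then have "coprime (int p) (int (4 * l * f\<^sup>2))" by (simp only: coprime_int_iff)
  then have cop: "coprime (int p) N" by (simp add: N_def)
  obtain N' where N': "[N * N' = 1] (mod int p)" using cop cong_solve_coprime_int coprime_commute by blast
  obtain P' where P': "[int p * P' = 1] (mod N)" using cop cong_solve_coprime_int by blast
  have p0: "int p > 0" using p prime_gt_0_nat by simp
  have perL: "of_int (Legendre (a\<^sup>2 - 4 * int n) (int p)) = (of_int (Legendre (b\<^sup>2 - 4 * int n) (int p)) :: complex)"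
    if "[a = b] (mod int p)" for a b
    using Legendre_cong[OF cong_diff[OF cong_pow[OF that, of 2] cong_refl]] by simp
  have perW: "kl_weight l f n a = kl_weight l f n b" if "[a = b] (mod N)" for a b
    using that unfolding N_def by (intro kl_weight_periodic[OF f]) auto
  have "Kl_sum (p * l) f \<xi> n = twisted_sum (\<lambda>a. of_int (Legendre (a\<^sup>2 - 4 * int n) (int p)) * kl_weight l f n a) (int p * N) \<xi>"
  proof -
    have "kl_weight (p * l) f n = (\<lambda>a. of_int (Legendre (a\<^sup>2 - 4 * int n) (int p)) * kl_weight l f n a)"
      by (rule ext) (rule kl_weight_mult_prime[OF p(1,2) pl p(3) l])
    moreover have "4 * int (p * l) * (int f)\<^sup>2 = int p * N" by (simp add: N_def)
    ultimately show ?thesis by (simp only: Kl_sum_eq_twisted_sum)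
  qed
  also have "\<dots> = twisted_sum (\<lambda>a. of_int (Legendre (a\<^sup>2 - 4 * int n) (int p))) (int p) (\<xi> * N') * twisted_sum (kl_weight l f n) N (\<xi> * P')"
    by (rule twisted_sum_crt[OF p0 N N' P']) (use perL perW in blast)+
  also have "\<dots> = quad_char_sum p (int n) (\<xi> * N') * Kl_sum l f (\<xi> * P') n"
    by (simp add: Kl_sum_eq_twisted_sum N_def twisted_sum_def quad_char_sum_def)
  finally have eq: "Kl_sum (p * l) f \<xi> n = quad_char_sum p (int n) (\<xi> * N') * Kl_sum l f (\<xi> * P') n" .
  have "coprime (int p) N'" using N' by (metis cong_sym coprime_1_right cong_imp_coprime coprime_mult_right_iff coprime_commute)
  then have dp: "int p dvd \<xi> * N' \<longleftrightarrow> int p dvd \<xi>" by (simp add: coprime_dvd_mult_left_iff)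
  have dq: "int q dvd \<xi> * P' \<longleftrightarrow> int q dvd \<xi>" if "q \<in> A" for q
  proof -
    have "q dvd \<Prod>A" using dvd_prodI[OF insert(1) that, of "\<lambda>x. x"] by simp
    then have "q dvd 4 * l * f\<^sup>2" by (simp add: l_def)
    then have "int q dvd int (4 * l * f\<^sup>2)" by (simp only: int_dvd_int_iff)
    then have "int q dvd N" by (simp add: N_def)
    moreover have "coprime N P'" using P' by (metis cong_sym coprime_1_right cong_imp_coprime coprime_mult_right_iff coprime_commute)
    ultimately have "coprime (int q) P'" by (meson coprime_divisors dvd_refl)
    then show ?thesis by (simp add: coprime_dvd_mult_left_iff)
  qed
  define B where "B p \<xi> = (if int p dvd \<xi> then real p else 2 * sqrt (real p))" for p \<xi>
  have B0: "B p \<xi> \<ge> 0" for p \<xi> by (simp add: B_def)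
  have "norm (Kl_sum (p * l) f \<xi> n) \<le> B p (\<xi> * N') * ((\<Prod>q\<in>A. B q (\<xi> * P')) * (4 * real s * real (sqrt_count f n)))"
    unfolding eq norm_mult using norm_quad_char_sum_le[OF p(1,2)] insert.IH[of "\<xi> * P'"] insert.prems B0
    by (intro mult_mono) (auto simp: B_def l_def)
  also have "B p (\<xi> * N') = B p \<xi>" by (simp add: B_def dp)
  also have "(\<Prod>q\<in>A. B q (\<xi> * P')) = (\<Prod>q\<in>A. B q \<xi>)" by (intro prod.cong refl) (simp add: B_def dq)
  finally show ?case using insert(1,2) by (simp add: B_def l_def mult_ac)
qed

section \<open>Averages over the moduli: divisor sums, square root counts and the mean of Kl\<close>

section \<open>Divisor sums\<close>

definition num_divisors :: "nat \<Rightarrow> nat" where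
  "num_divisors n = card {d. d dvd n}"

lemma num_divisors_mult_le:
  assumes "a > 0" "b > 0"
  shows "num_divisors (a * b) \<le> num_divisors a * num_divisors b"
proof -
  have "{d. d dvd a * b} \<subseteq> (\<lambda>(x, y). x * y) ` ({d. d dvd a} \<times> {d. d dvd b})"
  proof
    fix d assume "d \<in> {d. d dvd a * b}"
    then have "d dvd a * b" by simp
    then obtain x y where "d = x * y" "x dvd a" "y dvd b" by (rule division_decomp[elim_format]) auto
    then show "d \<in> (\<lambda>(x, y). x * y) ` ({d. d dvd a} \<times> {d. d dvd b})" by auto
  qed
  moreover have fin: "finite ({d. d dvd a} \<times> {d. d dvd b})" using assms by (auto intro!: finite_divisors_nat)
  ultimately have "num_divisors (a * b) \<le> card ((\<lambda>(x, y). x * y) ` ({d. d dvd a} \<times> {d. d dvd b}))"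
    unfolding num_divisors_def by (intro card_mono) auto
  also have "\<dots> \<le> card ({d. d dvd a} \<times> {d. d dvd b})" by (rule card_image_le[OF fin])
  finally show ?thesis by (simp add: card_cartesian_product num_divisors_def)
qed

lemma sum_divisors_swap:
  fixes F :: "nat \<Rightarrow> nat \<Rightarrow> real"
  shows "(\<Sum>g\<in>{1..G}. \<Sum>a | a dvd g. F a (g div a)) = (\<Sum>a\<in>{1..G}. \<Sum>b\<in>{1..G div a}. F a b)"
proof -
  have "(\<Sum>g\<in>{1..G}. \<Sum>a | a dvd g. F a (g div a)) = (\<Sum>(g, a)\<in>Sigma {1..G} (\<lambda>g. {a. a dvd g}). F a (g div a))"
    by (rule sum.Sigma) (auto intro!: finite_divisors_nat)
  also have "\<dots> = (\<Sum>(a, b)\<in>Sigma {1..G} (\<lambda>a. {1..G div a}). F a b)"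
  proof (rule sum.reindex_bij_witness[of _ "\<lambda>(a, b). (a * b, a)" "\<lambda>(g, a). (a, g div a)"])
    fix z assume "z \<in> Sigma {1..G} (\<lambda>g. {a. a dvd g})"
    then obtain g a where z: "z = (g, a)" "1 \<le> g" "g \<le> G" "a dvd g" by auto
    have a: "a > 0" using z by (intro Nat.gr0I) auto
    have ab: "g = a * (g div a)" using z by simp
    then have "g div a > 0" using z by (intro Nat.gr0I) auto
    moreover have "g div a \<le> G div a" using z by (intro div_le_mono)
    moreover have "a \<le> G" using z by (meson dvd_imp_le less_le_trans zero_less_one le_trans)
    ultimately show "(case z of (g, a) \<Rightarrow> (a, g div a)) \<in> Sigma {1..G} (\<lambda>a. {1..G div a})"
      using z a by auto
  next
    fix z assume "z \<in> Sigma {1..G} (\<lambda>a. {1..G div a})"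
    then obtain a b where z: "z = (a, b)" "1 \<le> a" "a \<le> G" "1 \<le> b" "b \<le> G div a" by auto
    have "a * b \<le> G" using z(5) by (metis div_times_less_eq_dividend le_trans mult.commute mult_le_mono1)
    then show "(case z of (a, b) \<Rightarrow> (a * b, a)) \<in> Sigma {1..G} (\<lambda>g. {a. a dvd g})" using z by auto
    show "(case case z of (a, b) \<Rightarrow> (a * b, a) of (g, a) \<Rightarrow> (a, g div a)) = z" using z by auto
  qed auto
  also have "\<dots> = (\<Sum>a\<in>{1..G}. \<Sum>b\<in>{1..G div a}. F a b)" by (rule sum.Sigma[symmetric]) auto
  finally show ?thesis .
qed

lemma sum_divisors_le:
  fixes F :: "nat \<Rightarrow> nat \<Rightarrow> real"
  assumes "\<And>a b. F a b \<ge> 0"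
  shows "(\<Sum>g\<in>{1..G}. \<Sum>a | a dvd g. F a (g div a)) \<le> (\<Sum>a\<in>{1..G}. \<Sum>b\<in>{1..G}. F a b)"
  unfolding sum_divisors_swap using assms
  by (intro sum_mono sum_mono2) (auto intro: le_trans[OF _ div_le_dividend])

text \<open>Induction on \<open>k\<close>. One further factor \<open>num_divisors g\<close> turns
  the term at g into a sum over factorizations g = a b, and submultiplicativity bounds each summand
  by the product of the previous terms at a and b. So the square of the previous bound
  serves.\<close>

lemma sum_divisor_powers_bounded:
  fixes s :: real
  assumes s: "s > 1"
  shows "\<exists>C>0. \<forall>G. (\<Sum>g\<in>{1..G}. real (num_divisors g) ^ k * real g powr - s) \<le> C"
proof (induction k)
  case 0
  have sm: "summable (\<lambda>g. real g powr - s)" using s by (subst summable_real_powr_iff) auto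
  have "(\<Sum>g\<in>{1..G}. real g powr - s) \<le> (\<Sum>g. real g powr - s)" for G
    by (rule sum_le_suminf[OF sm]) auto
  then show ?case
    by (intro exI[of _ "(\<Sum>g. real g powr - s) + 1"]) (force intro: add_nonneg_pos suminf_nonneg[OF sm] add_increasing2)
next
  case (Suc k)
  then obtain C where C: "C > 0" "\<And>G. (\<Sum>g\<in>{1..G}. real (num_divisors g) ^ k * real g powr - s) \<le> C" by blast
  define T where "T g = real (num_divisors g) ^ k * real g powr - s" for g
  have T0: "T g \<ge> 0" for g by (simp add: T_def)
  have "(\<Sum>g\<in>{1..G}. real (num_divisors g) ^ Suc k * real g powr - s) \<le> C * C" for G
  proof -
    have "(\<Sum>g\<in>{1..G}. real (num_divisors g) ^ Suc k * real g powr - s) = (\<Sum>g\<in>{1..G}. \<Sum>a | a dvd g. T g)"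
      by (simp add: T_def num_divisors_def mult_ac)
    also have "\<dots> \<le> (\<Sum>g\<in>{1..G}. \<Sum>a | a dvd g. T a * T (g div a))"
    proof (intro sum_mono)
      fix g a assume g: "g \<in> {1..G}" and a: "a \<in> {a. a dvd g}"
      define b where "b = g div a"
      have ab: "g = a * b" using a by (simp add: b_def)
      then have pos: "a > 0" "b > 0" using g by (auto intro: Nat.gr0I)
      have "T g \<le> real (num_divisors a * num_divisors b) ^ k * real g powr - s"
        unfolding T_def using num_divisors_mult_le[OF pos] ab
        by (intro mult_right_mono power_mono) (auto simp only: of_nat_le_iff of_nat_0_le_iff powr_ge_zero)
      also have "\<dots> = T a * T b" by (simp add: T_def ab powr_mult power_mult_distrib mult_ac)
      finally show "T g \<le> T a * T (g div a)" by (simp add: b_def)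
    qed
    also have "\<dots> \<le> (\<Sum>a\<in>{1..G}. \<Sum>b\<in>{1..G}. T a * T b)"
      by (rule sum_divisors_le) (simp add: T0)
    also have "\<dots> = (\<Sum>a\<in>{1..G}. T a) * (\<Sum>b\<in>{1..G}. T b)" by (simp add: sum_product)
    also have "\<dots> \<le> C * C" using C T0 by (intro mult_mono) (auto simp: T_def intro!: sum_nonneg)
    finally show ?thesis .
  qed
  then show ?case using C(1) by (intro exI[of _ "C * C"]) simp
qed

lemma harmonic_sum_le: "n > 0 \<Longrightarrow> (\<Sum>k\<in>{1..n}. 1 / real k) \<le> 1 + ln (real n)"
proof (induction n)
  case (Suc n)
  show ?case
  proof (cases "n = 0")
    case False
    then have IH: "(\<Sum>k\<in>{1..n}. 1 / real k) \<le> 1 + ln (real n)" using Suc by simp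
    have 1: "ln (real n / real (Suc n)) \<le> real n / real (Suc n) - 1" using False by (intro ln_le_minus_one) auto
    have "real n / real (Suc n) = (real (Suc n) - 1) / real (Suc n)" by simp
    then have 2: "real n / real (Suc n) = 1 - 1 / real (Suc n)" unfolding diff_divide_distrib by simp
    have 3: "ln (real n / real (Suc n)) = ln (real n) - ln (real (Suc n))" using False by (subst ln_divide_pos) auto
    have "1 / real (Suc n) \<le> ln (real (Suc n)) - ln (real n)" using 1 2 3 by linarith
    then show ?thesis using IH by simp
  qed simp
qed simp

lemma real_div_le: "real (n div x) \<le> real n / real x"
proof (cases "x = 0")
  case False
  have "real (n div x * x) \<le> real n" by (simp only: of_nat_le_iff div_times_less_eq_dividend)
  then show ?thesis using False by (simp add: le_divide_eq)
qed simp

lemma sum_num_divisors_le: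
  assumes "Y > 0"
  shows "(\<Sum>m\<in>{1..Y}. real (num_divisors m)) \<le> real Y * (1 + ln (real Y))"
proof -
  have "(\<Sum>m\<in>{1..Y}. real (num_divisors m)) = (\<Sum>m\<in>{1..Y}. \<Sum>a | a dvd m. 1)"
    by (simp add: num_divisors_def)
  also have "\<dots> = (\<Sum>a\<in>{1..Y}. \<Sum>b\<in>{1..Y div a}. 1)" by (rule sum_divisors_swap)
  also have "\<dots> \<le> (\<Sum>a\<in>{1..Y}. real Y * (1 / real a))"
    by (intro sum_mono) (simp add: real_div_le)
  also have "\<dots> = real Y * (\<Sum>a\<in>{1..Y}. 1 / real a)" by (simp add: sum_distrib_left)
  also have "\<dots> \<le> real Y * (1 + ln (real Y))" using harmonic_sum_le[OF assms] by (intro mult_left_mono) auto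
  finally show ?thesis .
qed

text \<open>Put a = gcd m x and m = a b, and sum over the divisors a of \<open>x\<close> instead.
  The b-sum is shorter by the factor a, which outweighs sqrt a. One factor
  \<open>num_divisors x\<close> comes from \<open>num_divisors a\<close>, the other from the number
  of a.\<close>

lemma sum_num_divisors_gcd_le:
  assumes Y: "Y > 0" and x: "x > 0"
  shows "(\<Sum>m\<in>{1..Y}. real (num_divisors m) * sqrt (real (gcd m x)))
    \<le> real Y * (1 + ln (real Y)) * real (num_divisors x) ^ 2"
proof -
  define D where "D = {e. e dvd x}"
  have finD: "finite D" unfolding D_def using x by (intro finite_divisors_nat) auto
  define F where "F a b = (if a \<in> D then sqrt (real a) * (real (num_divisors a) * real (num_divisors b)) else 0)" for a b
  have F0: "F a b \<ge> 0" for a b by (simp add: F_def)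
  have L0: "1 + ln (real Y) \<ge> 0" using Y by simp
  have "(\<Sum>m\<in>{1..Y}. real (num_divisors m) * sqrt (real (gcd m x))) \<le> (\<Sum>m\<in>{1..Y}. \<Sum>a | a dvd m. F a (m div a))"
  proof (rule sum_mono)
    fix m assume m: "m \<in> {1..Y}"
    define e where "e = gcd m x"
    have me: "m = e * (m div e)" by (simp add: e_def)
    have "m \<noteq> 0" using m by simp
    then have pos: "e > 0" "m div e > 0" using me by (metis gr0I mult_0 mult_0_right)+
    have "real (num_divisors m) \<le> real (num_divisors e * num_divisors (m div e))"
      using num_divisors_mult_le[OF pos] me by (metis of_nat_le_iff)
    then have "sqrt (real e) * real (num_divisors m) \<le> sqrt (real e) * real (num_divisors e * num_divisors (m div e))"
      by (rule mult_left_mono) simp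
    also have "\<dots> = F e (m div e)" by (simp add: F_def D_def e_def)
    also have "\<dots> \<le> (\<Sum>a | a dvd m. F a (m div a))"
      using m by (intro member_le_sum F0) (auto simp: e_def intro!: finite_divisors_nat)
    finally show "real (num_divisors m) * sqrt (real (gcd m x)) \<le> (\<Sum>a | a dvd m. F a (m div a))"
      by (simp add: e_def mult.commute)
  qed
  also have "\<dots> = (\<Sum>a\<in>{1..Y}. \<Sum>b\<in>{1..Y div a}. F a b)" by (rule sum_divisors_swap)
  also have "\<dots> \<le> (\<Sum>a\<in>{1..Y}. if a \<in> D then real (num_divisors x) * (real Y * (1 + ln (real Y))) else 0)"
  proof (rule sum_mono)
    fix a assume a: "a \<in> {1..Y}"
    show "(\<Sum>b\<in>{1..Y div a}. F a b) \<le> (if a \<in> D then real (num_divisors x) * (real Y * (1 + ln (real Y))) else 0)"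
    proof (cases "a \<in> D")
      case True
      have q: "Y div a > 0" using a by (simp add: div_greater_zero_iff)
      have "num_divisors a \<le> num_divisors x"
        unfolding num_divisors_def using True x
        by (intro card_mono) (auto simp: D_def intro: dvd_trans intro!: finite_divisors_nat)
      then have da: "real (num_divisors a) \<le> real (num_divisors x)" by simp
      have "(\<Sum>b\<in>{1..Y div a}. F a b) = sqrt (real a) * real (num_divisors a) * (\<Sum>b\<in>{1..Y div a}. real (num_divisors b))"
        using True by (simp add: F_def sum_distrib_left mult_ac)
      also have "\<dots> \<le> sqrt (real a) * real (num_divisors a) * (real (Y div a) * (1 + ln (real (Y div a))))"
        by (intro mult_left_mono sum_num_divisors_le q) auto
      also have "\<dots> \<le> sqrt (real a) * real (num_divisors x) * (real Y / real a * (1 + ln (real Y)))"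
      proof (intro mult_mono da order_refl)
        show "real (Y div a) \<le> real Y / real a" by (rule real_div_le)
        show "1 + ln (real (Y div a)) \<le> 1 + ln (real Y)"
          unfolding add_le_cancel_left by (subst ln_le_cancel_iff) (use q Y in auto)
      qed (use q L0 in auto)
      also have "\<dots> = real (num_divisors x) * (real Y * (1 + ln (real Y))) * (sqrt (real a) / real a)" by simp
      also have "\<dots> \<le> real (num_divisors x) * (real Y * (1 + ln (real Y))) * 1"
      proof (intro mult_left_mono)
        have "sqrt (real a) \<le> sqrt (real a * real a)" using a by (intro real_sqrt_le_mono) simp
        then show "sqrt (real a) / real a \<le> 1" using a by simp
      qed (use L0 in auto)
      finally show ?thesis using True by simp
    qed (simp add: F_def)
  qed
  also have "\<dots> = (\<Sum>a\<in>{1..Y} \<inter> D. real (num_divisors x) * (real Y * (1 + ln (real Y))))"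
    by (rule sum.inter_restrict[symmetric]) simp
  also have "\<dots> \<le> (\<Sum>a\<in>D. real (num_divisors x) * (real Y * (1 + ln (real Y))))"
    using finD L0 by (intro sum_mono2) auto
  also have "\<dots> = real Y * (1 + ln (real Y)) * real (num_divisors x) ^ 2"
    by (simp add: D_def num_divisors_def power2_eq_square)
  finally show ?thesis .
qed

text \<open>The divisor sum of order -1/2. It arises below from the sum over the part
  \<open>t\<close> of the modulus that divides \<open>2 * f\<close>.\<close>

definition sigma_half :: "nat \<Rightarrow> real" where
  "sigma_half n = (\<Sum>t | t dvd n. 1 / sqrt (real t))"

lemma sigma_half_nonneg: "sigma_half n \<ge> 0"
  by (simp add: sigma_half_def sum_nonneg)

lemma sigma_half_le_num_divisors: "n > 0 \<Longrightarrow> sigma_half n \<le> real (num_divisors n)"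
proof -
  assume n: "n > 0"
  have "sigma_half n \<le> (\<Sum>t | t dvd n. 1)"
    unfolding sigma_half_def
  proof (rule sum_mono)
    fix t assume "t \<in> {t. t dvd n}"
    then have "t \<ge> 1" using n by (metis dvd_pos_nat mem_Collect_eq Suc_leI One_nat_def)
    then show "1 / sqrt (real t) \<le> 1" by simp
  qed
  then show ?thesis by (simp add: num_divisors_def)
qed

lemma sigma_half_mult_le:
  assumes "a > 0" "b > 0"
  shows "sigma_half (a * b) \<le> sigma_half a * sigma_half b"
proof -
  have fin: "finite ({d. d dvd a} \<times> {d. d dvd b})" using assms by (auto intro!: finite_divisors_nat)
  have sub: "{d. d dvd a * b} \<subseteq> (\<lambda>(x, y). x * y) ` ({d. d dvd a} \<times> {d. d dvd b})"
  proof
    fix d assume "d \<in> {d. d dvd a * b}"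
    then have "d dvd a * b" by simp
    then obtain x y where "d = x * y" "x dvd a" "y dvd b" by (rule division_decomp[elim_format]) auto
    then show "d \<in> (\<lambda>(x, y). x * y) ` ({d. d dvd a} \<times> {d. d dvd b})" by auto
  qed
  have "sigma_half (a * b) \<le> (\<Sum>t\<in>(\<lambda>(x, y). x * y) ` ({d. d dvd a} \<times> {d. d dvd b}). 1 / sqrt (real t))"
    unfolding sigma_half_def using fin sub by (intro sum_mono2) auto
  also have "\<dots> \<le> (\<Sum>z\<in>{d. d dvd a} \<times> {d. d dvd b}. 1 / sqrt (real (case z of (x, y) \<Rightarrow> x * y)))"
    using sum_image_le[OF fin, of "\<lambda>t. 1 / sqrt (real t)" "\<lambda>(x, y). x * y"] by (simp add: o_def)
  also have "\<dots> = sigma_half a * sigma_half b"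
    unfolding sigma_half_def sum_product sum.cartesian_product
    by (intro sum.cong) (auto simp: real_sqrt_mult)
  finally show ?thesis .
qed

text \<open>With h = a b the sum is at most the product of a convergent sum of a^(-3/2) and a
  harmonic sum.\<close>

lemma sum_sigma_half_le:
  "\<exists>C>0. \<forall>H>0. (\<Sum>h\<in>{1..H}. sigma_half h / real h) \<le> C * (1 + ln (real H))"
proof -
  obtain C where C: "C > 0" "\<And>G. (\<Sum>g\<in>{1..G}. real (num_divisors g) ^ 0 * real g powr - (3/2)) \<le> C"
    using sum_divisor_powers_bounded[of "3/2" 0] by auto
  have "(\<Sum>h\<in>{1..H}. sigma_half h / real h) \<le> C * (1 + ln (real H))" if H: "H > 0" for H
  proof -
    define F where "F a b = real a powr - (3/2) * (1 / real b)" for a b :: nat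
    have "(\<Sum>h\<in>{1..H}. sigma_half h / real h) = (\<Sum>h\<in>{1..H}. \<Sum>a | a dvd h. F a (h div a))"
      unfolding sigma_half_def sum_divide_distrib
    proof (intro sum.cong refl)
      fix h a assume h: "h \<in> {1..H}" and a: "a \<in> {a. a dvd h}"
      define b where "b = h div a"
      have ab: "h = a * b" using a by (simp add: b_def)
      then have pos: "a > 0" "b > 0" using h by (auto intro: Nat.gr0I)
      have "real a powr - (3/2) = real a powr (- (1/2) - 1)" by simp
      also have "\<dots> = real a powr - (1/2) / real a" using pos by (simp only: powr_diff powr_one of_nat_0_le_iff)
      also have "real a powr - (1/2) = 1 / sqrt (real a)" using pos by (simp add: powr_minus powr_half_sqrt inverse_eq_divide)
      finally show "1 / sqrt (real a) / real h = F a (h div a)"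
        using pos by (simp add: F_def b_def[symmetric] ab)
    qed
    also have "\<dots> \<le> (\<Sum>a\<in>{1..H}. \<Sum>b\<in>{1..H}. F a b)" by (rule sum_divisors_le) (simp add: F_def)
    also have "\<dots> = (\<Sum>a\<in>{1..H}. real a powr - (3/2)) * (\<Sum>b\<in>{1..H}. 1 / real b)"
      unfolding F_def sum_product ..
    also have "\<dots> \<le> C * (1 + ln (real H))"
      using C(2)[of H] harmonic_sum_le[OF H] C(1) by (intro mult_mono) (auto intro!: sum_nonneg)
    finally show ?thesis .
  qed
  then show ?thesis using C(1) by blast
qed

section \<open>Counting square roots\<close>

text \<open>Fix one root c. A root b determines e = gcd (b - c) m, and then b is c modulo e and -c
  modulo m / e. This fixes b modulo lcm e (m / e), which is m or m / 2, because gcd e (m / e)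
  divides 2 c and c is a unit. So each divisor e belongs to at most two roots.\<close>

lemma card_unit_square_roots_le:
  fixes m \<nu> :: int
  assumes m: "m > 0"
  shows "card {b \<in> {0..<m}. coprime b m \<and> [b\<^sup>2 = \<nu>] (mod m)} \<le> 2 * num_divisors (nat m)"
proof (cases "{b \<in> {0..<m}. coprime b m \<and> [b\<^sup>2 = \<nu>] (mod m)} = {}")
  case True
  then show ?thesis by (simp only: card.empty)
next
  case False
  define R where "R = {b \<in> {0..<m}. coprime b m \<and> [b\<^sup>2 = \<nu>] (mod m)}"
  obtain c where c: "c \<in> R" using False by (auto simp: R_def)
  have key: "m dvd 2 * (b - b')" if b: "b \<in> R" "b' \<in> R" and e: "gcd (b - c) m = gcd (b' - c) m" for b b'
  proof -
    define e where "e = gcd (b - c) m"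
    have e0: "e > 0" using m by (simp add: e_def)
    obtain k where k: "m = e * k" unfolding e_def by (meson gcd_dvd2 dvdE)
    have k0: "k > 0" using k m e0 by (metis zero_less_mult_pos)
    have kd: "k dvd y + c" if y: "y \<in> R" and ey: "gcd (y - c) m = e" for y
    proof -
      obtain j where j: "y - c = e * j" using ey by (metis gcd_dvd1 dvdE)
      have "gcd (e * j) (e * k) = e" using ey j k by simp
      then have "e * gcd j k = e * 1" using e0 by (simp add: gcd_mult_distrib_int[symmetric])
      then have "gcd j k = 1" using e0 by (simp only: mult_cancel_left) auto
      then have cop: "coprime k j" by (simp add: coprime_iff_gcd_eq_1 gcd.commute)
      have "[y\<^sup>2 = c\<^sup>2] (mod m)" using y c by (auto simp: R_def intro: cong_trans cong_sym)
      then have "m dvd (y - c) * (y + c)" by (simp add: cong_iff_dvd_diff power2_eq_square algebra_simps)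
      then have "e * k dvd e * (j * (y + c))" using j k by (simp add: mult.assoc)
      then have "k dvd j * (y + c)" using e0 by simp
      then show ?thesis using cop by (simp add: coprime_dvd_mult_right_iff)
    qed
    have k1: "k dvd b + c" and k2: "k dvd b' + c" using kd b e by (auto simp: e_def)
    have e1: "e dvd b - c" unfolding e_def by (rule gcd_dvd1)
    have e2: "e dvd b' - c" unfolding e_def e by (rule gcd_dvd1)
    have "gcd e k dvd 2 * c"
    proof -
      have "gcd e k dvd (b + c) - (b - c)" using k1 e1 by (meson dvd_diff dvd_trans gcd_dvd1 gcd_dvd2)
      then show ?thesis by simp
    qed
    moreover have "coprime (gcd e k) c"
    proof -
      have "gcd e k dvd m" unfolding k by (simp add: dvd_mult2)
      moreover have "coprime m c" using c by (simp add: R_def coprime_commute)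
      ultimately show ?thesis by (meson coprime_divisors dvd_refl)
    qed
    ultimately have g2: "gcd e k dvd 2" by (simp add: coprime_dvd_mult_left_iff)
    have "e dvd b - b'" using dvd_diff[OF e1 e2] by simp
    moreover have "k dvd b - b'" using dvd_diff[OF k1 k2] by simp
    ultimately have "lcm e k dvd b - b'" by simp
    then have "gcd e k * lcm e k dvd 2 * (b - b')" using g2 by (rule mult_dvd_mono[rotated])
    moreover have "gcd e k * lcm e k = m" using e0 k0 k by (simp add: prod_gcd_lcm_int)
    ultimately show ?thesis by (simp only:)
  qed
  \<comment> \<open>The bit \<open>2 * b < m\<close> separates roots whose doubles are congruent
    modulo m.\<close>
  have "inj_on (\<lambda>b. (nat (gcd (b - c) m), 2 * b < m)) R"
  proof (rule inj_onI)
    fix b b' assume b: "b \<in> R" "b' \<in> R" and eq: "(nat (gcd (b - c) m), 2 * b < m) = (nat (gcd (b' - c) m), 2 * b' < m)"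
    have "gcd (b - c) m = gcd (b' - c) m" using eq by (simp add: nat_eq_iff)
    then have "m dvd 2 * (b - b')" using key b by blast
    moreover have "\<bar>2 * (b - b')\<bar> < m" using b eq by (auto simp: R_def)
    ultimately have "2 * (b - b') = 0" using dvd_imp_le_int[of "2 * (b - b')" m] by linarith
    then show "b = b'" by simp
  qed
  moreover have "(\<lambda>b. (nat (gcd (b - c) m), 2 * b < m)) ` R \<subseteq> {d. d dvd nat m} \<times> UNIV"
  proof (rule image_subsetI)
    fix b
    have "int (nat (gcd (b - c) m)) dvd int (nat m)" using m by simp
    then have "nat (gcd (b - c) m) dvd nat m" by (simp only: int_dvd_int_iff)
    then show "(nat (gcd (b - c) m), 2 * b < m) \<in> {d. d dvd nat m} \<times> UNIV"
      by (intro SigmaI CollectI UNIV_I)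
  qed
  moreover have "finite ({d. d dvd nat m} \<times> (UNIV :: bool set))" using m by (auto intro!: finite_divisors_nat)
  ultimately have "card R \<le> card ({d. d dvd nat m} \<times> (UNIV :: bool set))" by (rule card_inj_on_le)
  then show ?thesis by (simp add: R_def card_cartesian_product num_divisors_def)
qed

text \<open>The roots are sorted by h = gcd a f, whose square must divide 4 n. With f = h g and a =
  h b, the cofactor b is a unit and a square root of a fixed number modulo g^2; since b < h g^2,
  each residue occurs at most h times.\<close>

lemma sqrt_count_le:
  assumes f: "f > 0"
  shows "sqrt_count f n \<le> (\<Sum>h | h dvd f \<and> h\<^sup>2 dvd 4 * n. h * (2 * num_divisors ((f div h)\<^sup>2)))"
proof -
  define S where "S = {a \<in> {0..<(int f)\<^sup>2}. [a\<^sup>2 = 4 * int n] (mod (int f)\<^sup>2)}"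
  define Hs where "Hs = {h. h dvd f \<and> h\<^sup>2 dvd 4 * n}"
  define Sh where "Sh h = {a \<in> S. gcd a (int f) = int h}" for h
  have finHs: "finite Hs" unfolding Hs_def using f by (intro finite_subset[OF _ finite_divisors_nat[of f]]) auto
  have finS: "finite S" unfolding S_def by (rule finite_subset[of _ "{0..<(int f)\<^sup>2}"]) auto
  have sub: "S \<subseteq> (\<Union>h\<in>Hs. Sh h)"
  proof
    fix a assume a: "a \<in> S"
    define h where "h = nat (gcd a (int f))"
    have hi: "int h = gcd a (int f)" by (simp add: h_def)
    have hf: "h dvd f" by (metis gcd_dvd2 hi int_dvd_int_iff)
    have ha: "int h dvd a" by (simp add: hi)
    have "(int h)\<^sup>2 dvd (int f)\<^sup>2" using hf by (intro dvd_power_same) simp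
    moreover have "(int f)\<^sup>2 dvd a\<^sup>2 - 4 * int n" using a by (simp add: S_def cong_iff_dvd_diff)
    ultimately have hd: "(int h)\<^sup>2 dvd a\<^sup>2 - 4 * int n" by (rule dvd_trans)
    have "(int h)\<^sup>2 dvd a\<^sup>2 - (a\<^sup>2 - 4 * int n)"
      by (rule dvd_diff[OF dvd_power_same[OF ha] hd])
    then have "int (h\<^sup>2) dvd int (4 * n)" by simp
    then have "h\<^sup>2 dvd 4 * n" by (simp only: int_dvd_int_iff)
    then show "a \<in> (\<Union>h\<in>Hs. Sh h)" using hf a hi by (auto simp: Hs_def Sh_def)
  qed
  have ShB: "card (Sh h) \<le> h * (2 * num_divisors ((f div h)\<^sup>2))" if h: "h \<in> Hs" for h
  proof -
    define g where "g = f div h"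
    have fg: "f = h * g" using h by (simp add: g_def Hs_def)
    then have h0: "h > 0" and g0: "g > 0" using f by (auto intro: Nat.gr0I)
    define m where "m = (int g)\<^sup>2"
    have m0: "m > 0" using g0 by (simp add: m_def)
    have "h\<^sup>2 dvd 4 * n" using h by (simp add: Hs_def)
    then obtain v where v: "4 * n = h\<^sup>2 * v" by (rule dvdE)
    have vi: "4 * int n = (int h)\<^sup>2 * int v" using arg_cong[OF v, of int] by simp
    define R where "R = {b \<in> {0..<m}. coprime b m \<and> [b\<^sup>2 = int v] (mod m)}"
    have mul: "a = int h * (a div int h)" if "a \<in> Sh h" for a
    proof -
      have "gcd a (int f) = int h" using that by (simp add: Sh_def)
      then have "int h dvd a" by (metis gcd_dvd1)
      then show ?thesis by simp
    qed
    have "inj_on (\<lambda>a. ((a div int h) div m, (a div int h) mod m)) (Sh h)"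
    proof (rule inj_onI)
      fix a b assume ab: "a \<in> Sh h" "b \<in> Sh h"
        "((a div int h) div m, (a div int h) mod m) = ((b div int h) div m, (b div int h) mod m)"
      then have "a div int h = b div int h" by (metis Pair_inject div_mult_mod_eq)
      then show "a = b" using mul[OF ab(1)] mul[OF ab(2)] by simp
    qed
    moreover have "(\<lambda>a. ((a div int h) div m, (a div int h) mod m)) ` Sh h \<subseteq> {0..<int h} \<times> R"
    proof clarify
      fix a assume a: "a \<in> Sh h"
      define b where "b = a div int h"
      have ab: "a = int h * b" using mul[OF a] by (simp add: b_def)
      have a0: "0 \<le> a" "a < (int f)\<^sup>2" "[a\<^sup>2 = 4 * int n] (mod (int f)\<^sup>2)" "gcd a (int f) = int h"
        using a by (auto simp: Sh_def S_def)
      have b0: "b \<ge> 0" using a0(1) h0 by (simp add: b_def pos_imp_zdiv_nonneg_iff)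
      have "int h * b < int h * (int h * m)" using a0(2) by (simp add: ab fg m_def power2_eq_square mult_ac)
      then have bl: "b < int h * m" using h0 by simp
      have d1: "0 \<le> b div m" using b0 m0 by (simp add: pos_imp_zdiv_nonneg_iff)
      have d2: "b div m < int h"
      proof -
        have "b div m * m \<le> b" using m0 by (simp flip: minus_mod_eq_div_mult)
        then have "b div m * m < int h * m" using bl by simp
        then show ?thesis using m0 by (simp only: mult_less_cancel_right_pos)
      qed
      have "gcd (int h * b) (int h * int g) = int h" using a0(4) by (simp add: ab fg)
      then have "int h * gcd b (int g) = int h * 1" by (simp add: gcd_mult_distrib_int[symmetric])
      then have "gcd b (int g) = 1" using h0 by (simp only: mult_cancel_left) auto
      then have "coprime b (int g)" by (simp add: coprime_iff_gcd_eq_1)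
      then have "coprime b m" by (simp add: m_def)
      then have c1: "coprime (b mod m) m" using m0 by (subst coprime_mod_left_iff) auto
      have "(int f)\<^sup>2 dvd a\<^sup>2 - 4 * int n" using a0(3) by (simp add: cong_iff_dvd_diff)
      then have "(int h)\<^sup>2 * m dvd (int h)\<^sup>2 * (b\<^sup>2 - int v)"
        by (simp add: ab vi fg m_def power_mult_distrib right_diff_distrib)
      then have "m dvd b\<^sup>2 - int v" using h0 by simp
      then have "[b\<^sup>2 = int v] (mod m)" by (simp add: cong_iff_dvd_diff)
      then have c2: "[(b mod m)\<^sup>2 = int v] (mod m)" by (simp add: Cong.cong_def power_mod)
      show "(a div int h) div m \<in> {0..<int h} \<and> (a div int h) mod m \<in> R"
        unfolding b_def[symmetric] using d1 d2 c1 c2 m0 by (auto simp: R_def)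
    qed
    moreover have "finite R" unfolding R_def by (rule finite_subset[of _ "{0..<m}"]) auto
    ultimately have "card (Sh h) \<le> card ({0..<int h} \<times> R)" by (intro card_inj_on_le) auto
    also have "\<dots> = h * card R" by (simp add: card_cartesian_product)
    also have "card R \<le> 2 * num_divisors (nat m)" unfolding R_def by (rule card_unit_square_roots_le[OF m0])
    also have "nat m = (f div h)\<^sup>2" by (simp add: m_def g_def nat_power_eq)
    finally show ?thesis by simp
  qed
  have "sqrt_count f n = card S" by (simp add: sqrt_count_def S_def)
  also have "\<dots> \<le> card (\<Union>h\<in>Hs. Sh h)"
    using finHs finS sub by (intro card_mono) (auto simp: Sh_def)
  also have "\<dots> \<le> (\<Sum>h\<in>Hs. card (Sh h))" by (rule card_UN_le[OF finHs])
  also have "\<dots> \<le> (\<Sum>h\<in>Hs. h * (2 * num_divisors ((f div h)\<^sup>2)))" by (intro sum_mono ShB)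
  finally show ?thesis by (simp add: Hs_def)
qed

text \<open>With f = h g the sum splits. Since h^2 divides 4 n, h is at most 4 n whatever
  \<open>N\<close> is, and its harmonic sum costs one logarithm of \<open>n\<close>; the g-sum
  converges.\<close>

lemma sum_sqrt_count_le:
  "\<exists>C>0. \<forall>n>0. \<forall>N. (\<Sum>f\<in>{1..N}. real (sqrt_count f n) / (real f)\<^sup>2 * sigma_half f) \<le> C * (1 + ln (4 * real n))"
proof -
  obtain C1 where C1: "C1 > 0" "\<And>H. H > 0 \<Longrightarrow> (\<Sum>h\<in>{1..H}. sigma_half h / real h) \<le> C1 * (1 + ln (real H))"
    using sum_sigma_half_le by blast
  obtain C2 where C2: "C2 > 0" "\<And>G. (\<Sum>g\<in>{1..G}. real (num_divisors g) ^ 3 * real g powr - 2) \<le> C2"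
    using sum_divisor_powers_bounded[of 2 3] by auto
  have "(\<Sum>f\<in>{1..N}. real (sqrt_count f n) / (real f)\<^sup>2 * sigma_half f) \<le> (C1 * (2 * C2)) * (1 + ln (4 * real n))"
    if n: "n > 0" for n N :: nat
  proof -
    define U where "U h = (if h \<le> 4 * n then sigma_half h / real h else 0)" for h
    \<comment> \<open>The cube comes from
      \<open>num_divisors (g\<^sup>2) \<le> num_divisors g ^ 2\<close> together with
      \<open>sigma_half g \<le> num_divisors g\<close>.\<close>
    define V where "V g = 2 * (real (num_divisors g) ^ 3 * real g powr - 2)" for g
    have U0: "U h \<ge> 0" and V0: "V h \<ge> 0" for h by (auto simp: U_def V_def sigma_half_nonneg)
    have "(\<Sum>f\<in>{1..N}. real (sqrt_count f n) / (real f)\<^sup>2 * sigma_half f) \<le> (\<Sum>f\<in>{1..N}. \<Sum>h | h dvd f. U h * V (f div h))"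
    proof (rule sum_mono)
      fix f assume f: "f \<in> {1..N}"
      then have f0: "f > 0" by simp
      have fin: "finite {h. h dvd f}" using f0 by (intro finite_divisors_nat) auto
      have "real (sqrt_count f n) \<le> (\<Sum>h | h dvd f \<and> h\<^sup>2 dvd 4 * n. real (h * (2 * num_divisors ((f div h)\<^sup>2))))"
        using sqrt_count_le[OF f0, of n] by (metis (mono_tags, lifting) of_nat_le_iff of_nat_sum sum.cong)
      then have "real (sqrt_count f n) / (real f)\<^sup>2 * sigma_half f
          \<le> (\<Sum>h | h dvd f \<and> h\<^sup>2 dvd 4 * n. real (h * (2 * num_divisors ((f div h)\<^sup>2)))) / (real f)\<^sup>2 * sigma_half f"
        by (intro mult_right_mono divide_right_mono sigma_half_nonneg) auto
      also have "\<dots> = (\<Sum>h | h dvd f \<and> h\<^sup>2 dvd 4 * n. real (h * (2 * num_divisors ((f div h)\<^sup>2))) / (real f)\<^sup>2 * sigma_half f)"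
        by (simp add: sum_divide_distrib sum_distrib_right)
      also have "\<dots> \<le> (\<Sum>h | h dvd f \<and> h\<^sup>2 dvd 4 * n. U h * V (f div h))"
      proof (rule sum_mono)
        fix h assume "h \<in> {h. h dvd f \<and> h\<^sup>2 dvd 4 * n}"
        then have h: "h dvd f" "h\<^sup>2 dvd 4 * n" by auto
        define g where "g = f div h"
        have fg: "f = h * g" using h by (simp add: g_def)
        then have h0: "h > 0" and g0: "g > 0" using f0 by (auto intro: Nat.gr0I)
        have "h \<le> h\<^sup>2" by (simp add: power2_eq_square)
        also have "h\<^sup>2 \<le> 4 * n" using h(2) n by (intro dvd_imp_le) auto
        finally have Uh: "U h = sigma_half h / real h" by (simp add: U_def)
        have "num_divisors (g\<^sup>2) \<le> num_divisors g ^ 2"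
          using num_divisors_mult_le[OF g0 g0] by (simp add: power2_eq_square)
        then have dg: "real (num_divisors (g\<^sup>2)) \<le> real (num_divisors g) ^ 2" by (metis of_nat_le_iff of_nat_power)
        have "sigma_half f \<le> sigma_half h * real (num_divisors g)"
          unfolding fg using sigma_half_mult_le[OF h0 g0] sigma_half_le_num_divisors[OF g0] sigma_half_nonneg[of h]
          by (meson mult_left_mono order_trans)
        moreover have "real (h * (2 * num_divisors (g\<^sup>2))) \<le> real h * (2 * real (num_divisors g) ^ 2)"
          unfolding of_nat_mult of_nat_numeral by (intro mult_left_mono dg) auto
        ultimately have "real (h * (2 * num_divisors (g\<^sup>2))) / (real f)\<^sup>2 * sigma_half f
            \<le> real h * (2 * real (num_divisors g) ^ 2) / (real f)\<^sup>2 * (sigma_half h * real (num_divisors g))"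
          using sigma_half_nonneg by (intro mult_mono divide_right_mono) auto
        also have "\<dots> = (sigma_half h * (2 * real (num_divisors g) ^ 3)) * (real h / (real f)\<^sup>2)"
          by (simp add: power3_eq_cube power2_eq_square)
        also have "real h / (real f)\<^sup>2 = 1 / real h * real g powr - 2"
          using h0 g0 by (simp add: fg power2_eq_square powr_minus powr_numeral inverse_eq_divide)
        also have "(sigma_half h * (2 * real (num_divisors g) ^ 3)) * (1 / real h * real g powr - 2) = U h * V g"
          by (simp add: Uh V_def)
        finally show "real (h * (2 * num_divisors ((f div h)\<^sup>2))) / (real f)\<^sup>2 * sigma_half f \<le> U h * V (f div h)"
          by (simp only: g_def)
      qed
      also have "\<dots> \<le> (\<Sum>h | h dvd f. U h * V (f div h))"
        using fin U0 V0 by (intro sum_mono2) auto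
      finally show "real (sqrt_count f n) / (real f)\<^sup>2 * sigma_half f \<le> (\<Sum>h | h dvd f. U h * V (f div h))" .
    qed
    also have "\<dots> \<le> (\<Sum>h\<in>{1..N}. \<Sum>g\<in>{1..N}. U h * V g)" by (rule sum_divisors_le) (simp add: U0 V0)
    also have "\<dots> = (\<Sum>h\<in>{1..N}. U h) * (\<Sum>g\<in>{1..N}. V g)" by (simp add: sum_product)
    also have "\<dots> \<le> (C1 * (1 + ln (4 * real n))) * (2 * C2)"
    proof (intro mult_mono)
      have "(\<Sum>h\<in>{1..N}. U h) = (\<Sum>h\<in>{1..N} \<inter> {1..4 * n}. sigma_half h / real h)"
        unfolding U_def by (subst sum.inter_restrict) (auto intro!: sum.cong)
      also have "\<dots> \<le> (\<Sum>h\<in>{1..4 * n}. sigma_half h / real h)"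
        by (intro sum_mono2) (auto simp: sigma_half_nonneg)
      also have "\<dots> \<le> C1 * (1 + ln (real (4 * n)))" using n by (intro C1) auto
      finally show "(\<Sum>h\<in>{1..N}. U h) \<le> C1 * (1 + ln (4 * real n))" by simp
      show "(\<Sum>g\<in>{1..N}. V g) \<le> 2 * C2" unfolding V_def sum_distrib_left[symmetric] using C2(2)[of N] by linarith
      show "0 \<le> C1 * (1 + ln (4 * real n))" using C1(1) n by (intro mult_nonneg_nonneg add_nonneg_nonneg ln_ge_zero) auto
    qed (auto intro!: sum_nonneg V0)
    finally show ?thesis by (simp only: mult_ac)
  qed
  then show ?thesis using C1(1) C2(1) by (intro exI[of _ "C1 * (2 * C2)"]) auto
qed

section \<open>The average of Kl\<close>

lemma prod_primes_dvd:
  fixes k :: nat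
  assumes "finite B" "\<And>p. p \<in> B \<Longrightarrow> prime p \<and> p dvd k"
  shows "\<Prod>B dvd k"
  using assms
proof (induction B rule: finite_induct)
  case (insert p B)
  have "coprime p (\<Prod>B)"
  proof (rule prod_coprime_right)
    fix q assume "q \<in> B"
    then have "p \<noteq> q" "prime p" "prime q" using insert by auto
    then show "coprime p q" by (simp add: primes_coprime)
  qed
  moreover have "\<Prod>B dvd k" "p dvd k" using insert by auto
  ultimately show ?case using insert by (simp add: divides_mult)
qed simp

lemma prime_dvd_prod_primes_iff:
  fixes p :: nat
  assumes "finite B" "prime p" "\<And>q. q \<in> B \<Longrightarrow> prime q"
  shows "p dvd \<Prod>B \<longleftrightarrow> p \<in> B"
proof
  assume "p dvd \<Prod>B"
  then obtain q where "q \<in> B" "p dvd q" using assms(1,2) by (auto simp: prime_dvd_prod_iff)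
  then show "p \<in> B" using assms by (metis primes_dvd_imp_eq)
next
  assume "p \<in> B"
  then show "p dvd \<Prod>B" using dvd_prodI[OF assms(1), of p "\<lambda>x. x"] by simp
qed

text \<open>\<open>d\<close> is \<open>l\<close> divided by its radical, so the primes of
  \<open>l\<close> outside \<open>d\<close> divide it exactly once. Those prime to
  \<open>2 * f\<close> form \<open>A\<close>, the others multiply to \<open>t\<close>, and the
  primes of \<open>d\<close> contribute \<open>d\<close> times their product. The last conclusion
  says that l / d still contains every prime of \<open>l\<close>, which is what the vanishing
  criterion \<open>Kl_sum_eq_0\<close> asks.\<close>

lemma modulus_decomposition:
  fixes l f :: nat
  assumes l: "l > 0" and f: "f > 0"
  obtains A t d where "finite A" "l = \<Prod>A * (t * (d * \<Prod>(prime_factors d)))" "t dvd 2 * f" "d > 0"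
    "\<And>p. p \<in> A \<Longrightarrow> prime p \<and> p \<noteq> 2 \<and> \<not> p dvd f \<and> \<not> p dvd t * (d * \<Prod>(prime_factors d))"
    "\<And>p. p \<in> prime_factors l \<Longrightarrow> p dvd \<Prod>A * t * \<Prod>(prime_factors d)"
proof -
  define r where "r = \<Prod>(prime_factors l)"
  have "r dvd l" unfolding r_def by (rule prod_primes_dvd) auto
  then obtain d where d: "l = r * d" by (rule dvdE)
  have d0: "d > 0" using d l by (auto intro: Nat.gr0I)
  have sub: "prime_factors d \<subseteq> prime_factors l" using d l by (auto simp: in_prime_factors_iff)
  define U where "U = prime_factors l - prime_factors d"
  define A where "A = {p\<in>U. \<not> p dvd 2 * f}"
  define T where "T = {p\<in>U. p dvd 2 * f}"
  have fin: "finite U" "finite A" "finite T" by (auto simp: U_def A_def T_def)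
  have prU: "prime p" if "p \<in> U" for p using that by (auto simp: U_def in_prime_factors_iff)
  have UAT: "U = A \<union> T" "A \<inter> T = {}" by (auto simp: A_def T_def)
  have "r = \<Prod>U * \<Prod>(prime_factors d)"
    unfolding r_def U_def using prod.subset_diff[OF sub, of "\<lambda>x. x"] by simp
  also have "\<Prod>U = \<Prod>A * \<Prod>T" unfolding UAT(1) by (rule prod.union_disjoint) (use fin UAT in auto)
  finally have r: "r = \<Prod>A * \<Prod>T * \<Prod>(prime_factors d)" .
  show ?thesis
  proof (rule that[of A "\<Prod>T" d])
    show "l = \<Prod>A * (\<Prod>T * (d * \<Prod>(prime_factors d)))" using d r by (simp only: mult_ac)
    show "\<Prod>T dvd 2 * f" by (rule prod_primes_dvd) (use fin prU in \<open>auto simp: T_def\<close>)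
    show "prime p \<and> p \<noteq> 2 \<and> \<not> p dvd f \<and> \<not> p dvd \<Prod>T * (d * \<Prod>(prime_factors d))" if p: "p \<in> A" for p
    proof -
      have pp: "prime p" "p \<in> U" "\<not> p dvd 2 * f" using p prU by (auto simp: A_def)
      have prT: "prime q" if "q \<in> T" for q using that prU by (simp add: T_def)
      have prD: "prime q" if "q \<in> prime_factors d" for q using that by (simp add: in_prime_factors_iff)
      have "p \<notin> T" using UAT(2) p by blast
      then have "\<not> p dvd \<Prod>T"
        using prime_dvd_prod_primes_iff[OF fin(3) pp(1) prT] by blast
      moreover have pd: "p \<notin> prime_factors d" using pp by (simp add: U_def)
      moreover have "\<not> p dvd d" using pd pp(1) d0 by (auto simp: in_prime_factors_iff)
      moreover have "\<not> p dvd \<Prod>(prime_factors d)"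
        using prime_dvd_prod_primes_iff[OF _ pp(1) prD] pd by blast
      ultimately have "\<not> p dvd \<Prod>T * (d * \<Prod>(prime_factors d))"
        using pp(1) by (simp add: prime_dvd_mult_iff)
      moreover have "p \<noteq> 2" using pp(3) by auto
      moreover have "\<not> p dvd f" using pp(3) by auto
      ultimately show ?thesis using pp(1) by blast
    qed
    show "p dvd \<Prod>A * \<Prod>T * \<Prod>(prime_factors d)" if "p \<in> prime_factors l" for p
      unfolding r[symmetric] r_def using dvd_prodI[OF _ that, of "\<lambda>x. x"] by simp
  qed (use fin d0 in auto)
qed

lemma sqrt_of_nat_prod: "sqrt (real (\<Prod>x\<in>A. g x)) = (\<Prod>x\<in>A. sqrt (real (g x)))"
  by (induction A rule: infinite_finite_induct) (simp_all add: real_sqrt_mult)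

text \<open>A prime p dividing \<open>x\<close> satisfies p \<le> 2 sqrt p * sqrt p, and the extra
  factors sqrt p multiply to the square root of a common divisor of \<open>\<Prod>A\<close> and
  \<open>x\<close>. The powers of 2 are absorbed because products over subsets of \<open>A\<close>
  are distinct divisors of \<open>\<Prod>A\<close>.\<close>

lemma prod_prime_bounds_le:
  fixes A :: "nat set" and x :: nat
  assumes A: "finite A" "\<And>p. p \<in> A \<Longrightarrow> prime p" and x: "x > 0"
  shows "(\<Prod>p\<in>A. if int p dvd int x then real p else 2 * sqrt (real p))
    \<le> real (num_divisors (\<Prod>A)) * sqrt (real (\<Prod>A)) * sqrt (real (gcd (\<Prod>A) x))"
proof -
  have A0: "\<Prod>A > 0" using A by (intro prod_pos) (auto simp: prime_gt_0_nat)
  define B where "B = {p\<in>A. p dvd x}"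
  have "(\<Prod>p\<in>A. if int p dvd int x then real p else 2 * sqrt (real p))
      \<le> (\<Prod>p\<in>A. 2 * sqrt (real p) * sqrt (real (if p dvd x then p else 1)))"
    by (intro prod_mono) (auto simp: mult.assoc)
  also have "\<dots> = 2 ^ card A * sqrt (real (\<Prod>A)) * sqrt (real (\<Prod>p\<in>A. if p dvd x then p else 1))"
    unfolding sqrt_of_nat_prod by (simp only: prod.distrib prod_constant)
  also have "(\<Prod>p\<in>A. if p dvd x then p else 1) = \<Prod>B"
    unfolding B_def using A(1) by (simp add: prod.inter_filter)
  also have "2 ^ card A * sqrt (real (\<Prod>A)) * sqrt (real (\<Prod>B)) \<le> real (num_divisors (\<Prod>A)) * sqrt (real (\<Prod>A)) * sqrt (real (gcd (\<Prod>A) x))"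
  proof (intro mult_mono order_refl)
    have "inj_on (\<lambda>S. \<Prod>S) (Pow A)"
    proof (rule inj_onI)
      fix S S' assume S: "S \<in> Pow A" "S' \<in> Pow A" "\<Prod>S = \<Prod>S'"
      have iff: "p \<in> W \<longleftrightarrow> p dvd \<Prod>W" if "W \<in> Pow A" "p \<in> A" for p W
        using prime_dvd_prod_primes_iff[of W p] that A by (meson PowD finite_subset subsetD)
      have "p \<in> S \<longleftrightarrow> p \<in> S'" for p
      proof (cases "p \<in> A")
        case True then show ?thesis using iff[OF S(1) True] iff[OF S(2) True] S(3) by (simp only:)
      next
        case False then show ?thesis using S by blast
      qed
      then show "S = S'" by blast
    qed
    moreover have "(\<lambda>S. \<Prod>S) ` Pow A \<subseteq> {d. d dvd \<Prod>A}"
    proof clarify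
      fix S assume "S \<subseteq> A"
      then show "\<Prod>S dvd \<Prod>A" by (rule prod_dvd_prod_subset[OF A(1)])
    qed
    moreover have "finite {d. d dvd \<Prod>A}" using A0 by (intro finite_divisors_nat) auto
    ultimately have "card (Pow A) \<le> num_divisors (\<Prod>A)" unfolding num_divisors_def by (rule card_inj_on_le)
    then have "2 ^ card A \<le> num_divisors (\<Prod>A)" using A(1) by (simp add: card_Pow)
    then have "real (2 ^ card A) \<le> real (num_divisors (\<Prod>A))" by (simp only: of_nat_le_iff)
    then show "2 ^ card A \<le> real (num_divisors (\<Prod>A))" by simp
    have "\<Prod>B dvd \<Prod>A" unfolding B_def by (rule prod_dvd_prod_subset[OF A(1)]) auto
    moreover have "\<Prod>B dvd x" unfolding B_def by (rule prod_primes_dvd) (use A in auto)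
    ultimately have "\<Prod>B dvd gcd (\<Prod>A) x" by simp
    then have "\<Prod>B \<le> gcd (\<Prod>A) x" using A0 by (intro dvd_imp_le) auto
    then show "sqrt (real (\<Prod>B)) \<le> sqrt (real (gcd (\<Prod>A) x))"
      by (simp only: real_sqrt_le_iff of_nat_le_iff)
  qed (simp_all del: of_nat_prod)
  finally show ?thesis .
qed

text \<open>The part of a number at its repeated primes, when \<open>d\<close> is the quotient of
  that number by its radical.\<close>

definition with_radical :: "nat \<Rightarrow> nat" where
  "with_radical d = d * \<Prod>(prime_factors d)"

lemma with_radical_pos: "d > 0 \<Longrightarrow> with_radical d > 0"
  unfolding with_radical_def by (auto intro!: prod_pos simp: in_prime_factors_iff prime_gt_0_nat)

text \<open>Weil's bound on \<open>A\<close> gives \<open>sqrt (\<Prod>A)\<close>, which division by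
  \<open>sqrt l\<close> cancels; the trivial bound on the remaining factor s =
  \<open>t * with_radical d\<close> leaves \<open>sqrt s\<close>. Nonvanishing of the sum forces
  \<open>d dvd x\<close>.\<close>

lemma norm_Kl_sum_decomposed:
  fixes l f x n :: nat
  assumes l: "l > 0" and f: "f > 0" and x: "x > 0" and nz: "Kl_sum l f (int x) n \<noteq> 0"
  obtains m t d where "m > 0" "t dvd 2 * f" "d dvd x" "l = m * (t * with_radical d)"
    "norm (Kl_sum l f (int x) n) / sqrt (real l)
      \<le> 4 * real (sqrt_count f n) * sqrt (real (t * with_radical d)) * (real (num_divisors m) * sqrt (real (gcd m x)))"
proof -
  from modulus_decomposition[OF l f] obtain A t d where A: "finite A"
    and lA: "l = \<Prod>A * (t * (d * \<Prod>(prime_factors d)))" and t: "t dvd 2 * f" and d0: "d > 0"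
    and pA: "\<And>p. p \<in> A \<Longrightarrow> prime p \<and> p \<noteq> 2 \<and> \<not> p dvd f \<and> \<not> p dvd t * (d * \<Prod>(prime_factors d))"
    and rad: "\<And>p. p \<in> prime_factors l \<Longrightarrow> p dvd \<Prod>A * t * \<Prod>(prime_factors d)" by metis
  define s where "s = t * with_radical d"
  have ls: "l = \<Prod>A * s" using lA by (simp add: s_def with_radical_def)
  have s0: "s > 0" and A0: "\<Prod>A > 0" using l ls by (metis gr0I mult_0 mult_0_right)+
  have lrd: "l = (\<Prod>A * t * \<Prod>(prime_factors d)) * d" using lA by (simp only: mult_ac)
  have "int d dvd int x" using Kl_sum_eq_0[OF f lrd l rad] nz by blast
  then have dx: "d dvd x" by (simp only: int_dvd_int_iff)
  have "norm (Kl_sum (\<Prod>A * s) f (int x) n) \<le>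
    (\<Prod>p\<in>A. if int p dvd int x then real p else 2 * sqrt (real p)) * (4 * real s * real (sqrt_count f n))"
    by (rule norm_Kl_sum_le[OF A _ f s0]) (use pA in \<open>simp add: s_def with_radical_def\<close>)
  also have "\<dots> \<le> (real (num_divisors (\<Prod>A)) * sqrt (real (\<Prod>A)) * sqrt (real (gcd (\<Prod>A) x))) * (4 * real s * real (sqrt_count f n))"
    by (intro mult_right_mono prod_prime_bounds_le[OF A _ x]) (use pA in auto)
  also have "\<dots> = (4 * real (sqrt_count f n) * sqrt (real s) * (real (num_divisors (\<Prod>A)) * sqrt (real (gcd (\<Prod>A) x)))) * (sqrt (real (\<Prod>A)) * sqrt (real s))"
  proof -
    have "D * M * G * (4 * S * c) = (4 * c * r * (D * G)) * (M * r)" if "S = r * r" for D M G S c r :: real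
      using that by simp
    then show ?thesis by simp
  qed
  also have "sqrt (real (\<Prod>A)) * sqrt (real s) = sqrt (real l)" unfolding ls by (simp only: of_nat_mult real_sqrt_mult)
  finally have "norm (Kl_sum l f (int x) n) / sqrt (real l)
      \<le> 4 * real (sqrt_count f n) * sqrt (real s) * (real (num_divisors (\<Prod>A)) * sqrt (real (gcd (\<Prod>A) x)))"
    using l by (simp add: divide_le_eq ls[symmetric])
  then show ?thesis using that[OF A0 t dx ls[unfolded s_def]] by (simp only: s_def)
qed

text \<open>The pairs with nonzero sum are injected into quadruples (f, t, d, m), from which l is
  recovered. With w = \<open>t * with_radical d\<close>, the m-sum has length at most Y / (f^2 w)
  and its terms carry sqrt w, so 1 / sqrt w survives. The t-sum of 1 / sqrt t is
  \<open>sigma_half (2 * f)\<close>, and the d-sum costs one more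
  \<open>num_divisors x\<close>.\<close>

lemma sum_norm_Kl_sum_le:
  "\<exists>C>0. \<forall>n>0. \<forall>x>0. \<forall>Y\<ge>1. (\<Sum>(l, f) | l \<ge> 1 \<and> f \<ge> 1 \<and> real l * (real f)\<^sup>2 \<le> Y. norm (Kl_sum l f (int x) n) / sqrt (real l))
     \<le> C * Y * (1 + ln Y) * (1 + ln (4 * real n)) * real (num_divisors x) ^ 3"
proof -
  obtain C where C: "C > 0" and CS: "\<And>n N. n > 0 \<Longrightarrow>
      (\<Sum>f\<in>{1..N}. real (sqrt_count f n) / (real f)\<^sup>2 * sigma_half f) \<le> C * (1 + ln (4 * real n))"
    using sum_sqrt_count_le by blast
  have "(\<Sum>(l, f) | l \<ge> 1 \<and> f \<ge> 1 \<and> real l * (real f)\<^sup>2 \<le> Y. norm (Kl_sum l f (int x) n) / sqrt (real l))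
     \<le> (8 * C) * Y * (1 + ln Y) * (1 + ln (4 * real n)) * real (num_divisors x) ^ 3"
    if n: "n > 0" and x: "x > 0" and Y: "Y \<ge> 1" for n x :: nat and Y :: real
  proof -
    define L where "L = {(l::nat, f::nat). l \<ge> 1 \<and> f \<ge> 1 \<and> real l * (real f)\<^sup>2 \<le> Y}"
    have finL: "finite L" unfolding L_def by (rule finite_S2_outer)
    define L' where "L' = {z\<in>L. Kl_sum (fst z) (snd z) (int x) n \<noteq> 0}"
    have finL': "finite L'" using finL by (simp add: L'_def)
    define N where "N = nat \<lfloor>Y\<rfloor>"
    define M where "M f t d = nat \<lfloor>Y / ((real f)\<^sup>2 * real (t * with_radical d))\<rfloor>" for f t d
    define v where "v f t d m = 4 * real (sqrt_count f n) * sqrt (real (t * with_radical d)) * (real (num_divisors m) * sqrt (real (gcd m x)))"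
      for f t d m :: nat
    have v0: "v f t d m \<ge> 0" for f t d m by (simp add: v_def)
    define Q where "Q = Sigma {1..N} (\<lambda>f. Sigma {t. t dvd 2 * f} (\<lambda>t. Sigma {d. d dvd x} (\<lambda>d. {1..M f t d})))"
    have finx: "finite {d. d dvd x}" using x by (intro finite_divisors_nat) auto
    have fint: "finite {t. t dvd 2 * f}" if "f \<in> {1..N}" for f using that by (intro finite_divisors_nat) auto
    have finQ: "finite Q" unfolding Q_def by (intro finite_SigmaI fint finx) auto
    have "\<exists>q. q \<in> Q \<and> fst q = snd z \<and> fst z = snd (snd (snd q)) * (fst (snd q) * with_radical (fst (snd (snd q)))) \<and>
        norm (Kl_sum (fst z) (snd z) (int x) n) / sqrt (real (fst z)) \<le> v (fst q) (fst (snd q)) (fst (snd (snd q))) (snd (snd (snd q)))"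
      if z: "z \<in> L'" for z
    proof -
      obtain l f where zlf: "z = (l, f)" by (cases z)
      have lf: "l > 0" "f > 0" "real l * (real f)\<^sup>2 \<le> Y" "Kl_sum l f (int x) n \<noteq> 0"
        using z zlf by (auto simp: L'_def L_def)
      from norm_Kl_sum_decomposed[OF lf(1,2) x lf(4)] obtain m t d where
        m: "m > 0" "t dvd 2 * f" "d dvd x" "l = m * (t * with_radical d)"
        "norm (Kl_sum l f (int x) n) / sqrt (real l) \<le> v f t d m"
        unfolding v_def by metis
      have s0: "t * with_radical d > 0" using lf(1) m(4) by (metis gr0I mult_0_right)
      have "1 * real f \<le> (real f)\<^sup>2" using lf(2) unfolding power2_eq_square by (intro mult_right_mono) auto
      also have "1 * (real f)\<^sup>2 \<le> real l * (real f)\<^sup>2" using lf(1) by (intro mult_right_mono) auto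
      then have "(real f)\<^sup>2 \<le> Y" using lf(3) by simp
      finally have "real f \<le> Y" by simp
      then have "f \<le> N" unfolding N_def by (rule le_nat_floor)
      have pos: "(real f)\<^sup>2 * real (t * with_radical d) > 0" using lf(2) s0 by (intro mult_pos_pos) auto
      have "real m * ((real f)\<^sup>2 * real (t * with_radical d)) = real l * (real f)\<^sup>2"
        unfolding m(4) by (simp only: of_nat_mult mult_ac)
      then have "real m \<le> Y / ((real f)\<^sup>2 * real (t * with_radical d))"
        using lf(3) pos by (simp only: pos_le_divide_eq)
      then have "m \<le> M f t d" unfolding M_def by (rule le_nat_floor)
      then have "(f, t, d, m) \<in> Q" using \<open>f \<le> N\<close> lf m by (auto simp: Q_def)
      then show ?thesis using m zlf by (intro exI[of _ "(f, t, d, m)"]) auto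
    qed
    then obtain q where q: "\<And>z. z \<in> L' \<Longrightarrow> q z \<in> Q \<and> fst (q z) = snd z \<and>
        fst z = snd (snd (snd (q z))) * (fst (snd (q z)) * with_radical (fst (snd (snd (q z))))) \<and>
        norm (Kl_sum (fst z) (snd z) (int x) n) / sqrt (real (fst z)) \<le> v (fst (q z)) (fst (snd (q z))) (fst (snd (snd (q z)))) (snd (snd (snd (q z))))"
      by metis
    define V where "V w = v (fst w) (fst (snd w)) (fst (snd (snd w))) (snd (snd (snd w)))" for w
    have injq: "inj_on q L'"
      by (rule inj_onI) (metis q prod.expand)
    have "(\<Sum>(l, f)\<in>L. norm (Kl_sum l f (int x) n) / sqrt (real l)) = (\<Sum>z\<in>L'. norm (Kl_sum (fst z) (snd z) (int x) n) / sqrt (real (fst z)))"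
      unfolding case_prod_unfold using finL by (intro sum.mono_neutral_right) (auto simp: L'_def)
    also have "\<dots> \<le> (\<Sum>z\<in>L'. V (q z))" unfolding V_def using q by (intro sum_mono) blast
    also have "\<dots> = (\<Sum>w\<in>q ` L'. V w)" using injq by (simp add: sum.reindex)
    also have "\<dots> \<le> (\<Sum>w\<in>Q. V w)" 
    proof (rule sum_mono2[OF finQ])
      show "q ` L' \<subseteq> Q" using q by blast
    qed (simp add: V_def v0)
    also have "\<dots> = (\<Sum>f\<in>{1..N}. \<Sum>t | t dvd 2 * f. \<Sum>d | d dvd x. \<Sum>m\<in>{1..M f t d}. v f t d m)"
    proof -
      have "(\<Sum>f\<in>{1..N}. \<Sum>t | t dvd 2 * f. \<Sum>d | d dvd x. \<Sum>m\<in>{1..M f t d}. v f t d m)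
        = (\<Sum>f\<in>{1..N}. \<Sum>t | t dvd 2 * f. \<Sum>(d, m)\<in>Sigma {d. d dvd x} (\<lambda>d. {1..M f t d}). v f t d m)"
        by (intro sum.cong refl sum.Sigma) (use finx in auto)
      also have "\<dots> = (\<Sum>f\<in>{1..N}. \<Sum>(t, d, m)\<in>Sigma {t. t dvd 2 * f} (\<lambda>t. Sigma {d. d dvd x} (\<lambda>d. {1..M f t d})). v f t d m)"
        by (intro sum.cong refl sum.Sigma) (use finx fint in auto)
      also have "\<dots> = (\<Sum>(f, t, d, m)\<in>Q. v f t d m)"
        unfolding Q_def by (intro sum.Sigma) (use finx fint in auto)
      finally show ?thesis by (simp add: V_def case_prod_unfold)
    qed
    also have "\<dots> \<le> (\<Sum>f\<in>{1..N}. (8 * Y * (1 + ln Y) * real (num_divisors x) ^ 3) * (real (sqrt_count f n) / (real f)\<^sup>2 * sigma_half f))"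
    proof (rule sum_mono)
      fix f assume f: "f \<in> {1..N}"
      then have f0: "f > 0" by simp
      define E where "E = 4 * (real (sqrt_count f n) / (real f)\<^sup>2) * (Y * (1 + ln Y)) * real (num_divisors x) ^ 2"
      have E0: "E \<ge> 0" using Y by (simp add: E_def)
      have inner: "(\<Sum>m\<in>{1..M f t d}. v f t d m) \<le> E * (1 / sqrt (real t))"
        if t: "t dvd 2 * f" and d: "d dvd x" for t d
      proof (cases "M f t d = 0")
        case True then show ?thesis using E0 by simp
      next
        case False
        define w where "w = t * with_radical d"
        have t0: "t > 0" using t f0 by (auto intro: Nat.gr0I)
        have d0: "d > 0" using d x by (auto intro: Nat.gr0I)
        have wd: "with_radical d \<ge> 1" using with_radical_pos[OF d0] by simp
        have w0: "w > 0" using t0 wd by (simp add: w_def)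
        have den: "(real f)\<^sup>2 * real w > 0" using f0 w0 by simp
        have Mle: "real (M f t d) \<le> Y / ((real f)\<^sup>2 * real w)"
          unfolding M_def w_def[symmetric] using Y den by (intro of_nat_floor) auto
        have "1 \<le> (real f)\<^sup>2 * real w"
        proof -
          have "1 \<le> f\<^sup>2 * w" using f0 w0 by (simp add: Suc_le_eq)
          then have "real 1 \<le> real (f\<^sup>2 * w)" by (simp only: of_nat_le_iff)
          then show ?thesis by simp
        qed
        then have "Y / ((real f)\<^sup>2 * real w) \<le> Y / 1" using Y by (intro divide_left_mono) auto
        then have "real (M f t d) \<le> Y" using Mle by simp
        then have lnM: "ln (real (M f t d)) \<le> ln Y" using False Y by (subst ln_le_cancel_iff) auto
        have "(\<Sum>m\<in>{1..M f t d}. v f t d m) = 4 * real (sqrt_count f n) * sqrt (real w) * (\<Sum>m\<in>{1..M f t d}. real (num_divisors m) * sqrt (real (gcd m x)))"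
          by (simp add: v_def w_def[symmetric] sum_distrib_left)
        also have "\<dots> \<le> 4 * real (sqrt_count f n) * sqrt (real w) * (real (M f t d) * (1 + ln (real (M f t d))) * real (num_divisors x) ^ 2)"
          using False x by (intro mult_left_mono sum_num_divisors_gcd_le) auto
        also have "\<dots> \<le> 4 * real (sqrt_count f n) * sqrt (real w) * (Y / ((real f)\<^sup>2 * real w) * (1 + ln Y) * real (num_divisors x) ^ 2)"
          using Mle lnM Y False by (intro mult_left_mono mult_right_mono mult_mono) (auto intro!: add_nonneg_nonneg divide_nonneg_nonneg)
        also have "\<dots> = E * (sqrt (real w) / real w)" by (simp add: E_def)
        also have "sqrt (real w) / real w = 1 / sqrt (real w)" by (simp only: sqrt_divide_self_eq[OF of_nat_0_le_iff] inverse_eq_divide)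
        \<comment> \<open>Only the saving in \<open>t\<close> is kept; \<open>d\<close> runs over
          divisors of \<open>x\<close>, whose number the bound already allows for.\<close>
        also have "E * (1 / sqrt (real w)) \<le> E * (1 / sqrt (real t))"
        proof (intro mult_left_mono E0 divide_left_mono)
          have "t * 1 \<le> w" unfolding w_def using wd by (intro mult_le_mono) auto
          then show "sqrt (real t) \<le> sqrt (real w)" by simp
        qed (use t0 w0 in auto)
        finally show ?thesis .
      qed
      have "(\<Sum>t | t dvd 2 * f. \<Sum>d | d dvd x. \<Sum>m\<in>{1..M f t d}. v f t d m) \<le> (\<Sum>t | t dvd 2 * f. \<Sum>d | d dvd x. E * (1 / sqrt (real t)))"
        by (intro sum_mono inner) auto
      also have "\<dots> = E * real (num_divisors x) * sigma_half (2 * f)"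
        by (simp add: num_divisors_def sigma_half_def sum_distrib_left mult_ac)
      also have "\<dots> \<le> E * real (num_divisors x) * (2 * sigma_half f)"
      proof (intro mult_left_mono)
        have "sigma_half (2 * f) \<le> sigma_half 2 * sigma_half f" using f0 by (intro sigma_half_mult_le) auto
        also have "\<dots> \<le> 2 * sigma_half f"
        proof (intro mult_right_mono sigma_half_nonneg)
          have "{t. t dvd 2} = {1, 2 :: nat}" using two_is_prime_nat[unfolded prime_nat_iff] by auto
          then have "num_divisors 2 = 2" by (simp add: num_divisors_def)
          then show "sigma_half 2 \<le> 2" using sigma_half_le_num_divisors[of 2] by simp
        qed
        finally show "sigma_half (2 * f) \<le> 2 * sigma_half f" .
      qed (use E0 in auto)
      also have "\<dots> = (8 * Y * (1 + ln Y) * real (num_divisors x) ^ 3) * (real (sqrt_count f n) / (real f)\<^sup>2 * sigma_half f)"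
        by (simp add: E_def power2_eq_square power3_eq_cube)
      finally show "(\<Sum>t | t dvd 2 * f. \<Sum>d | d dvd x. \<Sum>m\<in>{1..M f t d}. v f t d m)
          \<le> (8 * Y * (1 + ln Y) * real (num_divisors x) ^ 3) * (real (sqrt_count f n) / (real f)\<^sup>2 * sigma_half f)" .
    qed
    also have "\<dots> = (8 * Y * (1 + ln Y) * real (num_divisors x) ^ 3) * (\<Sum>f\<in>{1..N}. real (sqrt_count f n) / (real f)\<^sup>2 * sigma_half f)"
      by (simp add: sum_distrib_left)
    also have "\<dots> \<le> (8 * Y * (1 + ln Y) * real (num_divisors x) ^ 3) * (C * (1 + ln (4 * real n)))"
      using Y by (intro mult_left_mono CS n) auto
    finally show ?thesis unfolding L_def by (simp only: mult_ac)
  qed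
  then show ?thesis using C by (intro exI[of _ "8 * C"]) auto
qed

section \<open>Analytic estimates for the integrals I\<close>

section \<open>An oscillatory integral with square-root endpoints\<close>

lemma one_minus_square_pos: "\<bar>x\<bar> < 1 \<Longrightarrow> 1 - x\<^sup>2 > (0::real)"
  by (simp add: abs_square_less_1)

lemma sqrt_deriv:
  fixes x :: real
  assumes "\<bar>x\<bar> < 1"
  shows "((\<lambda>x. sqrt (1 - x\<^sup>2)) has_real_derivative - (x / sqrt (1 - x\<^sup>2))) (at x)"
proof -
  have "((\<lambda>x. sqrt (1 - x\<^sup>2)) has_real_derivative inverse (sqrt (1 - x\<^sup>2)) / 2 * (- (2 * x))) (at x)"
    using one_minus_square_pos[OF assms] by (auto intro!: derivative_eq_intros)
  also have "inverse (sqrt (1 - x\<^sup>2)) / 2 * (- (2 * x)) = - (x / sqrt (1 - x\<^sup>2))" by (simp add: inverse_eq_divide)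
  finally show ?thesis .
qed

text \<open>The intervals within 1 / (2 |lam|) of the endpoints are estimated trivially: length of
  order |lam|^(-1) times height of order |lam|^(-1/2). Between them two integrations by parts gain
  lam^(-2) against the integral of (1 - x^2)^(-3/2), which is of order |lam|^(1/2) there; the
  boundary terms have the same total size |lam|^(-3/2).\<close>

lemma oscillatory_integral_bound:
  fixes h h' h'' :: "real \<Rightarrow> complex" and M lam :: real
  assumes M: "M \<ge> 0" and lam: "lam \<noteq> 0"
    and int: "(\<lambda>x. h x * exp (\<i> * of_real (lam * x))) integrable_on {-1..1}"
    and d1: "\<And>x. \<bar>x\<bar> < 1 \<Longrightarrow> (h has_vector_derivative h' x) (at x)"
    and d2: "\<And>x. \<bar>x\<bar> < 1 \<Longrightarrow> (h' has_vector_derivative h'' x) (at x)"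
    and b0: "\<And>x. \<bar>x\<bar> \<le> 1 \<Longrightarrow> norm (h x) \<le> M * sqrt (1 - x\<^sup>2)"
    and b1: "\<And>x. \<bar>x\<bar> < 1 \<Longrightarrow> norm (h' x) \<le> M / sqrt (1 - x\<^sup>2)"
    and b2: "\<And>x. \<bar>x\<bar> < 1 \<Longrightarrow> norm (h'' x) \<le> M / sqrt (1 - x\<^sup>2) ^ 3"
  shows "norm (integral {-1..1} (\<lambda>x. h x * exp (\<i> * of_real (lam * x)))) \<le> 9 * M * \<bar>lam\<bar> powr (- 3/2)"
proof -
  define e where "e x = exp (\<i> * of_real (lam * x))" for x :: real
  define f where "f x = h x * e x" for x
  define L where "L = \<bar>lam\<bar>"
  define u where "u = sqrt L"
  have L0: "L > 0" using lam by (simp add: L_def)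
  have u0: "u > 0" and uL: "u * u = L" using L0 by (simp_all add: u_def)
  have q: "L powr (- 3/2) = 1 / u ^ 3"
  proof -
    have "u ^ 3 = (L powr (1/2)) powr 3" using L0 by (simp add: u_def powr_half_sqrt)
    also have "\<dots> = L powr (3/2)" by (simp add: powr_powr)
    finally show ?thesis by (simp add: powr_minus_divide)
  qed
  have ne: "norm (e x) = 1" for x unfolding e_def by (rule norm_exp_i_times)
  have nf: "norm (f x) = norm (h x)" for x by (simp add: f_def norm_mult ne)
  have intf: "f integrable_on {-1..1}" using int unfolding f_def[abs_def] e_def .
  have sub: "f integrable_on {c..d}" if "-1 \<le> c" "d \<le> 1" for c d
    using that by (intro integrable_subinterval_real[OF intf]) auto
  have bound: "norm (integral {c..d} f) \<le> B * (d - c)"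
    if "-1 \<le> c" "c \<le> d" "d \<le> 1" "B \<ge> 0" "\<And>x. c \<le> x \<Longrightarrow> x \<le> d \<Longrightarrow> norm (f x) \<le> B" for c d B
    using has_integral_bound_real[OF that(4) finite.emptyI integrable_integral[OF sub[OF that(1,3)]]] that
    by simp
  have "norm (integral {-1..1} f) \<le> 9 * M * (1 / u ^ 3)"
  \<comment> \<open>For small frequency the trivial bound suffices, since then
    \<open>u ^ 3 \<le> 1\<close>.\<close>
  proof (cases "L \<le> 1")
    case True
    have "norm (f x) \<le> M" if "-1 \<le> x" "x \<le> 1" for x
    proof -
      have "sqrt (1 - x\<^sup>2) \<le> 1" by simp
      then have "M * sqrt (1 - x\<^sup>2) \<le> M * 1" using M by (rule mult_left_mono)
      then show ?thesis using b0[of x] that nf by (simp add: abs_le_iff)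
    qed
    then have "norm (integral {-1..1} f) \<le> M * (1 - (-1))" by (intro bound M) auto
    also have "\<dots> \<le> 9 * M * 1" using M by simp
    also have "9 * M * 1 \<le> 9 * M * (1 / u ^ 3)"
    proof (rule mult_left_mono)
      have "u \<le> 1" using True by (simp add: u_def)
      then have "u ^ 3 \<le> 1" using u0 by (intro power_le_one) auto
      then show "1 \<le> 1 / u ^ 3" using u0 by simp
    qed (use M in simp)
    finally show ?thesis .
  next
    case False
    \<comment> \<open>This distance from the endpoints balances the two regions. As L > 1 here, a
      exceeds 1/2, which keeps 1 - a^2 between 3 / (4 L) and 1 / L.\<close>
    define a where "a = 1 - 1 / (2 * L)"
    have iL: "0 < 1 / (2 * L)" "1 / (2 * L) < 1 / 2" using False by (simp_all add: divide_less_eq)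
    have a: "1/2 < a" "a < 1" using iL by (simp_all add: a_def)
    have w: "1 - a\<^sup>2 = 1 / (2 * L) * (1 + a)" by (simp add: a_def power2_eq_square algebra_simps)
    have w1: "1 / (2 * L) * (3/2) \<le> 1 - a\<^sup>2" unfolding w using a iL by (intro mult_left_mono) auto
    have w2: "1 - a\<^sup>2 \<le> 1 / L"
    proof -
      have "1 / (2 * L) * (1 + a) \<le> 1 / (2 * L) * 2" using a iL by (intro mult_left_mono) auto
      then show ?thesis unfolding w by simp
    qed
    define s where "s = sqrt (1 - a\<^sup>2)"
    have wpos: "1 - a\<^sup>2 > 0" unfolding w using a iL by (intro mult_pos_pos) auto
    have s0: "s > 0" using wpos by (simp add: s_def)
    have s1: "s \<le> 1 / u"
    proof -
      have "s \<le> sqrt (1 / L)" unfolding s_def using w2 by (rule real_sqrt_le_mono)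
      then show ?thesis by (simp add: u_def real_sqrt_divide)
    qed
    have s2: "1 / s \<le> 3/2 * u"
    proof -
      have "(2 / (3 * u))\<^sup>2 = 4/9 * (1 / L)" using u0 by (simp add: power2_eq_square uL)
      also have "\<dots> \<le> 3/4 * (1 / L)" using L0 by (intro mult_right_mono) auto
      also have "\<dots> = 1 / (2 * L) * (3/2)" by simp
      also have "\<dots> \<le> 1 - a\<^sup>2" by (rule w1)
      finally have "2 / (3 * u) \<le> s" unfolding s_def by (rule real_le_rsqrt)
      then have "1 / s \<le> 1 / (2 / (3 * u))" using u0 s0 by (intro divide_left_mono) auto
      then show ?thesis by simp
    qed
    define \<kappa> where "\<kappa> = \<i> * of_real lam"
    have k0: "\<kappa> \<noteq> 0" using lam by (simp add: \<kappa>_def)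
    have nk: "norm \<kappa> = L" by (simp add: \<kappa>_def L_def norm_mult)
    \<comment> \<open>The boundary function of two integrations by parts: its derivative is
      \<open>f\<close> minus a term in \<open>h''\<close>, and only that term is left to
      estimate.\<close>
    define \<Phi> where "\<Phi> x = h x * e x * (1 / \<kappa>) - h' x * e x * (1 / \<kappa>\<^sup>2)" for x
    have de: "(e has_vector_derivative \<kappa> * e x) (at x)" for x
    proof -
      have "((\<lambda>z. exp (\<kappa> * z)) has_field_derivative \<kappa> * exp (\<kappa> * of_real x)) (at (of_real x))"
        by (auto intro!: derivative_eq_intros)
      then have "((\<lambda>y. exp (\<kappa> * of_real y)) has_vector_derivative \<kappa> * exp (\<kappa> * of_real x)) (at x)"
        by (rule has_vector_derivative_real_field)
      then show ?thesis by (simp add: e_def[abs_def] \<kappa>_def mult.assoc)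
    qed
    have dPhi: "(\<Phi> has_vector_derivative f x - h'' x * e x * (1 / \<kappa>\<^sup>2)) (at x)" if x: "\<bar>x\<bar> < 1" for x
    proof -
      have "(\<Phi> has_vector_derivative (h x * (\<kappa> * e x) + h' x * e x) * (1 / \<kappa>) - (h' x * (\<kappa> * e x) + h'' x * e x) * (1 / \<kappa>\<^sup>2)) (at x)"
        unfolding \<Phi>_def
        by (intro has_vector_derivative_diff has_vector_derivative_mult_left has_vector_derivative_mult d1 d2 de x)
      also have "(h x * (\<kappa> * e x) + h' x * e x) * (1 / \<kappa>) - (h' x * (\<kappa> * e x) + h'' x * e x) * (1 / \<kappa>\<^sup>2) = f x - h'' x * e x * (1 / \<kappa>\<^sup>2)"
        using k0 by (simp add: f_def distrib_right add_divide_distrib power2_eq_square)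
      finally show ?thesis .
    qed
    have "((\<lambda>x. f x - h'' x * e x * (1 / \<kappa>\<^sup>2)) has_integral \<Phi> a - \<Phi> (- a)) {-a..a}"
      using a by (intro fundamental_theorem_of_calculus has_vector_derivative_at_within[OF dPhi]) auto
    moreover have "(f has_integral integral {-a..a} f) {-a..a}" using a by (intro integrable_integral sub) auto
    ultimately have "((\<lambda>x. f x - (f x - h'' x * e x * (1 / \<kappa>\<^sup>2))) has_integral integral {-a..a} f - (\<Phi> a - \<Phi> (- a))) {-a..a}"
      by (rule has_integral_diff[rotated])
    then have rest: "((\<lambda>x. h'' x * e x * (1 / \<kappa>\<^sup>2)) has_integral integral {-a..a} f - (\<Phi> a - \<Phi> (- a))) {-a..a}" by simp
    have wx: "1 - x\<^sup>2 > 0" if "\<bar>x\<bar> < 1" for x :: real using that by (simp add: abs_square_less_1)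
    have dA: "((\<lambda>x. x / sqrt (1 - x\<^sup>2)) has_vector_derivative 1 / sqrt (1 - x\<^sup>2) ^ 3) (at x)" if x: "\<bar>x\<bar> < 1" for x :: real
    proof -
      define r where "r = sqrt (1 - x\<^sup>2)"
      have r0: "r > 0" and rr: "r * r = 1 - x\<^sup>2" using wx[OF x] by (simp_all add: r_def)
      have "((\<lambda>x. x / sqrt (1 - x\<^sup>2)) has_real_derivative (1 * r - x * (- (x / r))) / (r * r)) (at x)"
        unfolding r_def using wx[OF x] by (intro DERIV_divide DERIV_ident sqrt_deriv[OF x]) auto
      also have "1 * r - x * (- (x / r)) = (r * r + x * x) / r" using r0 by (simp add: add_divide_distrib)
      also have "r * r + x * x = 1" using rr by (simp add: power2_eq_square)
      also have "1 / r / (r * r) = 1 / r ^ 3" by (simp add: power3_eq_cube)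
      finally show ?thesis by (simp add: r_def has_real_derivative_iff_has_vector_derivative)
    qed
    have gi: "((\<lambda>x. M / L\<^sup>2 * (1 / sqrt (1 - x\<^sup>2) ^ 3)) has_integral M / L\<^sup>2 * (a / s - (- a) / s)) {-a..a}"
    proof (rule has_integral_mult_right)
      have "((\<lambda>x. 1 / sqrt (1 - x\<^sup>2) ^ 3) has_integral a / sqrt (1 - a\<^sup>2) - (- a) / sqrt (1 - (- a)\<^sup>2)) {-a..a}"
        using a by (intro fundamental_theorem_of_calculus has_vector_derivative_at_within[OF dA]) auto
      then show "((\<lambda>x. 1 / sqrt (1 - x\<^sup>2) ^ 3) has_integral a / s - (- a) / s) {-a..a}" by (simp add: s_def)
    qed
    have "norm (integral {-a..a} f - (\<Phi> a - \<Phi> (- a))) \<le> M / L\<^sup>2 * (a / s - (- a) / s)"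
    proof -
      have "norm (integral {-a..a} (\<lambda>x. h'' x * e x * (1 / \<kappa>\<^sup>2))) \<le> integral {-a..a} (\<lambda>x. M / L\<^sup>2 * (1 / sqrt (1 - x\<^sup>2) ^ 3))"
      proof (rule integral_norm_bound_integral)
        fix x assume "x \<in> {-a..a}"
        then have "\<bar>x\<bar> < 1" using a by auto
        have "norm (h'' x * e x * (1 / \<kappa>\<^sup>2)) = norm (h'' x) * (1 / L\<^sup>2)"
          by (simp add: norm_mult norm_divide norm_power ne nk)
        also have "\<dots> \<le> M / sqrt (1 - x\<^sup>2) ^ 3 * (1 / L\<^sup>2)"
          using \<open>\<bar>x\<bar> < 1\<close> by (intro mult_right_mono b2) auto
        also have "\<dots> = M / L\<^sup>2 * (1 / sqrt (1 - x\<^sup>2) ^ 3)" by simp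
        finally show "norm (h'' x * e x * (1 / \<kappa>\<^sup>2)) \<le> M / L\<^sup>2 * (1 / sqrt (1 - x\<^sup>2) ^ 3)" .
      qed (use rest gi in \<open>auto simp: has_integral_integrable\<close>)
      then show ?thesis using rest gi by (simp only: integral_unique)
    qed
    also have "\<dots> \<le> 3 * M * (1 / u ^ 3)"
    proof -
      have "a / s - (- a) / s = 2 * a * (1 / s)" by simp
      also have "\<dots> \<le> 2 * 1 * (3/2 * u)" using a s0 s2 by (intro mult_mono) auto
      finally have "M / L\<^sup>2 * (a / s - (- a) / s) \<le> M / L\<^sup>2 * (3 * u)" using M by (intro mult_left_mono) auto
      also have "L\<^sup>2 = u ^ 3 * u" by (simp add: uL[symmetric] power2_eq_square power3_eq_cube)
      then have "M / L\<^sup>2 * (3 * u) = 3 * M * (1 / u ^ 3)" using u0 by simp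
      finally show ?thesis .
    qed
    finally have mid: "norm (integral {-a..a} f - (\<Phi> a - \<Phi> (- a))) \<le> 3 * M * (1 / u ^ 3)" .
    have Phi: "norm (\<Phi> y) \<le> 5/2 * M * (1 / u ^ 3)" if y: "y = a \<or> y = - a" for y
    proof -
      have y1: "\<bar>y\<bar> < 1" and yw: "sqrt (1 - y\<^sup>2) = s" using y a by (auto simp: s_def)
      have "norm (\<Phi> y) \<le> norm (h y) * (1 / L) + norm (h' y) * (1 / L\<^sup>2)"
        unfolding \<Phi>_def by (rule order_trans[OF norm_triangle_ineq4]) (simp add: norm_mult norm_divide norm_power ne nk)
      also have "\<dots> \<le> (M * s) * (1 / L) + (M * (1 / s)) * (1 / L\<^sup>2)"
        using b0[of y] b1[of y] y1 yw L0 by (intro add_mono mult_right_mono) auto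
      also have "\<dots> \<le> (M * (1 / u)) * (1 / L) + (M * (3/2 * u)) * (1 / L\<^sup>2)"
        using M L0 s1 s2 by (intro add_mono mult_right_mono mult_left_mono) auto
      also have "(M * (1 / u)) * (1 / L) = M * (1 / u ^ 3)" by (simp add: uL[symmetric] power3_eq_cube mult.assoc)
      also have "(M * (3/2 * u)) * (1 / L\<^sup>2) = 3/2 * M * (1 / u ^ 3)"
        using u0 by (simp add: uL[symmetric] power2_eq_square power3_eq_cube)
      finally show ?thesis by simp
    qed
    have small: "norm (f x) \<le> M * (1 / u)" if "a \<le> \<bar>x\<bar>" "\<bar>x\<bar> \<le> 1" for x
    proof -
      have "a\<^sup>2 \<le> \<bar>x\<bar>\<^sup>2" using that a by (intro power_mono) auto
      then have "sqrt (1 - x\<^sup>2) \<le> s" by (simp add: s_def)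
      then have "M * sqrt (1 - x\<^sup>2) \<le> M * (1 / u)" using s1 M by (intro mult_left_mono) auto
      then show ?thesis using b0[of x] that nf by simp
    qed
    have endval: "M * (1 / u) * (1 - a) = 1/2 * M * (1 / u ^ 3)"
      by (simp add: a_def uL[symmetric] power3_eq_cube)
    have r1: "norm (integral {a..1} f) \<le> M * (1 / u) * (1 - a)"
      using a M u0 by (intro bound small) auto
    have r2: "norm (integral {-1..-a} f) \<le> M * (1 / u) * (- a - (- 1))"
      using a M u0 by (intro bound small) auto
    have "integral {-1..1} f = integral {-1..-a} f + integral {-a..1} f"
      using a by (intro Henstock_Kurzweil_Integration.integral_combine[symmetric] intf) auto
    also have "integral {-a..1} f = integral {-a..a} f + integral {a..1} f"
      using a by (intro Henstock_Kurzweil_Integration.integral_combine[symmetric] sub) auto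
    also have "integral {-a..a} f = (integral {-a..a} f - (\<Phi> a - \<Phi> (- a))) + (\<Phi> a - \<Phi> (- a))" by simp
    finally have "norm (integral {-1..1} f) \<le> norm (integral {-1..-a} f) + (norm (integral {-a..a} f - (\<Phi> a - \<Phi> (- a))) + (norm (\<Phi> a) + norm (\<Phi> (- a))) + norm (integral {a..1} f))"
      by (simp only:) (intro order_trans[OF norm_triangle_ineq] add_mono order_refl norm_triangle_ineq4)
    \<comment> \<open>9 = 3 + 2 * 5/2 + 2 * 1/2: the inner integral, the two boundary terms and the
      two end intervals.\<close>
    also have "\<dots> \<le> 9 * M * (1 / u ^ 3)"
      using r1 r2 mid Phi[of a] Phi[of "- a"] endval by simp
    finally show ?thesis .
  qed
  then have "norm (integral {-1..1} f) \<le> 9 * M * (L powr (- 3/2))" by (simp only: q)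
  then show ?thesis unfolding f_def[abs_def] e_def L_def .
qed

section \<open>The weight theta\<close>

text \<open>With x = cos \<phi> this is exp (i j \<phi>). Its imaginary part for j = k - 1, divided
  by -pi, is \<open>theta_inf k\<close>; \<open>theta_d\<close> and \<open>theta_dd\<close> are the
  first two derivatives of \<open>theta_c\<close> in x.\<close>

definition theta_c :: "nat \<Rightarrow> real \<Rightarrow> complex" where
  "theta_c j x = (of_real x + \<i> * of_real (sqrt (1 - x\<^sup>2))) ^ j"

definition theta_d :: "nat \<Rightarrow> real \<Rightarrow> complex" where
  "theta_d j x = - \<i> * of_nat j * theta_c j x / of_real (sqrt (1 - x\<^sup>2))"

definition theta_dd :: "nat \<Rightarrow> real \<Rightarrow> complex" where
  "theta_dd j x = - \<i> * of_nat j * (theta_c j x * of_real (x / sqrt (1 - x\<^sup>2) ^ 3) + theta_d j x * of_real (1 / sqrt (1 - x\<^sup>2)))"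

lemma inverse_sqrt_deriv:
  fixes x :: real
  assumes "\<bar>x\<bar> < 1"
  shows "((\<lambda>x. 1 / sqrt (1 - x\<^sup>2)) has_real_derivative x / sqrt (1 - x\<^sup>2) ^ 3) (at x)"
proof -
  define r where "r = sqrt (1 - x\<^sup>2)"
  have r0: "r > 0" using one_minus_square_pos[OF assms] by (simp add: r_def)
  have "((\<lambda>x. 1 / sqrt (1 - x\<^sup>2)) has_real_derivative (0 * r - 1 * (- (x / r))) / (r * r)) (at x)"
    unfolding r_def using one_minus_square_pos[OF assms] sqrt_deriv[OF assms]
    by (intro DERIV_divide DERIV_const) auto
  also have "(0 * r - 1 * (- (x / r))) / (r * r) = x / r ^ 3" by (simp add: power3_eq_cube)
  finally show ?thesis by (simp add: r_def)
qed

lemma theta_c_base_norm: "\<bar>x\<bar> \<le> 1 \<Longrightarrow> norm (of_real x + \<i> * of_real (sqrt (1 - x\<^sup>2))) = 1"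
  by (simp add: cmod_def abs_square_le_1)

lemma norm_theta_c: "\<bar>x\<bar> \<le> 1 \<Longrightarrow> norm (theta_c j x) = 1"
  unfolding theta_c_def by (simp only: norm_power theta_c_base_norm power_one)

text \<open>The inequality |sin (j \<phi>)| \<le> j |sin \<phi>|, by induction with the addition
  formula. It is the source of the square-root zero at the endpoints.\<close>

lemma abs_Im_theta_c_le: "\<bar>x\<bar> \<le> 1 \<Longrightarrow> \<bar>Im (theta_c j x)\<bar> \<le> real j * sqrt (1 - x\<^sup>2)"
proof (induction j)
  case (Suc j)
  define w where "w = sqrt (1 - x\<^sup>2)"
  have w: "w \<ge> 0" using Suc by (simp add: w_def abs_square_le_1)
  have "theta_c (Suc j) x = (of_real x + \<i> * of_real w) * theta_c j x" by (simp add: theta_c_def w_def)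
  then have "Im (theta_c (Suc j) x) = x * Im (theta_c j x) + w * Re (theta_c j x)" by simp
  then have "\<bar>Im (theta_c (Suc j) x)\<bar> \<le> \<bar>x\<bar> * \<bar>Im (theta_c j x)\<bar> + w * \<bar>Re (theta_c j x)\<bar>"
    using abs_triangle_ineq[of "x * Im (theta_c j x)" "w * Re (theta_c j x)"] w by (simp add: abs_mult)
  also have "\<dots> \<le> 1 * (real j * w) + w * 1"
  proof (intro add_mono mult_mono)
    show "\<bar>Re (theta_c j x)\<bar> \<le> 1" using abs_Re_le_cmod[of "theta_c j x"] norm_theta_c[OF Suc.prems] by simp
    show "\<bar>Im (theta_c j x)\<bar> \<le> real j * w" using Suc by (simp add: w_def)
  qed (use Suc w in auto)
  finally show ?case by (simp add: w_def distrib_right algebra_simps)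
qed (simp add: theta_c_def)

lemma theta_c_deriv:
  assumes x: "\<bar>x\<bar> < 1"
  shows "(theta_c j has_vector_derivative theta_d j x) (at x)"
proof -
  define z where "z x = of_real x + \<i> * of_real (sqrt (1 - x\<^sup>2))" for x :: real
  define r where "r = sqrt (1 - x\<^sup>2)"
  have r0: "r > 0" using one_minus_square_pos[OF x] by (simp add: r_def)
  have dz: "(z has_vector_derivative - \<i> * z x / of_real r) (at x)"
  proof -
    have "(z has_vector_derivative of_real 1 + \<i> * of_real (- (x / r))) (at x)"
      unfolding z_def r_def
      by (intro has_vector_derivative_add has_vector_derivative_of_real has_vector_derivative_mult_right
          DERIV_ident sqrt_deriv[OF x])
    also have "of_real 1 + \<i> * of_real (- (x / r)) = - \<i> * z x / of_real r"
      using r0 by (simp add: z_def r_def[symmetric] complex_eq_iff)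
    finally show ?thesis .
  qed
  have "((\<lambda>y. z y ^ j) has_vector_derivative of_nat j * (- \<i> * z x / of_real r) * z x ^ (j - 1)) (at x)"
  proof -
    have "((\<lambda>w. w ^ j) has_field_derivative of_nat j * z x ^ (j - 1)) (at (z x))"
      by (auto intro!: derivative_eq_intros)
    from field_vector_diff_chain_at[OF dz this] show ?thesis by (simp add: o_def mult_ac)
  qed
  also have "of_nat j * (- \<i> * z x / of_real r) * z x ^ (j - 1) = theta_d j x"
    by (cases j) (simp_all add: theta_d_def theta_c_def z_def r_def)
  finally show ?thesis by (simp add: theta_c_def[abs_def] z_def)
qed

lemma theta_d_deriv:
  assumes x: "\<bar>x\<bar> < 1"
  shows "(theta_d j has_vector_derivative theta_dd j x) (at x)"
proof -
  have eq: "theta_d j = (\<lambda>y. - \<i> * of_nat j * (theta_c j y * of_real (1 / sqrt (1 - y\<^sup>2))))"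
    by (simp add: theta_d_def fun_eq_iff)
  have "((\<lambda>y. - \<i> * of_nat j * (theta_c j y * of_real (1 / sqrt (1 - y\<^sup>2)))) has_vector_derivative
     - \<i> * of_nat j * (theta_c j x * of_real (x / sqrt (1 - x\<^sup>2) ^ 3) + theta_d j x * of_real (1 / sqrt (1 - x\<^sup>2)))) (at x)"
    by (intro has_vector_derivative_mult_right has_vector_derivative_mult has_vector_derivative_of_real
        theta_c_deriv[OF x] inverse_sqrt_deriv[OF x])
  then show ?thesis unfolding theta_dd_def by (subst eq)
qed

lemma norm_theta_d_le: "\<bar>x\<bar> < 1 \<Longrightarrow> norm (theta_d j x) \<le> real j / sqrt (1 - x\<^sup>2)"
  using one_minus_square_pos[of x] norm_theta_c[of x j] by (simp add: theta_d_def norm_mult norm_divide)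

lemma norm_theta_dd_le:
  assumes x: "\<bar>x\<bar> < 1"
  shows "norm (theta_dd j x) \<le> (real j ^ 2 + real j) / sqrt (1 - x\<^sup>2) ^ 3"
proof -
  define r where "r = sqrt (1 - x\<^sup>2)"
  have r0: "r > 0" "r \<le> 1" using one_minus_square_pos[OF x] by (simp_all add: r_def)
  have "norm (theta_dd j x) \<le> real j * (\<bar>x\<bar> / r ^ 3 + norm (theta_d j x) * (1 / r))"
    unfolding theta_dd_def r_def[symmetric] norm_mult
    using r0 norm_theta_c[of x j] x
    by (intro mult_mono order_trans[OF norm_triangle_ineq] add_mono) (auto simp: norm_mult norm_divide norm_power)
  also have "\<dots> \<le> real j * (1 / r ^ 3 + real j / r ^ 3)"
  proof (intro mult_left_mono add_mono)
    have "norm (theta_d j x) * (1 / r) \<le> real j / r * (1 / r)"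
      using norm_theta_d_le[OF x, of j] r0 by (intro mult_right_mono) (auto simp: r_def)
    also have "\<dots> = real j * (1 / r ^ 2)" by (simp add: power2_eq_square)
    also have "\<dots> \<le> real j * (1 / r ^ 3)"
    proof (intro mult_left_mono divide_left_mono)
      show "r ^ 3 \<le> r ^ 2" using r0 by (intro power_decreasing) auto
    qed (use r0 in auto)
    finally show "norm (theta_d j x) * (1 / r) \<le> real j / r ^ 3" by simp
    show "\<bar>x\<bar> / r ^ 3 \<le> 1 / r ^ 3" using x r0 by (intro divide_right_mono) auto
  qed auto
  also have "\<dots> = (real j ^ 2 + real j) / r ^ 3" by (simp add: add_divide_distrib power2_eq_square distrib_left)
  finally show ?thesis by (simp add: r_def)
qed

text \<open>The endpoints are included: there \<open>theta_inf\<close> is 0 by definition and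
  \<open>theta_c\<close> is real.\<close>

lemma of_real_theta_inf_eq:
  assumes "\<bar>x\<bar> \<le> 1"
  shows "complex_of_real (theta_inf k x) = \<i> / (2 * of_real pi) * (theta_c (k - 1) x - cnj (theta_c (k - 1) x))"
proof (cases "\<bar>x\<bar> < 1")
  case True
  then show ?thesis by (simp add: of_real_theta_inf theta_c_def)
next
  case False
  then have "x\<^sup>2 = 1" using assms by (simp add: abs_square_eq_1)
  then have "theta_c (k - 1) x = of_real (x ^ (k - 1))" by (simp add: theta_c_def)
  then show ?thesis using False by (simp add: theta_inf_def)
qed

text \<open>By the product rule the weight times \<open>g\<close> satisfies the hypotheses of
  \<open>oscillatory_integral_bound\<close>, since on either factor a derivative costs at most 1 /
  (1 - x^2). At most four terms arise, so M is four times k^2 G, and 36 = 9 * 4.\<close>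

lemma theta_weighted_oscillatory_bound:
  fixes g g' g'' :: "real \<Rightarrow> complex" and G lam :: real
  assumes k: "k \<ge> 2" and G: "G \<ge> 0" and lam: "lam \<noteq> 0"
    and int: "(\<lambda>x. of_real (theta_inf k x) * g x * exp (\<i> * of_real (lam * x))) integrable_on {-1..1}"
    and d1: "\<And>x. \<bar>x\<bar> < 1 \<Longrightarrow> (g has_vector_derivative g' x) (at x)"
    and d2: "\<And>x. \<bar>x\<bar> < 1 \<Longrightarrow> (g' has_vector_derivative g'' x) (at x)"
    and b0: "\<And>x. \<bar>x\<bar> < 1 \<Longrightarrow> norm (g x) \<le> G"
    and b1: "\<And>x. \<bar>x\<bar> < 1 \<Longrightarrow> norm (g' x) \<le> G / (1 - x\<^sup>2)"
    and b2: "\<And>x. \<bar>x\<bar> < 1 \<Longrightarrow> norm (g'' x) \<le> G / (1 - x\<^sup>2)\<^sup>2"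
  shows "norm (integral {-1..1} (\<lambda>x. of_real (theta_inf k x) * g x * exp (\<i> * of_real (lam * x))))
    \<le> 36 * real k ^ 2 * G * \<bar>lam\<bar> powr (- 3/2)"
proof -
  define j where "j = k - 1"
  define c where "c = \<i> / (2 * complex_of_real pi)"
  have c: "norm c \<le> 1/2" using pi_gt3 by (simp add: c_def norm_divide norm_mult divide_le_eq)
  define \<theta> where "\<theta> x = complex_of_real (theta_inf k x)" for x
  define \<theta>' where "\<theta>' x = c * (theta_d j x - cnj (theta_d j x))" for x
  define \<theta>'' where "\<theta>'' x = c * (theta_dd j x - cnj (theta_dd j x))" for x
  define K where "K = real k ^ 2"
  have jK: "real j ^ 2 + real j \<le> K" "real j \<le> K" "real j \<le> real k"
  proof -
    have "k = j + 1" using k by (simp add: j_def)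
    then have "K = real j ^ 2 + real j + real j + 1" by (simp add: K_def power2_eq_square algebra_simps)
    then show "real j ^ 2 + real j \<le> K" by simp
    then show "real j \<le> K" using zero_le_power2[of "real j"] by linarith
    show "real j \<le> real k" by (simp add: j_def)
  qed
  have K0: "K \<ge> 0" by (simp add: K_def)
  have ncnj: "norm (c * (z - cnj z)) \<le> norm z" for z
  proof -
    have "norm (z - cnj z) \<le> norm z + norm z" using norm_triangle_ineq4[of z "cnj z"] by simp
    then have "norm c * norm (z - cnj z) \<le> 1/2 * (norm z + norm z)" using c by (intro mult_mono) auto
    then show ?thesis by (simp add: norm_mult)
  qed
  have eq: "\<theta> y = c * (theta_c j y - cnj (theta_c j y))" if "\<bar>y\<bar> \<le> 1" for y
    using of_real_theta_inf_eq[OF that, of k] by (simp add: \<theta>_def c_def j_def)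
  have dt: "(\<theta> has_vector_derivative \<theta>' x) (at x)" if x: "\<bar>x\<bar> < 1" for x
  proof -
    have "((\<lambda>y. c * (theta_c j y - cnj (theta_c j y))) has_vector_derivative \<theta>' x) (at x)"
      unfolding \<theta>'_def
      by (intro has_vector_derivative_mult_right has_vector_derivative_diff has_vector_derivative_cnj theta_c_deriv[OF x])
    moreover have "open {-1<..<1::real}" "x \<in> {-1<..<1}" using x by auto
    ultimately show ?thesis
      by (rule has_vector_derivative_transform_within_open) (auto simp: eq abs_le_iff)
  qed
  have dt': "(\<theta>' has_vector_derivative \<theta>'' x) (at x)" if x: "\<bar>x\<bar> < 1" for x
    unfolding \<theta>'_def[abs_def] \<theta>''_def
    by (intro has_vector_derivative_mult_right has_vector_derivative_diff has_vector_derivative_cnj theta_d_deriv[OF x])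
  have bt: "norm (\<theta> x) \<le> K * sqrt (1 - x\<^sup>2)" if x: "\<bar>x\<bar> \<le> 1" for x
  proof -
    have "norm (\<theta> x) = norm c * norm (theta_c j x - cnj (theta_c j x))" by (simp add: eq[OF x] norm_mult)
    also have "theta_c j x - cnj (theta_c j x) = 2 * of_real (Im (theta_c j x)) * \<i>" by (simp add: complex_diff_cnj)
    also have "norm c * norm (2 * of_real (Im (theta_c j x)) * \<i>) \<le> 1/2 * (2 * (real j * sqrt (1 - x\<^sup>2)))"
      using c abs_Im_theta_c_le[OF x, of j] by (intro mult_mono) (auto simp: norm_mult)
    also have "\<dots> \<le> K * sqrt (1 - x\<^sup>2)" using jK(2) x by (simp add: mult_right_mono abs_square_le_1)
    finally show ?thesis .
  qed
  have bt': "norm (\<theta>' x) \<le> K / sqrt (1 - x\<^sup>2)" if x: "\<bar>x\<bar> < 1" for x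
  proof -
    have "norm (\<theta>' x) \<le> real j / sqrt (1 - x\<^sup>2)"
      unfolding \<theta>'_def by (rule order_trans[OF ncnj norm_theta_d_le[OF x]])
    also have "\<dots> \<le> K / sqrt (1 - x\<^sup>2)" using jK one_minus_square_pos[OF x] by (intro divide_right_mono) auto
    finally show ?thesis .
  qed
  have bt'': "norm (\<theta>'' x) \<le> K / sqrt (1 - x\<^sup>2) ^ 3" if x: "\<bar>x\<bar> < 1" for x
  proof -
    have "norm (\<theta>'' x) \<le> (real j ^ 2 + real j) / sqrt (1 - x\<^sup>2) ^ 3"
      unfolding \<theta>''_def by (rule order_trans[OF ncnj norm_theta_dd_le[OF x]])
    also have "\<dots> \<le> K / sqrt (1 - x\<^sup>2) ^ 3" using jK one_minus_square_pos[OF x] by (intro divide_right_mono) auto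
    finally show ?thesis .
  qed
  have "norm (integral {-1..1} (\<lambda>x. (\<theta> x * g x) * exp (\<i> * of_real (lam * x)))) \<le> 9 * (4 * K * G) * \<bar>lam\<bar> powr (- 3/2)"
  proof (rule oscillatory_integral_bound[where h' = "\<lambda>x. \<theta> x * g' x + \<theta>' x * g x"
        and h'' = "\<lambda>x. (\<theta> x * g'' x + \<theta>' x * g' x) + (\<theta>' x * g' x + \<theta>'' x * g x)"])
    show "0 \<le> 4 * K * G" using K0 G by simp
    show "(\<lambda>x. \<theta> x * g x * exp (\<i> * of_real (lam * x))) integrable_on {-1..1}" using int by (simp add: \<theta>_def)
    fix x :: real
    show "norm (\<theta> x * g x) \<le> 4 * K * G * sqrt (1 - x\<^sup>2)" if x: "\<bar>x\<bar> \<le> 1"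
    proof (cases "\<bar>x\<bar> < 1")
      case True
      have "norm (\<theta> x * g x) \<le> (K * sqrt (1 - x\<^sup>2)) * G"
        unfolding norm_mult using bt[OF x] b0[OF True] K0 one_minus_square_pos[OF True] by (intro mult_mono) auto
      also have "\<dots> \<le> 4 * ((K * sqrt (1 - x\<^sup>2)) * G)"
        using K0 G one_minus_square_pos[OF True] by simp
      finally show ?thesis by (simp add: mult_ac)
    next
      \<comment> \<open>Nothing is assumed about \<open>g\<close> at the endpoints; the zero of the
        weight decides.\<close>
      case False
      then have "\<theta> x = 0" by (simp add: \<theta>_def theta_inf_def)
      then show ?thesis using K0 G x by (simp add: abs_square_le_1)
    qed
    assume x: "\<bar>x\<bar> < 1"
    define r where "r = sqrt (1 - x\<^sup>2)"
    have r0: "r > 0" and rr: "1 - x\<^sup>2 = r * r" using one_minus_square_pos[OF x] by (simp_all add: r_def)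
    show "((\<lambda>x. \<theta> x * g x) has_vector_derivative \<theta> x * g' x + \<theta>' x * g x) (at x)"
      by (intro has_vector_derivative_mult dt d1 x)
    show "((\<lambda>x. \<theta> x * g' x + \<theta>' x * g x) has_vector_derivative (\<theta> x * g'' x + \<theta>' x * g' x) + (\<theta>' x * g' x + \<theta>'' x * g x)) (at x)"
      by (intro has_vector_derivative_add has_vector_derivative_mult dt dt' d1 d2 x)
    have t0: "norm (\<theta> x) \<le> K * r" using bt[of x] x by (simp add: r_def)
    have t1: "norm (\<theta>' x) \<le> K / r" using bt'[OF x] by (simp add: r_def)
    have t2: "norm (\<theta>'' x) \<le> K / r ^ 3" using bt''[OF x] by (simp add: r_def)
    have g1: "norm (g' x) \<le> G / (r * r)" using b1[OF x] by (simp add: rr)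
    have g2: "norm (g'' x) \<le> G / (r * r)\<^sup>2" using b2[OF x] by (simp add: rr)
    have p1: "norm (\<theta> x * g' x) \<le> K * G / r"
    proof -
      have "norm (\<theta> x * g' x) \<le> (K * r) * (G / (r * r))" unfolding norm_mult using t0 g1 K0 r0 by (intro mult_mono) auto
      then show ?thesis using r0 by simp
    qed
    have p2: "norm (\<theta>' x * g x) \<le> K * G / r"
    proof -
      have "norm (\<theta>' x * g x) \<le> (K / r) * G" unfolding norm_mult using t1 b0[OF x] K0 r0 by (intro mult_mono) auto
      then show ?thesis by simp
    qed
    have "norm (\<theta> x * g' x + \<theta>' x * g x) \<le> 4 * (K * G / r)"
    proof -
      have nn: "0 \<le> K * G / r" using K0 G r0 by simp
      have "norm (\<theta> x * g' x + \<theta>' x * g x) \<le> K * G / r + K * G / r"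
        by (rule order_trans[OF norm_triangle_ineq add_mono[OF p1 p2]])
      also have "\<dots> \<le> 4 * (K * G / r)"
      proof -
        have "b + b \<le> 4 * b" if "0 \<le> b" for b :: real using that by simp
        then show ?thesis using nn by blast
      qed
      finally show ?thesis .
    qed
    then show "norm (\<theta> x * g' x + \<theta>' x * g x) \<le> 4 * K * G / sqrt (1 - x\<^sup>2)" by (simp add: r_def mult.assoc)
    have q1: "norm (\<theta> x * g'' x) \<le> K * G / r ^ 3"
    proof -
      have "norm (\<theta> x * g'' x) \<le> (K * r) * (G / (r * r)\<^sup>2)" unfolding norm_mult using t0 g2 K0 r0 by (intro mult_mono) auto
      also have "\<dots> = K * G / r ^ 3" using r0 by (simp add: power2_eq_square power3_eq_cube)
      finally show ?thesis .
    qed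
    have q2: "norm (\<theta>' x * g' x) \<le> K * G / r ^ 3"
    proof -
      have "norm (\<theta>' x * g' x) \<le> (K / r) * (G / (r * r))" unfolding norm_mult using t1 g1 K0 r0 by (intro mult_mono) auto
      also have "\<dots> = K * G / r ^ 3" using r0 by (simp add: power3_eq_cube)
      finally show ?thesis .
    qed
    have q3: "norm (\<theta>'' x * g x) \<le> K * G / r ^ 3"
    proof -
      have "norm (\<theta>'' x * g x) \<le> (K / r ^ 3) * G" unfolding norm_mult using t2 b0[OF x] K0 r0 by (intro mult_mono) auto
      then show ?thesis by simp
    qed
    have "norm ((\<theta> x * g'' x + \<theta>' x * g' x) + (\<theta>' x * g' x + \<theta>'' x * g x)) \<le> 4 * (K * G / r ^ 3)"
    proof -
      have "norm ((\<theta> x * g'' x + \<theta>' x * g' x) + (\<theta>' x * g' x + \<theta>'' x * g x))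
          \<le> (K * G / r ^ 3 + K * G / r ^ 3) + (K * G / r ^ 3 + K * G / r ^ 3)"
        by (intro order_trans[OF norm_triangle_ineq] add_mono q1 q2 q3)
      moreover have "(b + b) + (b + b) = 4 * b" for b :: real by simp
      ultimately show ?thesis by (simp only:)
    qed
    then show "norm ((\<theta> x * g'' x + \<theta>' x * g' x) + (\<theta>' x * g' x + \<theta>'' x * g x)) \<le> 4 * K * G / sqrt (1 - x\<^sup>2) ^ 3"
      by (simp add: r_def mult.assoc)
  qed (rule lam)
  then show ?thesis by (simp add: \<theta>_def K_def mult.assoc)
qed

section \<open>The cutoff function\<close>

lemma exp_tail:
  fixes a x :: real
  assumes a: "a > 0"
  shows "set_integrable lborel {x<..} (\<lambda>y. exp (- (a * y)))"
    and "(LINT y:{x<..}|lborel. exp (- (a * y))) = exp (- (a * x)) / a"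
proof -
  define F where "F y = - (exp (- (a * y)) / a)" for y
  have D: "DERIV F y :> exp (- (a * y))" for y
    unfolding F_def using a by (auto intro!: derivative_eq_intros)
  have A: "((F \<circ> real_of_ereal) \<longlongrightarrow> F x) (at_right (ereal x))"
    unfolding ereal_tendsto_simps1
    using DERIV_isCont[OF D, of x] by (simp add: isCont_def filterlim_at_split)
  have B: "((F \<circ> real_of_ereal) \<longlongrightarrow> 0) (at_left \<infinity>)"
  proof -
    have "filterlim (\<lambda>y. a * y) at_top at_top" using a by (simp add: filterlim_at_top_mult_tendsto_pos filterlim_tendsto_pos_mult_at_top[OF tendsto_const a filterlim_ident])
    then have "filterlim (\<lambda>y. - (a * y)) at_bot at_top" by (simp add: filterlim_uminus_at_bot)
    then have "((\<lambda>y. exp (- (a * y))) \<longlongrightarrow> 0) at_top" by (rule filterlim_compose[OF exp_at_bot])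
    then have "((\<lambda>y. - (exp (- (a * y)) / a)) \<longlongrightarrow> - (0 / a)) at_top" using a by (intro tendsto_intros) auto
    then show ?thesis unfolding ereal_tendsto_simps1 by (simp add: F_def[abs_def])
  qed
  have 1: "set_integrable lborel (einterval (ereal x) \<infinity>) (\<lambda>y. exp (- (a * y)))"
    by (rule interval_integral_FTC_nonneg(1)[OF _ _ _ _ A B]) (auto intro!: D continuous_intros)
  have 2: "(LBINT y=ereal x..\<infinity>. exp (- (a * y))) = 0 - F x"
    by (rule interval_integral_FTC_nonneg(2)[OF _ _ _ _ A B]) (auto intro!: D continuous_intros)
  show "set_integrable lborel {x<..} (\<lambda>y. exp (- (a * y)))" using 1 by simp
  show "(LINT y:{x<..}|lborel. exp (- (a * y))) = exp (- (a * x)) / a"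
    using 2 by (simp add: interval_integral_to_infinity_eq F_def)
qed

definition cut_kernel :: "real \<Rightarrow> real" where
  "cut_kernel y = exp (- y - 1 / y) / y"

text \<open>The factor 1 / y does no harm near 0, since 1 / y \<le> exp (1 / y).\<close>

lemma cut_kernel_bounds:
  assumes "y > 0" shows "0 \<le> cut_kernel y" "cut_kernel y \<le> exp (- (1 * y))"
proof -
  show "0 \<le> cut_kernel y" using assms by (simp add: cut_kernel_def)
  have "1 / y \<le> exp (1 / y)" using exp_ge_add_one_self[of "1 / y"] by linarith
  then have "exp (- y - 1 / y) * (1 / y) \<le> exp (- y - 1 / y) * exp (1 / y)" by (intro mult_left_mono) auto
  also have "\<dots> = exp (- (1 * y))" by (simp flip: exp_add)
  finally show "cut_kernel y \<le> exp (- (1 * y))" by (simp add: cut_kernel_def)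
qed

lemma cut_kernel_measurable [measurable]: "cut_kernel \<in> borel_measurable borel"
  unfolding cut_kernel_def[abs_def] by measurable

lemma cut_kernel_integrable: "x \<ge> 0 \<Longrightarrow> set_integrable lborel {x<..} cut_kernel"
  by (rule set_integrable_bound[OF exp_tail(1)[of 1 x]])
     (use cut_kernel_bounds in \<open>auto simp: set_borel_measurable_def intro!: AE_I2\<close>)

definition cut_const :: real where "cut_const = 1 / (2 * bessel_K0 2)"

lemma F_cutoff_eq: "F_cutoff x = cut_const * (LINT y:{x<..}|lborel. cut_kernel y)"
  by (simp add: F_cutoff_def cut_const_def cut_kernel_def)

lemma abs_F_cutoff_le:
  assumes x: "x \<ge> 0"
  shows "\<bar>F_cutoff x\<bar> \<le> \<bar>cut_const\<bar> * exp (- x)"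
proof -
  have "(LINT y:{x<..}|lborel. cut_kernel y) \<le> (LINT y:{x<..}|lborel. exp (- (1 * y)))"
    by (rule set_integral_mono[OF cut_kernel_integrable[OF x] exp_tail(1)]) (use x cut_kernel_bounds in auto)
  moreover have "0 \<le> (LINT y:{x<..}|lborel. cut_kernel y)"
    unfolding set_lebesgue_integral_def
    by (rule Bochner_Integration.integral_nonneg) (use x cut_kernel_bounds in \<open>auto simp: indicator_def\<close>)
  ultimately show ?thesis
    unfolding F_cutoff_eq abs_mult using exp_tail(2)[of 1 x] by (intro mult_left_mono) auto
qed

lemma F_cutoff_deriv:
  assumes x: "x > 0"
  shows "(F_cutoff has_real_derivative - cut_const * cut_kernel x) (at x)"
proof -
  have split: "F_cutoff z = cut_const * ((LBINT y=ereal x..\<infinity>. cut_kernel y) - (LBINT y=ereal x..ereal z. cut_kernel y))"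
    if z: "z > 0" for z
  proof -
    have "interval_lebesgue_integrable lborel (min (ereal z) (min (ereal x) \<infinity>)) (max (ereal z) (max (ereal x) \<infinity>)) cut_kernel"
    proof -
      have 1: "(min (ereal z) (min (ereal x) \<infinity>)) = ereal (min z x)" by (simp add: min_def)
      have 2: "(max (ereal z) (max (ereal x) \<infinity>)) = \<infinity>" by (simp add: max_def)
      show ?thesis unfolding 1 2 interval_integrable_to_infinity_eq
        by (rule cut_kernel_integrable) (use x z in simp)
    qed
    from interval_integral_sum[OF this]
    have "(LBINT y=ereal z..\<infinity>. cut_kernel y) = (LBINT y=ereal z..ereal x. cut_kernel y) + (LBINT y=ereal x..\<infinity>. cut_kernel y)" by simp
    moreover have "(LBINT y=ereal z..ereal x. cut_kernel y) = - (LBINT y=ereal x..ereal z. cut_kernel y)"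
      by (rule interval_integral_endpoints_reverse)
    ultimately show ?thesis by (simp add: F_cutoff_eq interval_integral_to_infinity_eq)
  qed
  have "((\<lambda>u. LBINT y=ereal x..ereal u. cut_kernel y) has_vector_derivative cut_kernel x) (at x within {x/2..x+1})"
    using x by (intro interval_integral_FTC2) (auto intro!: continuous_intros simp: cut_kernel_def[abs_def])
  moreover have "at x within {x/2..x+1} = at x" using x by (intro at_within_interior) auto
  ultimately have "((\<lambda>u. LBINT y=ereal x..ereal u. cut_kernel y) has_real_derivative cut_kernel x) (at x)"
    by (simp add: has_real_derivative_iff_has_vector_derivative)
  then have "((\<lambda>z. cut_const * ((LBINT y=ereal x..\<infinity>. cut_kernel y) - (LBINT y=ereal x..ereal z. cut_kernel y))) has_real_derivative
      cut_const * (0 - cut_kernel x)) (at x)"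
    by (intro DERIV_cmult DERIV_diff DERIV_const)
  then have "((\<lambda>z. cut_const * ((LBINT y=ereal x..\<infinity>. cut_kernel y) - (LBINT y=ereal x..ereal z. cut_kernel y))) has_real_derivative
      - cut_const * cut_kernel x) (at x)" by simp
  then show ?thesis
    by (rule has_field_derivative_transform_within_open[of _ _ _ "{0<..}"]) (use x split in auto)
qed

section \<open>Decay of the Mellin transform on the line Re u = 1\<close>

lemma norm_of_real_powr_imaginary: "x > 0 \<Longrightarrow> norm (complex_of_real x powr (\<i> * of_real v)) = 1"
  by (simp add: norm_powr_real_powr)

text \<open>On the line Re u = 1 the kernel x^(u - 1) is x^(i v), with antiderivative x^(1 + i v) /
  (1 + i v). The boundary terms have absolute value |x \<phi>(x)| up to that constant and vanish at
  0 by boundedness of \<phi>, at infinity by hypothesis.\<close>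

lemma mellin_by_parts:
  fixes \<phi> \<phi>' :: "real \<Rightarrow> real" and v B :: real
  assumes d: "\<And>x. x > 0 \<Longrightarrow> (\<phi> has_real_derivative \<phi>' x) (at x)"
    and c: "\<And>x. x > 0 \<Longrightarrow> isCont \<phi>' x"
    and i1: "set_integrable lborel {0<..} \<phi>" and i2: "set_integrable lborel {0<..} (\<lambda>x. x * \<phi>' x)"
    and b: "\<And>x. x > 0 \<Longrightarrow> \<bar>\<phi> x\<bar> \<le> B" and l: "((\<lambda>x. x * \<phi> x) \<longlongrightarrow> 0) at_top"
  shows "(1 + \<i> * of_real v) * (LINT x:{0<..}|lborel. of_real (\<phi> x) * of_real x powr (\<i> * of_real v))
     = - (LINT x:{0<..}|lborel. of_real (x * \<phi>' x) * of_real x powr (\<i> * of_real v))"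
proof -
  define \<kappa> where "\<kappa> = 1 + \<i> * complex_of_real v"
  define ch where "ch x = complex_of_real x powr (\<i> * of_real v)" for x
  have nch: "norm (ch x) = 1" if "x > 0" for x unfolding ch_def by (rule norm_of_real_powr_imaginary[OF that])
  have mch: "(\<lambda>x. indicator {0<..} x *\<^sub>R ch x) \<in> borel_measurable borel"
  proof -
    have "continuous_on {0<..} ch" unfolding ch_def
      by (intro continuous_intros) (auto simp: complex_nonpos_Reals_iff)
    then show ?thesis by (intro borel_measurable_continuous_on_indicator) auto
  qed
  have int: "set_integrable lborel {0<..} (\<lambda>x. of_real (g x) * ch x)" if g: "set_integrable lborel {0<..} g" for g :: "real \<Rightarrow> real"
  proof (rule set_integrable_bound[OF g])
    have "(\<lambda>x. indicator {0<..} x *\<^sub>R g x) \<in> borel_measurable lborel"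
      using g unfolding set_integrable_def by (rule borel_measurable_integrable)
    moreover have "complex_of_real \<in> borel_measurable borel"
      by (intro borel_measurable_continuous_onI continuous_intros)
    ultimately have "(\<lambda>x. complex_of_real (indicator {0<..} x *\<^sub>R g x)) \<in> borel_measurable lborel"
      by (rule measurable_compose)
    moreover have "(\<lambda>x. indicator {0<..} x *\<^sub>R ch x) \<in> borel_measurable lborel" using mch by simp
    ultimately have "(\<lambda>x. complex_of_real (indicator {0<..} x *\<^sub>R g x) * (indicator {0<..} x *\<^sub>R ch x)) \<in> borel_measurable lborel"
      by (rule borel_measurable_times)
    also have "(\<lambda>x. complex_of_real (indicator {0<..} x *\<^sub>R g x) * (indicator {0<..} x *\<^sub>R ch x)) = (\<lambda>x. indicator {0<..} x *\<^sub>R (of_real (g x) * ch x))"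
      by (auto simp: fun_eq_iff indicator_def)
    finally show "set_borel_measurable lborel {0<..} (\<lambda>x. of_real (g x) * ch x)" by (simp add: set_borel_measurable_def)
    show "AE x in lborel. x \<in> {0<..} \<longrightarrow> norm (of_real (g x) * ch x) \<le> norm (g x)"
      by (intro AE_I2) (auto simp: norm_mult nch)
  qed
  define \<Psi> where "\<Psi> x = of_real (\<phi> x) * (complex_of_real x powr \<kappa>)" for x
  have pk: "complex_of_real x powr \<kappa> = of_real x * ch x" if "x > 0" for x
    using that by (simp add: \<kappa>_def ch_def powr_add)
  define D where "D x = of_real (\<phi> x) * (\<kappa> * ch x) + of_real (\<phi>' x) * (of_real x * ch x)" for x
  have dP: "(\<Psi> has_vector_derivative D x) (at x)" if x: "x > 0" for x
  proof -
    have "((\<lambda>z. z powr \<kappa>) has_field_derivative \<kappa> * complex_of_real x powr (\<kappa> - 1)) (at (of_real x))"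
      using x by (intro has_field_derivative_powr) (auto simp: complex_nonpos_Reals_iff)
    then have "((\<lambda>y. complex_of_real y powr \<kappa>) has_vector_derivative \<kappa> * complex_of_real x powr (\<kappa> - 1)) (at x)"
      by (rule has_vector_derivative_real_field)
    moreover have "complex_of_real x powr (\<kappa> - 1) = ch x" by (simp add: \<kappa>_def ch_def)
    ultimately have "((\<lambda>y. complex_of_real y powr \<kappa>) has_vector_derivative \<kappa> * ch x) (at x)" by simp
    then have "(\<Psi> has_vector_derivative of_real (\<phi> x) * (\<kappa> * ch x) + of_real (\<phi>' x) * (complex_of_real x powr \<kappa>)) (at x)"
      unfolding \<Psi>_def by (intro has_vector_derivative_mult has_vector_derivative_of_real d x)
    then show ?thesis by (simp add: D_def pk[OF x])
  qed
  have cD: "isCont D x" if x: "x > 0" for x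
  proof -
    have "isCont \<phi> x" using d[OF x] by (rule DERIV_isCont)
    moreover have "isCont ch x" unfolding ch_def using x by (intro continuous_intros) (auto simp: complex_nonpos_Reals_iff)
    ultimately show ?thesis unfolding D_def using c[OF x] by (intro continuous_intros) auto
  qed
  have eqD: "D = (\<lambda>x. \<kappa> * (of_real (\<phi> x) * ch x) + of_real (x * \<phi>' x) * ch x)" by (simp add: D_def fun_eq_iff)
  have iD: "set_integrable lborel {0<..} D"
    unfolding eqD by (intro set_integral_add(1) set_integrable_mult_right int i1 i2)
  have nP: "norm (\<Psi> x) = \<bar>x * \<phi> x\<bar>" if "x > 0" for x
    using that nch[OF that] by (simp add: \<Psi>_def pk norm_mult abs_mult)
  have A: "((\<Psi> \<circ> real_of_ereal) \<longlongrightarrow> 0) (at_right (ereal 0))"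
    unfolding ereal_tendsto_simps1
  proof (rule Lim_null_comparison)
    show "\<forall>\<^sub>F x in at_right 0. norm (\<Psi> x) \<le> x * B"
      unfolding eventually_at_right_field
    proof (intro exI[of _ 1] conjI allI impI)
      fix x :: real assume "0 < x" "x < 1"
      then show "norm (\<Psi> x) \<le> x * B" using nP[of x] b[of x] by (simp add: abs_mult)
    qed simp
    show "((\<lambda>x. x * B) \<longlongrightarrow> 0) (at_right 0)" by (auto intro!: tendsto_eq_intros)
  qed
  have B: "((\<Psi> \<circ> real_of_ereal) \<longlongrightarrow> 0) (at_left \<infinity>)"
    unfolding ereal_tendsto_simps1
  proof (rule Lim_null_comparison)
    show "\<forall>\<^sub>F x in at_top. norm (\<Psi> x) \<le> \<bar>x * \<phi> x\<bar>"
      using eventually_gt_at_top[of 0] by eventually_elim (simp add: nP)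
    show "((\<lambda>x. \<bar>x * \<phi> x\<bar>) \<longlongrightarrow> 0) at_top" using l by (simp add: tendsto_rabs_zero_iff)
  qed
  have "(LBINT x=ereal 0..\<infinity>. D x) = 0 - 0"
  proof (rule interval_integral_FTC_integrable[OF _ dP cD _ A B])
    have "einterval (ereal 0) \<infinity> = {0<..}" by (auto simp: einterval_def)
    then show "set_integrable lborel (einterval (ereal 0) \<infinity>) D" using iD by (simp only:)
  qed auto
  then have "(LINT x:{0<..}|lborel. D x) = 0" by (simp add: interval_integral_to_infinity_eq)
  moreover have "(LINT x:{0<..}|lborel. D x) = \<kappa> * (LINT x:{0<..}|lborel. of_real (\<phi> x) * ch x) + (LINT x:{0<..}|lborel. of_real (x * \<phi>' x) * ch x)"
    unfolding eqD set_integral_add(2)[OF set_integrable_mult_right[OF int[OF i1], of \<kappa>] int[OF i2]]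
    by (simp only: set_integral_mult_right)
  ultimately show ?thesis by (simp add: \<kappa>_def ch_def eq_neg_iff_add_eq_0)
qed

text \<open>A family whose span is closed under x d/dx: this operator exchanges x - 1/x and x + 1/x
  and multiplies the exponential by -(x - 1/x). For \<open>F_cutoff\<close> in place of F, -x F'(x)
  is \<open>cut_const * mk 0 0 x\<close>.\<close>

definition mk :: "nat \<Rightarrow> nat \<Rightarrow> real \<Rightarrow> real" where
  "mk a b x = (x - 1 / x) ^ a * (x + 1 / x) ^ b * exp (- (x + 1 / x))"

text \<open>The derivative of \<open>mk a b\<close>. For a = 0 or b = 0 the truncated subtraction is
  harmless because the term then carries the factor 0.\<close>

definition mkd :: "nat \<Rightarrow> nat \<Rightarrow> real \<Rightarrow> real" where
  "mkd a b x = (real a * mk (a - 1) (Suc b) x + real b * mk (Suc a) (b - 1) x - mk (Suc a) b x) / x"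

lemma mk_deriv:
  assumes x: "x > 0"
  shows "(mk a b has_real_derivative mkd a b x) (at x)"
proof -
  define p where "p = x + 1 / x"
  define r where "r = x - 1 / x"
  define e where "e = exp (- p)"
  have rx: "1 + 1 / x\<^sup>2 = p / x" using x by (simp add: p_def add_divide_distrib power2_eq_square)
  have px: "1 - 1 / x\<^sup>2 = r / x" using x by (simp add: r_def diff_divide_distrib power2_eq_square)
  have d1: "((\<lambda>x. 1 / x) has_real_derivative - (1 / x\<^sup>2)) (at x)"
    using x by (auto intro!: derivative_eq_intros simp: power2_eq_square)
  have dr: "((\<lambda>x. x - 1 / x) has_real_derivative p / x) (at x)"
    using DERIV_diff[OF DERIV_ident d1] rx by simp
  have dp: "((\<lambda>x. x + 1 / x) has_real_derivative r / x) (at x)"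
    using DERIV_add[OF DERIV_ident d1] px by simp
  have dE: "((\<lambda>x. exp (- (x + 1 / x))) has_real_derivative e * - (r / x)) (at x)"
    using DERIV_fun_exp[OF DERIV_minus[OF dp]] by (simp add: e_def p_def)
  have dR: "((\<lambda>x. (x - 1 / x) ^ a) has_real_derivative real a * (p / x * r ^ (a - Suc 0))) (at x)"
    using DERIV_power[OF dr, of a] by (simp add: r_def)
  have dP: "((\<lambda>x. (x + 1 / x) ^ b) has_real_derivative real b * (r / x * p ^ (b - Suc 0))) (at x)"
    using DERIV_power[OF dp, of b] by (simp add: p_def)
  have "((\<lambda>x. (x - 1 / x) ^ a * (x + 1 / x) ^ b * exp (- (x + 1 / x))) has_real_derivative
     (real a * (p / x * r ^ (a - Suc 0)) * p ^ b + real b * (r / x * p ^ (b - Suc 0)) * r ^ a) * e + e * - (r / x) * (r ^ a * p ^ b)) (at x)"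
    using DERIV_mult[OF DERIV_mult[OF dR dP] dE] by (simp add: r_def p_def e_def)
  also have "(real a * (p / x * r ^ (a - Suc 0)) * p ^ b + real b * (r / x * p ^ (b - Suc 0)) * r ^ a) * e + e * - (r / x) * (r ^ a * p ^ b) = mkd a b x"
    unfolding mkd_def mk_def p_def[symmetric] r_def[symmetric] e_def[symmetric]
    by (simp add: add_divide_distrib diff_divide_distrib algebra_simps)
  finally show ?thesis by (simp add: mk_def[abs_def])
qed

lemma power_exp_bound: "\<exists>C\<ge>0. \<forall>y\<ge>0. y ^ n * exp (- y) \<le> C * exp (- (y / 2 :: real))"
proof (cases "n = 0")
  case False
  have "y ^ n * exp (- y) \<le> (2 * real n) ^ n * exp (- (y / 2))" if y: "y \<ge> 0" for y
  proof -
    \<comment> \<open>The inequality z \<le> exp z at this z, raised to the n-th power, trades y^n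
      for half of the exponential decay.\<close>
    define z where "z = y / (2 * real n)"
    have yz: "y = 2 * real n * z" using False by (simp add: z_def)
    have "z \<le> exp z" using exp_ge_add_one_self[of z] by linarith
    then have "z ^ n \<le> exp z ^ n" using y by (intro power_mono) (auto simp: z_def)
    also have "\<dots> = exp (y / 2)" using False by (simp add: yz flip: exp_of_nat_mult)
    finally have "(2 * real n) ^ n * z ^ n * exp (- y) \<le> (2 * real n) ^ n * exp (y / 2) * exp (- y)"
      by (intro mult_right_mono mult_left_mono) auto
    also have "\<dots> = (2 * real n) ^ n * exp (- (y / 2))" by (simp add: mult.assoc flip: exp_add)
    finally show ?thesis by (simp add: yz power_mult_distrib)
  qed
  then show ?thesis by (intro exI[of _ "(2 * real n) ^ n"]) auto
qed (auto intro!: exI[of _ 1])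

lemma mk_bound: "\<exists>C\<ge>0. \<forall>x>0. \<bar>mk a b x\<bar> \<le> C * exp (- (1/2 * x)) \<and> \<bar>x * mk a b x\<bar> \<le> C * exp (- (1/2 * x))"
proof -
  obtain C1 :: real where C1: "C1 \<ge> 0" "\<And>y. y \<ge> 0 \<Longrightarrow> y ^ (a + b) * exp (- y) \<le> C1 * exp (- (y / 2))"
    using power_exp_bound[of "a + b"] by blast
  obtain C2 :: real where C2: "C2 \<ge> 0" "\<And>y. y \<ge> 0 \<Longrightarrow> y ^ Suc (a + b) * exp (- y) \<le> C2 * exp (- (y / 2))"
    using power_exp_bound[of "Suc (a + b)"] by blast
  have "\<bar>mk a b x\<bar> \<le> (C1 + C2) * exp (- (1/2 * x)) \<and> \<bar>x * mk a b x\<bar> \<le> (C1 + C2) * exp (- (1/2 * x))" if x: "x > 0" for x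
  proof -
    define p where "p = x + 1 / x"
    have p: "p \<ge> x" "p \<ge> 0" using x by (auto simp: p_def)
    have r: "\<bar>x - 1 / x\<bar> \<le> p" unfolding p_def using x by (auto simp: abs_le_iff)
    have m: "\<bar>mk a b x\<bar> \<le> p ^ (a + b) * exp (- p)"
      unfolding mk_def p_def[symmetric] abs_mult power_abs power_add using r p
      by (intro mult_mono power_mono) auto
    have e: "exp (- (p / 2)) \<le> exp (- (1/2 * x))" using p by simp
    have "\<bar>mk a b x\<bar> \<le> C1 * exp (- (1/2 * x))"
      using m C1(2)[OF p(2)] mult_left_mono[OF e C1(1)] by linarith
    also have "\<dots> \<le> (C1 + C2) * exp (- (1/2 * x))" using C2(1) by (intro mult_right_mono) auto
    finally have 1: "\<bar>mk a b x\<bar> \<le> (C1 + C2) * exp (- (1/2 * x))" .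
    have "\<bar>x * mk a b x\<bar> \<le> p * (p ^ (a + b) * exp (- p))"
      unfolding abs_mult using m p x by (intro mult_mono) auto
    also have "\<dots> \<le> C2 * exp (- (p / 2))" using C2(2)[OF p(2)] by (simp add: mult.assoc)
    also have "\<dots> \<le> C2 * exp (- (1/2 * x))" using e C2(1) by (rule mult_left_mono)
    also have "\<dots> \<le> (C1 + C2) * exp (- (1/2 * x))" using C1(1) by (intro mult_right_mono) auto
    finally show ?thesis using 1 by blast
  qed
  then show ?thesis using C1(1) C2(1) by (intro exI[of _ "C1 + C2"]) auto
qed

lemma mk_measurable [measurable]: "mk a b \<in> borel_measurable borel"
  unfolding mk_def[abs_def] by measurable

lemma mk_integrable: "set_integrable lborel {0<..} (mk a b)"
proof -
  obtain C where C: "C \<ge> 0" "\<And>x. x > 0 \<Longrightarrow> \<bar>mk a b x\<bar> \<le> C * exp (- (1/2 * x))"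
    using mk_bound[of a b] by blast
  have "set_integrable lborel {0<..} (\<lambda>x. C * exp (- (1/2 * x)))"
    by (intro set_integrable_mult_right exp_tail) auto
  then show ?thesis
    by (rule set_integrable_bound) (use C in \<open>auto simp: set_borel_measurable_def abs_mult\<close>)
qed

lemma exp_half_tendsto_0: "((\<lambda>x. C * exp (- (1/2 * x))) \<longlongrightarrow> 0) (at_top :: real filter)"
proof -
  have "filterlim (\<lambda>y::real. 1/2 * y) at_top at_top"
    by (rule filterlim_tendsto_pos_mult_at_top[OF tendsto_const _ filterlim_ident]) simp
  then have "filterlim (\<lambda>y::real. - (1/2 * y)) at_bot at_top" by (simp add: filterlim_uminus_at_bot)
  then have "((\<lambda>y::real. exp (- (1/2 * y))) \<longlongrightarrow> 0) at_top" by (rule filterlim_compose[OF exp_at_bot])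
  from tendsto_mult_left[OF this, of C] show ?thesis by simp
qed

definition mk_mellin :: "nat \<Rightarrow> nat \<Rightarrow> real \<Rightarrow> complex" where
  "mk_mellin a b v = (LINT x:{0<..}|lborel. of_real (mk a b x) * of_real x powr (\<i> * of_real v))"

lemma set_integrable_mk_powr:
  "set_integrable lborel {0<..} (\<lambda>x. complex_of_real (mk a b x) * of_real x powr (\<i> * of_real v))"
proof (rule set_integrable_bound[OF mk_integrable[of a b]])
  have "continuous_on {0<..} (\<lambda>x. complex_of_real (mk a b x) * of_real x powr (\<i> * of_real v))"
    unfolding mk_def by (intro continuous_intros) (auto simp: complex_nonpos_Reals_iff)
  then show "set_borel_measurable lborel {0<..} (\<lambda>x. complex_of_real (mk a b x) * of_real x powr (\<i> * of_real v))"
    unfolding set_borel_measurable_def by (simp add: borel_measurable_continuous_on_indicator)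
  show "AE x in lborel. x \<in> {0<..} \<longrightarrow> norm (complex_of_real (mk a b x) * of_real x powr (\<i> * of_real v)) \<le> norm (mk a b x)"
    by (intro AE_I2) (auto simp: norm_mult norm_of_real_powr_imaginary)
qed

lemma mk_mellin_recurrence:
  "(1 + \<i> * of_real v) * mk_mellin a b v
     = - (of_nat a * mk_mellin (a - 1) (Suc b) v + of_nat b * mk_mellin (Suc a) (b - 1) v - mk_mellin (Suc a) b v)"
proof -
  obtain C where C: "C \<ge> 0" "\<And>x. x > 0 \<Longrightarrow> \<bar>mk a b x\<bar> \<le> C * exp (- (1/2 * x))"
      "\<And>x. x > 0 \<Longrightarrow> \<bar>x * mk a b x\<bar> \<le> C * exp (- (1/2 * x))"
    using mk_bound[of a b] by blast
  define g where "g x = real a * mk (a - 1) (Suc b) x + real b * mk (Suc a) (b - 1) x - mk (Suc a) b x" for x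
  have xg: "x * mkd a b x = g x" if "x > 0" for x using that by (simp add: mkd_def g_def)
  have ig: "set_integrable lborel {0<..} g"
    unfolding g_def by (intro set_integral_add(1) set_integral_diff(1) set_integrable_mult_right mk_integrable)
  have "(1 + \<i> * of_real v) * mk_mellin a b v = - (LINT x:{0<..}|lborel. of_real (x * mkd a b x) * of_real x powr (\<i> * of_real v))"
    unfolding mk_mellin_def
  proof (rule mellin_by_parts)
    show "(mk a b has_real_derivative mkd a b x) (at x)" if "x > 0" for x using mk_deriv that by blast
    show "isCont (mkd a b) x" if "x > 0" for x
      unfolding mkd_def mk_def using that by (intro continuous_intros) auto
    show "set_integrable lborel {0<..} (mk a b)" by (rule mk_integrable)
    have "set_integrable lborel {0<..} (\<lambda>x. x * mkd a b x) \<longleftrightarrow> set_integrable lborel {0<..} g"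
      by (rule set_integrable_cong) (auto simp: xg)
    then show "set_integrable lborel {0<..} (\<lambda>x. x * mkd a b x)" using ig by simp
    show "\<bar>mk a b x\<bar> \<le> C" if x: "x > 0" for x
    proof -
      have "C * exp (- (1/2 * x)) \<le> C * 1" using C(1) x by (intro mult_left_mono) auto
      then show ?thesis using C(2)[OF x] by linarith
    qed
    show "((\<lambda>x. x * mk a b x) \<longlongrightarrow> 0) at_top"
    proof (rule Lim_null_comparison[OF _ exp_half_tendsto_0])
      show "\<forall>\<^sub>F x in at_top. norm (x * mk a b x) \<le> C * exp (- (1/2 * x))"
        using eventually_gt_at_top[of 0]
      proof eventually_elim
        case (elim x)
        then show ?case unfolding real_norm_def by (rule C(3))
      qed
    qed
  qed
  also have "(LINT x:{0<..}|lborel. of_real (x * mkd a b x) * of_real x powr (\<i> * of_real v))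
      = (LINT x:{0<..}|lborel. of_nat a * (of_real (mk (a - 1) (Suc b) x) * of_real x powr (\<i> * of_real v))
          + of_nat b * (of_real (mk (Suc a) (b - 1) x) * of_real x powr (\<i> * of_real v))
          - of_real (mk (Suc a) b x) * of_real x powr (\<i> * of_real v))"
    by (rule set_lebesgue_integral_cong) (auto simp: xg g_def algebra_simps)
  also have "\<dots> = of_nat a * mk_mellin (a - 1) (Suc b) v + of_nat b * mk_mellin (Suc a) (b - 1) v - mk_mellin (Suc a) b v"
    unfolding mk_mellin_def
    by (subst set_integral_diff(2), (intro set_integral_add(1) set_integrable_mult_right set_integrable_mk_powr)+,
        subst set_integral_add(2), (intro set_integrable_mult_right set_integrable_mk_powr)+, simp)
  finally show ?thesis .
qed

text \<open>Each use of the recurrence gains one factor 1 + i v and stays inside the family, so the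
  induction runs over all \<open>a\<close> and \<open>b\<close> at once.\<close>

lemma mk_mellin_decay: "\<exists>C\<ge>0. \<forall>v. norm (mk_mellin a b v) * norm (1 + \<i> * of_real v) ^ m \<le> C"
proof (induction m arbitrary: a b)
  case 0
  have "norm (mk_mellin a b v) \<le> (LINT x:{0<..}|lborel. \<bar>mk a b x\<bar>)" for v
  proof -
    have "norm (mk_mellin a b v) \<le> (LINT x:{0<..}|lborel. norm (complex_of_real (mk a b x) * of_real x powr (\<i> * of_real v)))"
      unfolding mk_mellin_def by (rule set_integral_norm_bound[OF set_integrable_mk_powr])
    also have "\<dots> = (LINT x:{0<..}|lborel. \<bar>mk a b x\<bar>)"
      by (rule set_lebesgue_integral_cong) (auto simp: norm_mult norm_of_real_powr_imaginary)
    finally show ?thesis .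
  qed
  moreover have "0 \<le> (LINT x:{0<..}|lborel. \<bar>mk a b x\<bar>)"
    unfolding set_lebesgue_integral_def by (rule Bochner_Integration.integral_nonneg) auto
  ultimately show ?case by auto
next
  case (Suc m)
  obtain C1 where C1: "C1 \<ge> 0" "\<And>v. norm (mk_mellin (a - 1) (Suc b) v) * norm (1 + \<i> * of_real v) ^ m \<le> C1" using Suc by blast
  obtain C2 where C2: "C2 \<ge> 0" "\<And>v. norm (mk_mellin (Suc a) (b - 1) v) * norm (1 + \<i> * of_real v) ^ m \<le> C2" using Suc by blast
  obtain C3 where C3: "C3 \<ge> 0" "\<And>v. norm (mk_mellin (Suc a) b v) * norm (1 + \<i> * of_real v) ^ m \<le> C3" using Suc by blast
  have "norm (mk_mellin a b v) * norm (1 + \<i> * of_real v) ^ Suc m \<le> real a * C1 + real b * C2 + C3" for v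
  proof -
    define N where "N = norm (1 + \<i> * of_real v) ^ m"
    have N0: "N \<ge> 0" by (simp add: N_def)
    have "norm (mk_mellin a b v) * norm (1 + \<i> * of_real v) ^ Suc m = norm ((1 + \<i> * of_real v) * mk_mellin a b v) * N"
      by (simp add: N_def norm_mult)
    also have "\<dots> \<le> (real a * norm (mk_mellin (a - 1) (Suc b) v) + real b * norm (mk_mellin (Suc a) (b - 1) v) + norm (mk_mellin (Suc a) b v)) * N"
      unfolding mk_mellin_recurrence norm_minus_cancel using N0
      by (intro mult_right_mono order_trans[OF norm_triangle_ineq4] add_mono order_trans[OF norm_triangle_ineq]) (auto simp: norm_mult)
    also have "\<dots> = real a * (norm (mk_mellin (a - 1) (Suc b) v) * N) + real b * (norm (mk_mellin (Suc a) (b - 1) v) * N) + norm (mk_mellin (Suc a) b v) * N"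
      by (simp add: algebra_simps)
    also have "\<dots> \<le> real a * C1 + real b * C2 + C3"
      using C1(2)[of v] C2(2)[of v] C3(2)[of v] by (intro add_mono mult_left_mono) (auto simp: N_def)
    finally show ?thesis .
  qed
  then show ?case using C1(1) C2(1) C3(1) by (intro exI[of _ "real a * C1 + real b * C2 + C3"]) auto
qed

text \<open>One integration by parts replaces \<open>F_cutoff\<close>, itself defined by an
  integral, with the elementary function \<open>mk 0 0\<close>, and gains the first factor 1 + i
  v.\<close>

lemma F_mellin_eq: "(1 + \<i> * of_real v) * F_mellin (Complex 1 v) = of_real cut_const * mk_mellin 0 0 v"
proof -
  have u: "Complex 1 v - 1 = \<i> * of_real v" by (simp add: complex_eq_iff)
  have mkE: "x * (- cut_const * cut_kernel x) = - cut_const * mk 0 0 x" if "x > 0" for x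
    using that by (simp add: cut_kernel_def mk_def algebra_simps)
  have iF: "set_integrable lborel {0<..} F_cutoff"
  proof (rule set_integrable_bound)
    show "set_integrable lborel {0<..} (\<lambda>x. \<bar>cut_const\<bar> * exp (- (1 * x)))"
      by (intro set_integrable_mult_right exp_tail) auto
    have "continuous_on {0<..} F_cutoff"
      by (rule DERIV_continuous_on[of _ _ "\<lambda>x. - cut_const * cut_kernel x"]) (rule has_field_derivative_at_within[OF F_cutoff_deriv], simp)
    then have "(\<lambda>x. indicator {0<..} x *\<^sub>R F_cutoff x) \<in> borel_measurable borel"
      by (intro borel_measurable_continuous_on_indicator) auto
    then show "set_borel_measurable lborel {0<..} F_cutoff"
      unfolding set_borel_measurable_def by simp
    show "AE x in lborel. x \<in> {0<..} \<longrightarrow> norm (F_cutoff x) \<le> norm (\<bar>cut_const\<bar> * exp (- (1 * x)))"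
      using abs_F_cutoff_le by (intro AE_I2) (auto simp: abs_mult)
  qed
  have "(1 + \<i> * of_real v) * F_mellin (Complex 1 v) = - (LINT x:{0<..}|lborel. of_real (x * (- cut_const * cut_kernel x)) * of_real x powr (\<i> * of_real v))"
    unfolding F_mellin_def u
  proof (rule mellin_by_parts)
    show "(F_cutoff has_real_derivative - cut_const * cut_kernel x) (at x)" if "x > 0" for x
      by (rule F_cutoff_deriv[OF that])
    show "isCont (\<lambda>x. - cut_const * cut_kernel x) x" if "x > 0" for x
      unfolding cut_kernel_def using that by (intro continuous_intros) auto
    show "set_integrable lborel {0<..} F_cutoff" by (rule iF)
    have "set_integrable lborel {0<..} (\<lambda>x. x * (- cut_const * cut_kernel x)) \<longleftrightarrow> set_integrable lborel {0<..} (\<lambda>x. - cut_const * mk 0 0 x)"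
      by (rule set_integrable_cong) (use mkE in auto)
    then show "set_integrable lborel {0<..} (\<lambda>x. x * (- cut_const * cut_kernel x))"
      using set_integrable_mult_right[OF mk_integrable[of 0 0], of "- cut_const"] by simp
    show "\<bar>F_cutoff x\<bar> \<le> \<bar>cut_const\<bar>" if x: "x > 0" for x
    proof -
      have "\<bar>cut_const\<bar> * exp (- x) \<le> \<bar>cut_const\<bar> * 1" using x by (intro mult_left_mono) auto
      then show ?thesis using abs_F_cutoff_le[of x] x by simp
    qed
    show "((\<lambda>x. x * F_cutoff x) \<longlongrightarrow> 0) at_top"
    proof (rule Lim_null_comparison[OF _ exp_half_tendsto_0[of "2 * \<bar>cut_const\<bar>"]])
      show "\<forall>\<^sub>F x in at_top. norm (x * F_cutoff x) \<le> 2 * \<bar>cut_const\<bar> * exp (- (1/2 * x))"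
        using eventually_gt_at_top[of 0]
      proof eventually_elim
        case (elim x)
        have "x / 2 \<le> exp (x / 2)" using exp_ge_add_one_self[of "x / 2"] by linarith
        then have "x \<le> 2 * exp (x / 2)" by linarith
        then have "x * (\<bar>cut_const\<bar> * exp (- x)) \<le> 2 * exp (x / 2) * (\<bar>cut_const\<bar> * exp (- x))"
          by (intro mult_right_mono) auto
        also have "\<dots> = 2 * \<bar>cut_const\<bar> * (exp (x / 2) * exp (- x))" by simp
        also have "exp (x / 2) * exp (- x) = exp (- (1/2 * x))" by (simp flip: exp_add)
        finally have f1: "x * (\<bar>cut_const\<bar> * exp (- x)) \<le> 2 * \<bar>cut_const\<bar> * exp (- (1/2 * x))" .
        have f2: "x * \<bar>F_cutoff x\<bar> \<le> x * (\<bar>cut_const\<bar> * exp (- x))"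
          using abs_F_cutoff_le[of x] elim by (intro mult_left_mono) auto
        have "norm (x * F_cutoff x) = x * \<bar>F_cutoff x\<bar>" using elim by (simp add: abs_mult)
        then show ?case using order_trans[OF f2 f1] by (simp only:)
      qed
    qed
  qed
  also have "(LINT x:{0<..}|lborel. of_real (x * (- cut_const * cut_kernel x)) * of_real x powr (\<i> * of_real v))
      = (LINT x:{0<..}|lborel. of_real (- cut_const) * (of_real (mk 0 0 x) * of_real x powr (\<i> * of_real v)))"
    by (rule set_lebesgue_integral_cong) (use mkE in \<open>auto simp flip: of_real_mult of_real_minus simp: mult.assoc[symmetric]\<close>)
  also have "\<dots> = of_real (- cut_const) * mk_mellin 0 0 v"
    by (simp only: mk_mellin_def set_integral_mult_right)
  finally show ?thesis by simp
qed

text \<open>The exponent 5 pays for one power of v from the Gamma quotient, two from the oscillatory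
  bound and two for absolute convergence.\<close>

lemma F_mellin_decay: "\<exists>C\<ge>0. \<forall>v. norm (F_mellin (Complex 1 v)) * norm (1 + \<i> * of_real v) ^ 5 \<le> C"
proof -
  obtain C where C: "C \<ge> 0" "\<And>v. norm (mk_mellin 0 0 v) * norm (1 + \<i> * of_real v) ^ 4 \<le> C"
    using mk_mellin_decay[of 0 0 4] by blast
  have "norm (F_mellin (Complex 1 v)) * norm (1 + \<i> * of_real v) ^ 5 \<le> \<bar>cut_const\<bar> * C" for v
  proof -
    have "norm (F_mellin (Complex 1 v)) * norm (1 + \<i> * of_real v) ^ 5
        = norm ((1 + \<i> * of_real v) * F_mellin (Complex 1 v)) * norm (1 + \<i> * of_real v) ^ 4"
      unfolding norm_mult by (simp add: eval_nat_numeral)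
    also have "\<dots> = \<bar>cut_const\<bar> * (norm (mk_mellin 0 0 v) * norm (1 + \<i> * of_real v) ^ 4)"
      unfolding F_mellin_eq by (simp add: norm_mult)
    also have "\<dots> \<le> \<bar>cut_const\<bar> * C" using C(2)[of v] by (intro mult_left_mono) auto
    finally show ?thesis .
  qed
  then show ?thesis using C(1) by (intro exI[of _ "\<bar>cut_const\<bar> * C"]) auto
qed

section \<open>The Gamma quotient on the line Re u = 1\<close>

lemma cosh_of_real: "cosh (complex_of_real t) = of_real (cosh t)"
  by (simp add: cosh_field_def flip: exp_of_real)

lemma sinh_of_real: "sinh (complex_of_real t) = of_real (sinh t)"
  by (simp add: sinh_field_def flip: exp_of_real)

text \<open>The reflection formula gives both absolute values exactly, so no asymptotics of Gamma
  are involved: the squares are pi y / sinh (pi y) and pi / cosh (pi y), and the square of the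
  quotient is y coth (pi y).\<close>

lemma norm_Gamma_quotient_le:
  "norm (Gamma (1 + \<i> * of_real y) / Gamma (1/2 - \<i> * of_real y)) \<le> 1 + \<bar>y\<bar>"
proof (cases "y = 0")
  \<comment> \<open>At y = 0 the relation Gamma (1 + z) = z Gamma z, used in the other case, meets
    the pole of Gamma.\<close>
  case True
  have "1 \<le> sqrt pi" using pi_gt3 by simp
  then show ?thesis using True by (simp add: Gamma_one_half_complex norm_divide divide_le_eq)
next
  case False
  define c where "c = cosh (pi * y)"
  define s where "s = sinh (pi * y)"
  have cos_i: "sin (complex_of_real pi * (1/2 - \<i> * of_real y)) = of_real c"
  proof -
    have eq: "complex_of_real pi * (1/2 - \<i> * of_real y) = of_real (pi / 2) - \<i> * of_real (pi * y)" by (simp add: algebra_simps)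
    have s1: "sin (complex_of_real (pi / 2)) = 1" by (simp only: sin_of_real sin_pi_half of_real_1)
    have c1: "cos (complex_of_real (pi / 2)) = 0" by (simp only: cos_of_real cos_pi_half of_real_0)
    have "sin (complex_of_real pi * (1/2 - \<i> * of_real y)) = cosh (of_real (pi * y))"
      unfolding eq sin_diff s1 c1 by (simp add: cosh_conv_cos)
    then show ?thesis by (simp only: cosh_of_real c_def)
  qed
  have sin_i: "sin (complex_of_real pi * (\<i> * of_real y)) = \<i> * of_real s"
  proof -
    have "complex_of_real pi * (\<i> * of_real y) = \<i> * of_real (pi * y)" by simp
    then have "sin (complex_of_real pi * (\<i> * of_real y)) = sin (\<i> * of_real (pi * y))" by (simp only:)
    also have "\<dots> = \<i> * sinh (of_real (pi * y))" by (simp add: sinh_conv_sin)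
    finally show ?thesis by (simp only: sinh_of_real s_def)
  qed
  have s0: "s \<noteq> 0" using False by (simp add: s_def)
  have c0: "c > 0" by (simp add: c_def)
  have "Gamma (1/2 - \<i> * of_real y) * Gamma (1 - (1/2 - \<i> * of_real y)) = of_real pi / of_real c"
    unfolding Gamma_reflection_complex cos_i ..
  moreover have "1 - (1/2 - \<i> * of_real y) = cnj (1/2 - \<i> * complex_of_real y)" by (simp add: complex_eq_iff)
  ultimately have "Gamma (1/2 - \<i> * of_real y) * cnj (Gamma (1/2 - \<i> * of_real y)) = of_real (pi / c)"
    by (simp add: cnj_Gamma)
  then have G1: "norm (Gamma (1/2 - \<i> * of_real y)) ^ 2 = pi / c"
    by (metis complex_norm_square of_real_eq_iff)
  have "\<i> * of_real y \<noteq> 0" "\<i> * complex_of_real y \<notin> \<int>\<^sub>\<le>\<^sub>0" using False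
    by (auto simp: complex_eq_iff elim!: nonpos_Ints_cases)
  then have G: "Gamma (1 + \<i> * of_real y) = \<i> * of_real y * Gamma (\<i> * of_real y)"
    using Gamma_plus1[of "\<i> * of_real y"] by (simp add: add.commute)
  have "Gamma (1 + \<i> * of_real y) * Gamma (1 - \<i> * of_real y) = \<i> * of_real y * (Gamma (\<i> * of_real y) * Gamma (1 - \<i> * of_real y))"
    unfolding G by simp
  also have "\<dots> = \<i> * of_real y * (of_real pi / (\<i> * of_real s))" unfolding Gamma_reflection_complex sin_i ..
  also have "\<dots> = of_real (y * pi / s)" using s0 by simp
  finally have "Gamma (1 + \<i> * of_real y) * cnj (Gamma (1 + \<i> * of_real y)) = of_real (y * pi / s)"
    by (simp add: cnj_Gamma)
  then have G2: "norm (Gamma (1 + \<i> * of_real y)) ^ 2 = y * pi / s"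
    by (metis complex_norm_square of_real_eq_iff)
  \<comment> \<open>z coth z \<le> z + 1 is a form of 1 + 2 z \<le> exp (2 z).\<close>
  have main: "z * cosh z / sinh z \<le> z + 1" if "z > 0" for z :: real
  proof -
    have sh: "sinh z > 0" using that by simp
    have "exp (- z) * (1 + 2 * z) \<le> exp (- z) * exp (2 * z)"
      by (intro mult_left_mono exp_ge_add_one_self) auto
    also have "\<dots> = exp z" by (simp flip: exp_add)
    finally have "z * exp (- z) \<le> (exp z - exp (- z)) / 2" by (simp add: algebra_simps)
    then have "z * (cosh z - sinh z) \<le> sinh z" unfolding cosh_minus_sinh by (simp only: sinh_field_def)
    then have "z * cosh z \<le> (z + 1) * sinh z" by (simp add: algebra_simps)
    then show ?thesis using sh by (simp add: divide_le_eq)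
  qed
  have "norm (Gamma (1 + \<i> * of_real y) / Gamma (1/2 - \<i> * of_real y)) ^ 2 = (y * pi / s) / (pi / c)"
    unfolding norm_divide power_divide G1 G2 ..
  also have "\<dots> = y * c / s" by simp
  also have "\<dots> \<le> (1 + \<bar>y\<bar>) ^ 2"
  proof -
    define z where "z = pi * \<bar>y\<bar>"
    have z: "z > 0" using False by (simp add: z_def)
    have "z * cosh z / sinh z = pi * (y * c / s)"
    proof (cases "y > 0")
      case True then show ?thesis by (simp add: z_def c_def s_def)
    next
      case neg: False
      then have "z = - (pi * y)" by (simp add: z_def)
      then show ?thesis by (simp add: c_def s_def)
    qed
    then have "pi * (y * c / s) \<le> pi * \<bar>y\<bar> + 1" using main[OF z] by (simp add: z_def)
    also have "\<dots> \<le> pi * (\<bar>y\<bar> + 1)" using pi_gt3 by (simp add: distrib_left)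
    finally have "y * c / s \<le> \<bar>y\<bar> + 1" by (simp only: mult_le_cancel_left_pos[OF pi_gt_zero])
    also have "\<dots> \<le> (1 + \<bar>y\<bar>) * (1 + \<bar>y\<bar>)" by (simp add: algebra_simps)
    finally show ?thesis by (simp add: power2_eq_square)
  qed
  finally show ?thesis by (rule power2_le_imp_le) simp
qed

section \<open>The bound for the oscillatory integrals\<close>

text \<open>The integrands involve 1 / sqrt (1 - x^2) and are continuous only inside the interval.
  Measurability is taken from there, and the zero values at the endpoints make both indicator
  functions give the same product.\<close>

lemma bounded_interior_integrable:
  fixes h :: "real \<Rightarrow> complex"
  assumes c: "continuous_on {-1<..<1} h" and b: "\<And>x. \<bar>x\<bar> < 1 \<Longrightarrow> norm (h x) \<le> B"
    and z: "h 1 = 0" "h (-1) = 0"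
  shows "set_integrable lborel {-1..1} h"
proof (rule set_integrable_bound)
  show "set_integrable lborel {-1..1} (\<lambda>_::real. \<bar>B\<bar> :: real)"
    unfolding set_integrable_def real_scaleR_def
    by (intro integrable_mult_left integrable_real_indicator) auto
  have "(\<lambda>x. indicator {-1<..<1} x *\<^sub>R h x) \<in> borel_measurable borel"
    using c by (intro borel_measurable_continuous_on_indicator) auto
  moreover have "(\<lambda>x. indicator {-1<..<1} x *\<^sub>R h x) = (\<lambda>x. indicator {-1..1} x *\<^sub>R h x)"
  proof
    fix x :: real
    consider "x = 1" | "x = -1" | "x \<in> {-1<..<1}" | "x \<notin> {-1..1}" by fastforce
    then show "indicator {-1<..<1} x *\<^sub>R h x = indicator {-1..1} x *\<^sub>R h x"
      by cases (use z in \<open>auto simp: indicator_def\<close>)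
  qed
  ultimately show "set_borel_measurable lborel {-1..1} h" by (simp add: set_borel_measurable_def)
  have "norm (h x) \<le> \<bar>B\<bar>" if "x \<in> {-1..1}" for x
  proof (cases "\<bar>x\<bar> < 1")
    case True then show ?thesis using b[OF True] by linarith
  next
    case False
    then have "x = 1 \<or> x = -1" using that by auto
    then show ?thesis using z by auto
  qed
  then show "AE x in lborel. x \<in> {-1..1} \<longrightarrow> norm (h x) \<le> norm \<bar>B\<bar>" by (intro AE_I2) simp
qed

lemma theta_inf_boundary: "theta_inf k 1 = 0" "theta_inf k (-1) = 0"
  by (simp_all add: theta_inf_def)

lemma abs_theta_inf_le: "\<bar>x\<bar> \<le> 1 \<Longrightarrow> \<bar>theta_inf k x\<bar> \<le> 1"
proof -
  assume x: "\<bar>x\<bar> \<le> 1"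
  define z where "z = theta_c (k - 1) x"
  have "norm (complex_of_real (theta_inf k x)) = norm (\<i> / (2 * complex_of_real pi)) * norm (z - cnj z)"
    unfolding of_real_theta_inf_eq[OF x] z_def norm_mult ..
  also have "\<dots> \<le> 1/2 * (norm z + norm z)"
  proof (intro mult_mono)
    show "norm (\<i> / (2 * complex_of_real pi)) \<le> 1/2" using pi_gt3 by (simp add: norm_divide norm_mult divide_le_eq)
    show "norm (z - cnj z) \<le> norm z + norm z" using norm_triangle_ineq4[of z "cnj z"] by simp
  qed auto
  also have "\<dots> = 1" using norm_theta_c[OF x] by (simp add: z_def)
  finally show ?thesis by simp
qed

lemma continuous_on_theta_inf: "continuous_on {-1<..<1} (\<lambda>x. complex_of_real (theta_inf k x))"
proof -
  have "continuous_on {-1<..<1} (\<lambda>x. \<i> / (2 * of_real pi) * (theta_c (k - 1) x - cnj (theta_c (k - 1) x)))"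
    unfolding theta_c_def by (intro continuous_intros) auto
  then show ?thesis
    by (rule continuous_on_eq) (auto simp: of_real_theta_inf_eq abs_le_iff)
qed

text \<open>The oscillation estimate rests on the fundamental theorem for the gauge integral, while
  \<open>I_int\<close> is a Lebesgue integral; absolute integrability identifies the two.
  Integrability is stated as well because the two parts of \<open>I_int\<close> have to be separated
  later.\<close>

lemma theta_weighted_lebesgue_bound:
  fixes g g' g'' :: "real \<Rightarrow> complex" and G lam :: real
  assumes k: "k \<ge> 2" and G: "G \<ge> 0" and lam: "lam \<noteq> 0"
    and d1: "\<And>x. \<bar>x\<bar> < 1 \<Longrightarrow> (g has_vector_derivative g' x) (at x)"
    and d2: "\<And>x. \<bar>x\<bar> < 1 \<Longrightarrow> (g' has_vector_derivative g'' x) (at x)"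
    and b0: "\<And>x. \<bar>x\<bar> < 1 \<Longrightarrow> norm (g x) \<le> G"
    and b1: "\<And>x. \<bar>x\<bar> < 1 \<Longrightarrow> norm (g' x) \<le> G / (1 - x\<^sup>2)"
    and b2: "\<And>x. \<bar>x\<bar> < 1 \<Longrightarrow> norm (g'' x) \<le> G / (1 - x\<^sup>2)\<^sup>2"
  shows "set_integrable lborel {-1..1} (\<lambda>x. of_real (theta_inf k x) * g x * exp (\<i> * of_real (lam * x)))" (is ?I)
    and "norm (LINT x:{-1..1}|lborel. of_real (theta_inf k x) * g x * exp (\<i> * of_real (lam * x)))
      \<le> 36 * real k ^ 2 * G * \<bar>lam\<bar> powr (- 3/2)" (is ?B)
proof -
  have cg: "continuous_on {-1<..<1} g"
    by (intro continuous_at_imp_continuous_on ballI has_vector_derivative_continuous[OF d1]) auto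
  show int: ?I
  proof (rule bounded_interior_integrable[where B = G])
    show "continuous_on {-1<..<1} (\<lambda>x. of_real (theta_inf k x) * g x * exp (\<i> * of_real (lam * x)))"
      by (intro continuous_intros continuous_on_theta_inf cg)
    show "norm (of_real (theta_inf k x) * g x * exp (\<i> * of_real (lam * x))) \<le> G" if x: "\<bar>x\<bar> < 1" for x
    proof -
      have "norm (of_real (theta_inf k x) * g x * exp (\<i> * of_real (lam * x))) = \<bar>theta_inf k x\<bar> * norm (g x)"
        unfolding norm_mult norm_exp_i_times norm_of_real by simp
      also have "\<dots> \<le> 1 * G" using abs_theta_inf_le[of x k] b0[OF x] x by (intro mult_mono) auto
      finally show ?thesis by simp
    qed
  qed (simp_all add: theta_inf_boundary)
  note eq = set_borel_integral_eq_integral[OF int]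
  show ?B unfolding eq(2)
    by (rule theta_weighted_oscillatory_bound[OF k G lam eq(1) d1 d2 b0 b1 b2])
qed

text \<open>For t = T / sqrt (1 - x^2) the logarithmic derivative is x / (1 - x^2), independently of
  T. So a function with bounded derivatives in log t loses at most a multiple of 1 / (1 - x^2) per
  derivative, uniformly in T.\<close>

lemma log_ratio_deriv:
  fixes x T :: real
  assumes x: "\<bar>x\<bar> < 1" and T: "T > 0"
  shows "((\<lambda>x. T / sqrt (1 - x\<^sup>2)) has_real_derivative T / sqrt (1 - x\<^sup>2) * (x / (1 - x\<^sup>2))) (at x)"
    and "((\<lambda>x. x / (1 - x\<^sup>2)) has_real_derivative (1 + x\<^sup>2) / (1 - x\<^sup>2)\<^sup>2) (at x)"
proof -
  define r where "r = sqrt (1 - x\<^sup>2)"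
  have r0: "r > 0" and rr: "1 - x\<^sup>2 = r * r" using one_minus_square_pos[OF x] by (simp_all add: r_def)
  have "((\<lambda>x. T * (1 / sqrt (1 - x\<^sup>2))) has_real_derivative T * (x / r ^ 3)) (at x)"
    unfolding r_def by (intro DERIV_cmult inverse_sqrt_deriv[OF x])
  moreover have "T * (x / r ^ 3) = T / sqrt (1 - x\<^sup>2) * (x / (1 - x\<^sup>2))"
    unfolding r_def[symmetric] unfolding rr by (simp add: power3_eq_cube)
  moreover have "(\<lambda>x. T * (1 / sqrt (1 - x\<^sup>2))) = (\<lambda>x. T / sqrt (1 - x\<^sup>2))" by simp
  ultimately show "((\<lambda>x. T / sqrt (1 - x\<^sup>2)) has_real_derivative T / sqrt (1 - x\<^sup>2) * (x / (1 - x\<^sup>2))) (at x)"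
    by (simp only:)
  have "((\<lambda>x. 1 - x\<^sup>2) has_real_derivative - (2 * x)) (at x)" by (auto intro!: derivative_eq_intros)
  then have "((\<lambda>x. x / (1 - x\<^sup>2)) has_real_derivative (1 * (1 - x\<^sup>2) - x * - (2 * x)) / ((1 - x\<^sup>2) * (1 - x\<^sup>2))) (at x)"
    using one_minus_square_pos[OF x] by (intro DERIV_divide DERIV_ident) auto
  also have "1 * (1 - x\<^sup>2) - x * - (2 * x) = 1 + x\<^sup>2" by (simp add: power2_eq_square)
  finally show "((\<lambda>x. x / (1 - x\<^sup>2)) has_real_derivative (1 + x\<^sup>2) / (1 - x\<^sup>2)\<^sup>2) (at x)"
    by (simp only: power2_eq_square)
qed

lemma abs_ratio_le: "\<bar>x::real\<bar> < 1 \<Longrightarrow> \<bar>x / (1 - x\<^sup>2)\<bar> \<le> 1 / (1 - x\<^sup>2)"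
  using one_minus_square_pos[of x] by (simp add: divide_right_mono)

text \<open>G is chosen before T. This is possible because the first two derivatives of
  \<open>F_cutoff\<close> with respect to log t are, up to constants, the bounded functions
  \<open>mk 0 0\<close> and \<open>mk 1 0\<close>.\<close>

lemma F_cutoff_oscillatory_bound:
  "\<exists>G\<ge>0. \<forall>T>0. \<forall>k\<ge>2. \<forall>lam. lam \<noteq> 0 \<longrightarrow>
     set_integrable lborel {-1..1} (\<lambda>x. of_real (theta_inf k x) * of_real (F_cutoff (T / sqrt (1 - x\<^sup>2))) * exp (\<i> * of_real (lam * x))) \<and>
     norm (LINT x:{-1..1}|lborel. of_real (theta_inf k x) * of_real (F_cutoff (T / sqrt (1 - x\<^sup>2))) * exp (\<i> * of_real (lam * x)))
      \<le> 36 * real k ^ 2 * G * \<bar>lam\<bar> powr (- 3/2)"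
proof -
  obtain C0 where C0: "C0 \<ge> 0" "\<And>x. x > 0 \<Longrightarrow> \<bar>mk 0 0 x\<bar> \<le> C0 * exp (- (1/2 * x))" using mk_bound[of 0 0] by blast
  obtain C1 where C1: "C1 \<ge> 0" "\<And>x. x > 0 \<Longrightarrow> \<bar>mk 1 0 x\<bar> \<le> C1 * exp (- (1/2 * x))" using mk_bound[of 1 0] by blast
  have e1: "C * exp (- (1/2 * x)) \<le> C" if "C \<ge> 0" "x > 0" for C x :: real
    using mult_left_mono[of "exp (- (1/2 * x))" 1 C] that by simp
  have m0: "\<bar>mk 0 0 x\<bar> \<le> C0" if "x > 0" for x using C0(2)[OF that] e1[OF C0(1) that] by linarith
  have m1: "\<bar>mk 1 0 x\<bar> \<le> C1" if "x > 0" for x using C1(2)[OF that] e1[OF C1(1) that] by linarith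
  define c where "c = cut_const"
  define G where "G = \<bar>c\<bar> * (1 + 2 * C0 + C1)"
  have G0: "G \<ge> 0" using C0(1) C1(1) by (simp add: G_def)
  have "set_integrable lborel {-1..1} (\<lambda>x. of_real (theta_inf k x) * of_real (F_cutoff (T / sqrt (1 - x\<^sup>2))) * exp (\<i> * of_real (lam * x))) \<and>
     norm (LINT x:{-1..1}|lborel. of_real (theta_inf k x) * of_real (F_cutoff (T / sqrt (1 - x\<^sup>2))) * exp (\<i> * of_real (lam * x)))
      \<le> 36 * real k ^ 2 * G * \<bar>lam\<bar> powr (- 3/2)" if T: "T > 0" and k: "k \<ge> 2" and lam: "lam \<noteq> 0" for T k and lam :: real
  proof -
    define t where "t x = T / sqrt (1 - x\<^sup>2)" for x
    define q where "q x = x / (1 - x\<^sup>2)" for x :: real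
    define q' where "q' x = (1 + x\<^sup>2) / (1 - x\<^sup>2)\<^sup>2" for x :: real
    have tpos: "t x > 0" if "\<bar>x\<bar> < 1" for x using one_minus_square_pos[OF that] T by (simp add: t_def)
    have dt: "(t has_real_derivative t x * q x) (at x)" if "\<bar>x\<bar> < 1" for x
      unfolding t_def[abs_def] q_def by (rule log_ratio_deriv(1)[OF that T])
    have dq: "(q has_real_derivative q' x) (at x)" if "\<bar>x\<bar> < 1" for x
      unfolding q_def[abs_def] q'_def by (rule log_ratio_deriv(2)[OF that T])
    have d1: "((\<lambda>x. F_cutoff (t x)) has_real_derivative - c * (mk 0 0 (t x) * q x)) (at x)" if x: "\<bar>x\<bar> < 1" for x
    proof -
      have "((\<lambda>x. F_cutoff (t x)) has_real_derivative - cut_const * cut_kernel (t x) * (t x * q x)) (at x)"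
        by (rule DERIV_chain2[OF F_cutoff_deriv[OF tpos[OF x]] dt[OF x]])
      moreover have ck: "mk 0 0 (t x) = cut_kernel (t x) * t x"
        using tpos[OF x] by (simp add: cut_kernel_def mk_def)
      have "- cut_const * cut_kernel (t x) * (t x * q x) = - c * (mk 0 0 (t x) * q x)"
        by (simp only: c_def mult.assoc ck)
      ultimately show ?thesis by (simp only:)
    qed
    have d2: "((\<lambda>x. - c * (mk 0 0 (t x) * q x)) has_real_derivative - c * ((- mk 1 0 (t x) * q x) * q x + q' x * mk 0 0 (t x))) (at x)" if x: "\<bar>x\<bar> < 1" for x
    proof -
      have "((\<lambda>x. mk 0 0 (t x)) has_real_derivative mkd 0 0 (t x) * (t x * q x)) (at x)"
        by (rule DERIV_chain2[OF mk_deriv[OF tpos[OF x]] dt[OF x]])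
      moreover have "mkd 0 0 (t x) * (t x * q x) = - mk 1 0 (t x) * q x"
        using tpos[OF x] by (simp add: mkd_def)
      ultimately have "((\<lambda>x. mk 0 0 (t x)) has_real_derivative - mk 1 0 (t x) * q x) (at x)" by simp
      then show ?thesis by (intro DERIV_cmult DERIV_mult dq x)
    qed
    have aq: "\<bar>q x\<bar> \<le> 1 / (1 - x\<^sup>2)" if "\<bar>x\<bar> < 1" for x unfolding q_def by (rule abs_ratio_le[OF that])
    have aq': "\<bar>q' x\<bar> \<le> 2 / (1 - x\<^sup>2)\<^sup>2" if x: "\<bar>x\<bar> < 1" for x
      using x by (simp add: q'_def divide_right_mono abs_square_le_1)
    have b1: "\<bar>- c * (mk 0 0 (t x) * q x)\<bar> \<le> G / (1 - x\<^sup>2)" if x: "\<bar>x\<bar> < 1" for x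
    proof -
      have w: "1 - x\<^sup>2 > 0" by (rule one_minus_square_pos[OF x])
      have "\<bar>- c * (mk 0 0 (t x) * q x)\<bar> = \<bar>c\<bar> * (\<bar>mk 0 0 (t x)\<bar> * \<bar>q x\<bar>)" by (simp add: abs_mult)
      also have "\<dots> \<le> \<bar>c\<bar> * (C0 * (1 / (1 - x\<^sup>2)))"
        using m0[OF tpos[OF x]] aq[OF x] C0(1) by (intro mult_left_mono mult_mono) auto
      also have "\<dots> = \<bar>c\<bar> * C0 / (1 - x\<^sup>2)" by simp
      also have "\<dots> \<le> G / (1 - x\<^sup>2)"
        unfolding G_def using C0(1) C1(1) w by (intro divide_right_mono mult_left_mono) auto
      finally show ?thesis .
    qed
    have b2: "\<bar>- c * ((- mk 1 0 (t x) * q x) * q x + q' x * mk 0 0 (t x))\<bar> \<le> G / (1 - x\<^sup>2)\<^sup>2" if x: "\<bar>x\<bar> < 1" for x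
    proof -
      define w where "w = 1 - x\<^sup>2"
      have w: "w > 0" unfolding w_def by (rule one_minus_square_pos[OF x])
      have "\<bar>- c * ((- mk 1 0 (t x) * q x) * q x + q' x * mk 0 0 (t x))\<bar> \<le> \<bar>c\<bar> * (\<bar>mk 1 0 (t x)\<bar> * (\<bar>q x\<bar> * \<bar>q x\<bar>) + \<bar>q' x\<bar> * \<bar>mk 0 0 (t x)\<bar>)"
        unfolding abs_mult abs_minus_cancel
        by (intro mult_left_mono order_trans[OF abs_triangle_ineq]) (auto simp: abs_mult)
      also have "\<dots> \<le> \<bar>c\<bar> * (C1 * (1 / w * (1 / w)) + 2 / w\<^sup>2 * C0)"
        using m0[OF tpos[OF x]] m1[OF tpos[OF x]] aq[OF x] aq'[OF x] C0(1) C1(1) w unfolding w_def[symmetric]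
        by (intro mult_left_mono add_mono mult_mono) auto
      also have "\<dots> = \<bar>c\<bar> * (C1 + 2 * C0) / w\<^sup>2"
        by (simp add: power2_eq_square add_divide_distrib distrib_left)
      also have "\<dots> \<le> G / w\<^sup>2"
        unfolding G_def by (intro divide_right_mono mult_left_mono) auto
      finally show ?thesis by (simp only: w_def)
    qed
    have b0: "\<bar>F_cutoff (t x)\<bar> \<le> G" if x: "\<bar>x\<bar> < 1" for x
    proof -
      have "\<bar>F_cutoff (t x)\<bar> \<le> \<bar>c\<bar> * exp (- t x)" unfolding c_def using tpos[OF x] by (intro abs_F_cutoff_le) simp
      also have "\<dots> \<le> \<bar>c\<bar> * (1 + 2 * C0 + C1)"
      proof (intro mult_left_mono)
        have "exp (- t x) \<le> 1" using tpos[OF x] by simp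
        then show "exp (- t x) \<le> 1 + 2 * C0 + C1" using C0(1) C1(1) by linarith
      qed simp
      finally show ?thesis by (simp only: G_def)
    qed
    note res = theta_weighted_lebesgue_bound[OF k G0 lam, where g = "\<lambda>x. complex_of_real (F_cutoff (t x))"
        and g' = "\<lambda>x. complex_of_real (- c * (mk 0 0 (t x) * q x))"
        and g'' = "\<lambda>x. complex_of_real (- c * ((- mk 1 0 (t x) * q x) * q x + q' x * mk 0 0 (t x)))",
        OF has_vector_derivative_of_real[OF d1] has_vector_derivative_of_real[OF d2]]
    show ?thesis
      using res(1) res(2) b0 b1 b2 unfolding norm_of_real t_def by blast
  qed
  then show ?thesis using G0 by blast
qed

text \<open>t^(-i v) has absolute value 1, and each derivative in log t multiplies it by -i v; two
  derivatives, with the lower order terms, cost (1 + |v|)^2.\<close>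

lemma power_oscillatory_bound:
  fixes T lam v :: real
  assumes T: "T > 0" and k: "k \<ge> 2" and lam: "lam \<noteq> 0"
  shows "norm (LINT x:{-1..1}|lborel. of_real (theta_inf k x) * exp (\<i> * of_real (- v * ln (T / sqrt (1 - x\<^sup>2)))) * exp (\<i> * of_real (lam * x)))
      \<le> 36 * real k ^ 2 * (1 + \<bar>v\<bar>) ^ 2 * \<bar>lam\<bar> powr (- 3/2)"
proof -
  define t where "t x = T / sqrt (1 - x\<^sup>2)" for x
  define q where "q x = x / (1 - x\<^sup>2)" for x :: real
  define q' where "q' x = (1 + x\<^sup>2) / (1 - x\<^sup>2)\<^sup>2" for x :: real
  define a where "a = - \<i> * of_real v"
  have na: "norm a = \<bar>v\<bar>" by (simp add: a_def norm_mult)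
  define g where "g x = exp (\<i> * of_real (- v * ln (t x)))" for x
  have tpos: "t x > 0" if "\<bar>x\<bar> < 1" for x using one_minus_square_pos[OF that] T by (simp add: t_def)
  have dl: "((\<lambda>x. ln (t x)) has_real_derivative q x) (at x)" if x: "\<bar>x\<bar> < 1" for x
  proof -
    have "(t has_real_derivative t x * q x) (at x)"
      unfolding t_def[abs_def] q_def by (rule log_ratio_deriv(1)[OF x T])
    from DERIV_chain2[OF DERIV_ln[OF tpos[OF x]] this]
    show ?thesis using tpos[OF x] by (simp add: inverse_eq_divide)
  qed
  have dq: "(q has_real_derivative q' x) (at x)" if "\<bar>x\<bar> < 1" for x
    unfolding q_def[abs_def] q'_def by (rule log_ratio_deriv(2)[OF that T])
  have geq: "g = (\<lambda>x. exp (a * of_real (ln (t x))))" by (simp add: g_def a_def fun_eq_iff mult.assoc)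
  have dg: "(g has_vector_derivative a * of_real (q x) * g x) (at x)" if x: "\<bar>x\<bar> < 1" for x
  proof -
    have "((\<lambda>z. exp (a * z)) has_field_derivative a * exp (a * of_real (ln (t x)))) (at (of_real (ln (t x))))"
      by (auto intro!: derivative_eq_intros)
    from field_vector_diff_chain_at[OF has_vector_derivative_of_real[OF dl[OF x]] this]
    show ?thesis unfolding geq by (simp add: o_def mult_ac)
  qed
  have dg': "((\<lambda>x. a * of_real (q x) * g x) has_vector_derivative a * of_real (q x) * (a * of_real (q x) * g x) + a * of_real (q' x) * g x) (at x)"
    if x: "\<bar>x\<bar> < 1" for x
    by (intro has_vector_derivative_mult has_vector_derivative_mult_right has_vector_derivative_of_real dq dg x)
  have ng: "norm (g x) = 1" for x unfolding g_def by (rule norm_exp_i_times)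
  have aq: "\<bar>q x\<bar> \<le> 1 / (1 - x\<^sup>2)" if "\<bar>x\<bar> < 1" for x unfolding q_def by (rule abs_ratio_le[OF that])
  have aq': "\<bar>q' x\<bar> \<le> 2 / (1 - x\<^sup>2)\<^sup>2" if x: "\<bar>x\<bar> < 1" for x
    using x by (simp add: q'_def divide_right_mono abs_square_le_1)
  have v2: "(1 + \<bar>v\<bar>) ^ 2 = \<bar>v\<bar> * \<bar>v\<bar> + 2 * \<bar>v\<bar> + 1" by (simp add: power2_eq_square algebra_simps)
  have v0: "0 \<le> \<bar>v\<bar> * \<bar>v\<bar>" by simp
  show ?thesis unfolding t_def[symmetric] g_def[symmetric]
  proof (rule theta_weighted_lebesgue_bound(2)[OF k _ lam dg dg'])
    fix x :: real assume x: "\<bar>x\<bar> < 1"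
    define w where "w = 1 - x\<^sup>2"
    have w: "w > 0" unfolding w_def by (rule one_minus_square_pos[OF x])
    show "norm (g x) \<le> (1 + \<bar>v\<bar>)\<^sup>2" unfolding ng v2 using v0 by linarith
    have "norm (a * of_real (q x) * g x) = \<bar>v\<bar> * \<bar>q x\<bar>" by (simp add: norm_mult na ng)
    also have "\<dots> \<le> \<bar>v\<bar> * (1 / w)" using aq[OF x] by (intro mult_left_mono) (auto simp: w_def)
    also have "\<dots> = \<bar>v\<bar> / w" by simp
    also have "\<dots> \<le> (1 + \<bar>v\<bar>)\<^sup>2 / w" unfolding v2 using w v0 by (intro divide_right_mono) auto
    finally show "norm (a * of_real (q x) * g x) \<le> (1 + \<bar>v\<bar>)\<^sup>2 / (1 - x\<^sup>2)" by (simp only: w_def)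
    have "norm (a * of_real (q x) * (a * of_real (q x) * g x) + a * of_real (q' x) * g x)
       \<le> (\<bar>v\<bar> * \<bar>q x\<bar>) * (\<bar>v\<bar> * \<bar>q x\<bar>) + \<bar>v\<bar> * \<bar>q' x\<bar>"
      by (rule order_trans[OF norm_triangle_ineq]) (simp add: norm_mult na ng)
    also have "\<dots> \<le> (\<bar>v\<bar> * (1 / w)) * (\<bar>v\<bar> * (1 / w)) + \<bar>v\<bar> * (2 / w\<^sup>2)"
      using aq[OF x] aq'[OF x] w unfolding w_def[symmetric] by (intro add_mono mult_mono mult_left_mono) auto
    also have "\<dots> = (\<bar>v\<bar> * \<bar>v\<bar> + 2 * \<bar>v\<bar>) / w\<^sup>2" by (simp add: power2_eq_square add_divide_distrib)
    also have "\<dots> \<le> (1 + \<bar>v\<bar>)\<^sup>2 / w\<^sup>2" unfolding v2 by (intro divide_right_mono) auto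
    finally show "norm (a * of_real (q x) * (a * of_real (q x) * g x) + a * of_real (q' x) * g x) \<le> (1 + \<bar>v\<bar>)\<^sup>2 / (1 - x\<^sup>2)\<^sup>2"
      by (simp only: w_def)
  qed simp
qed

text \<open>The integrand of \<open>H_fun\<close> at u = 1 + i v without the power of pi y.\<close>

definition mellin_weight :: "real \<Rightarrow> complex" where
  "mellin_weight v = Gamma (1 + \<i> * of_real (v / 2)) / Gamma (1/2 - \<i> * of_real (v / 2)) * F_mellin (Complex 1 v)"

lemma F_mellin_measurable: "(\<lambda>v. F_mellin (Complex 1 v)) \<in> borel_measurable borel"
proof -
  have m: "(\<lambda>v. LINT x|lborel. indicator {0<..} x *\<^sub>R (complex_of_real (mk 0 0 x) * exp (\<i> * of_real (v * ln x)))) \<in> borel_measurable borel"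
    by measurable
  have "mk_mellin 0 0 v = (LINT x|lborel. indicator {0<..} x *\<^sub>R (complex_of_real (mk 0 0 x) * exp (\<i> * of_real (v * ln x))))" for v
    unfolding mk_mellin_def set_lebesgue_integral_def
    by (rule Bochner_Integration.integral_cong) (auto simp: indicator_def powr_def Ln_of_real mult_ac)
  then have mm: "mk_mellin 0 0 \<in> borel_measurable borel" using m by (simp cong: measurable_cong)
  have ne: "1 + \<i> * of_real v \<noteq> 0" for v by (simp add: complex_eq_iff)
  have "F_mellin (Complex 1 v) = of_real cut_const * mk_mellin 0 0 v / (1 + \<i> * of_real v)" for v
    using F_mellin_eq[of v] ne[of v] by (metis nonzero_mult_div_cancel_left)
  then show ?thesis using mm by simp
qed

lemma mellin_weight_measurable [measurable]: "mellin_weight \<in> borel_measurable borel"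
proof -
  have 1: "continuous_on UNIV (\<lambda>v. Gamma (1 + \<i> * complex_of_real (v / 2)))"
    by (rule continuous_on_compose2[OF continuous_on_Gamma[of "- \<int>\<^sub>\<le>\<^sub>0"]])
       (auto intro!: continuous_intros elim!: nonpos_Ints_cases simp: complex_eq_iff)
  have 2: "continuous_on UNIV (\<lambda>v. Gamma (1/2 - \<i> * complex_of_real (v / 2)))"
    by (rule continuous_on_compose2[OF continuous_on_Gamma[of "- \<int>\<^sub>\<le>\<^sub>0"]])
       (auto intro!: continuous_intros elim!: nonpos_Ints_cases simp: complex_eq_iff)
  show ?thesis
    unfolding mellin_weight_def[abs_def]
    by (intro borel_measurable_times borel_measurable_divide borel_measurable_continuous_onI[OF 1]
        borel_measurable_continuous_onI[OF 2] F_mellin_measurable)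
qed

lemma mellin_weight_integrable: "integrable lborel (\<lambda>v. norm (mellin_weight v) * (1 + \<bar>v\<bar>) ^ 2)"
proof -
  obtain C where C: "C \<ge> 0" "\<And>v. norm (F_mellin (Complex 1 v)) * norm (1 + \<i> * of_real v) ^ 5 \<le> C"
    using F_mellin_decay by blast
  have "set_integrable lborel (einterval (- \<infinity>) \<infinity>) (\<lambda>x. inverse (1 + x\<^sup>2))" by (rule integrable_inverse_1_plus_square)
  then have "integrable lborel (\<lambda>x::real. inverse (1 + x\<^sup>2))" by (simp add: set_integrable_def)
  then have int: "integrable lborel (\<lambda>x::real. 8 * C * inverse (1 + x\<^sup>2))" by (rule integrable_mult_right)
  show ?thesis
  proof (rule Bochner_Integration.integrable_bound[OF int])
    show "(\<lambda>v. norm (mellin_weight v) * (1 + \<bar>v\<bar>) ^ 2) \<in> borel_measurable lborel" by measurable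
    have "norm (norm (mellin_weight v) * (1 + \<bar>v\<bar>) ^ 2) \<le> norm (8 * C * inverse (1 + v\<^sup>2))" for v
    proof -
      define N where "N = norm (1 + \<i> * complex_of_real v)"
      have N2: "N ^ 2 = 1 + v\<^sup>2" by (simp add: N_def cmod_power2)
      have N0: "N > 0" using N2 by (simp add: N_def complex_eq_iff)
      have N1: "1 \<le> N" "\<bar>v\<bar> \<le> N"
        using abs_Re_le_cmod[of "1 + \<i> * complex_of_real v"] abs_Im_le_cmod[of "1 + \<i> * complex_of_real v"] by (simp_all add: N_def)
      then have vN: "1 + \<bar>v\<bar> \<le> 2 * N" by linarith
      have "norm (Gamma (1 + \<i> * of_real (v / 2)) / Gamma (1/2 - \<i> * of_real (v / 2))) \<le> 1 + \<bar>v\<bar>"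
        using norm_Gamma_quotient_le[of "v / 2"] by simp
      then have "norm (mellin_weight v) * (1 + \<bar>v\<bar>) ^ 2 \<le> ((1 + \<bar>v\<bar>) * norm (F_mellin (Complex 1 v))) * (1 + \<bar>v\<bar>) ^ 2"
        unfolding mellin_weight_def norm_mult by (intro mult_right_mono) auto
      also have "\<dots> = norm (F_mellin (Complex 1 v)) * (1 + \<bar>v\<bar>) ^ 3" by (simp add: power2_eq_square power3_eq_cube)
      also have "\<dots> \<le> norm (F_mellin (Complex 1 v)) * (2 * N) ^ 3"
        using vN by (intro mult_left_mono power_mono) auto
      also have "\<dots> = 8 * (norm (F_mellin (Complex 1 v)) * N ^ 5) / N ^ 2"
        using N0 by (simp add: power_mult_distrib eval_nat_numeral)
      also have "\<dots> \<le> 8 * C / N ^ 2" using C(2)[of v] by (intro divide_right_mono mult_left_mono) (auto simp: N_def)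
      also have "\<dots> = 8 * C * inverse (1 + v\<^sup>2)" by (simp add: N2 inverse_eq_divide)
      finally show ?thesis using C(1) by simp
    qed
    then show "AE v in lborel. norm (norm (mellin_weight v) * (1 + \<bar>v\<bar>) ^ 2) \<le> norm (8 * C * inverse (1 + v\<^sup>2))" by simp
  qed
qed

text \<open>On Re u = 1 the power (pi t)^(-u) is 1 / (pi t) times a number of absolute value 1, and
  the outer factor t cancels the growth at 0. What remains is a superposition of unimodular powers
  with a weight independent of t.\<close>

lemma t_H_fun_eq:
  assumes t: "t > 0"
  shows "of_real t * H_fun t = of_real (sqrt pi / (2 * pi * pi)) *
     (LINT v|lborel. mellin_weight v * exp (\<i> * of_real (- v * ln (pi * t))))"
proof -
  have pt: "pi * t > 0" using t by simp
  have "Gamma ((1 + Complex 1 v) / 2) / Gamma ((2 - Complex 1 v) / 2) * of_real (pi * t) powr (- Complex 1 v) * F_mellin (Complex 1 v) * \<i>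
     = (\<i> * of_real (1 / (pi * t))) * (mellin_weight v * exp (\<i> * of_real (- v * ln (pi * t))))" for v
  proof -
    have a: "(1 + Complex 1 v) / 2 = 1 + \<i> * of_real (v / 2)" "(2 - Complex 1 v) / 2 = 1/2 - \<i> * of_real (v / 2)"
      by (simp_all add: complex_eq_iff)
    have "complex_of_real (pi * t) powr (- Complex 1 v) = exp (- Complex 1 v * of_real (ln (pi * t)))"
      using pt t by (simp add: powr_def Ln_of_real del: of_real_mult)
    also have "- Complex 1 v * of_real (ln (pi * t)) = of_real (- ln (pi * t)) + \<i> * of_real (- v * ln (pi * t))"
      by (simp add: complex_eq_iff)
    also have "exp \<dots> = of_real (exp (- ln (pi * t))) * exp (\<i> * of_real (- v * ln (pi * t)))"
      by (simp only: exp_add exp_of_real)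
    also have "exp (- ln (pi * t)) = 1 / (pi * t)" using pt t by (simp add: exp_minus inverse_eq_divide)
    finally show ?thesis unfolding a mellin_weight_def by (simp only: mult_ac)
  qed
  then have "vertical_integral 1 (\<lambda>u. Gamma ((1 + u) / 2) / Gamma ((2 - u) / 2) * of_real (pi * t) powr (- u) * F_mellin u)
     = (\<i> * of_real (1 / (pi * t))) * (LINT v|lborel. mellin_weight v * exp (\<i> * of_real (- v * ln (pi * t))))"
    unfolding vertical_integral_def by (simp only: integral_mult_right_zero)
  then have "of_real t * H_fun t = (of_real t * (of_real (sqrt pi) / (2 * of_real pi * \<i>)) * (\<i> * of_real (1 / (pi * t)))) *
      (LINT v|lborel. mellin_weight v * exp (\<i> * of_real (- v * ln (pi * t))))"
    unfolding H_fun_def by (simp only: mult.assoc)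
  also have "of_real t * (of_real (sqrt pi) / (2 * of_real pi * \<i>)) * (\<i> * of_real (1 / (pi * t))) = complex_of_real (sqrt pi / (2 * pi * pi))"
    using t by simp
  finally show ?thesis .
qed

lemma theta_inf_measurable [measurable]: "theta_inf k \<in> borel_measurable borel"
  unfolding theta_inf_def[abs_def] by measurable

text \<open>Fubini moves the x-integral inside the v-integral, where
  \<open>power_oscillatory_bound\<close> applies with T replaced by \<open>pi * T\<close>; its
  growth in v is integrable against the weight.\<close>

lemma H_fun_oscillatory_bound:
  "\<exists>G\<ge>0. \<forall>T>0. \<forall>k\<ge>2. \<forall>lam. lam \<noteq> 0 \<longrightarrow>
     set_integrable lborel {-1..1} (\<lambda>x. of_real (theta_inf k x) * (of_real (T / sqrt (1 - x\<^sup>2)) * H_fun (T / sqrt (1 - x\<^sup>2))) * exp (\<i> * of_real (lam * x))) \<and>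
     norm (LINT x:{-1..1}|lborel. of_real (theta_inf k x) * (of_real (T / sqrt (1 - x\<^sup>2)) * H_fun (T / sqrt (1 - x\<^sup>2))) * exp (\<i> * of_real (lam * x)))
      \<le> 36 * real k ^ 2 * G * \<bar>lam\<bar> powr (- 3/2)"
proof -
  define c where "c = complex_of_real (sqrt pi / (2 * pi * pi))"
  define W where "W = (LINT v|lborel. norm (mellin_weight v) * (1 + \<bar>v\<bar>) ^ 2)"
  have W0: "W \<ge> 0" unfolding W_def by (rule Bochner_Integration.integral_nonneg) auto
  have intW: "integrable lborel mellin_weight"
    by (rule Bochner_Integration.integrable_bound[OF mellin_weight_integrable])
       (auto intro!: AE_I2 simp: abs_mult mult_le_cancel_left1 one_le_power)
  have "set_integrable lborel {-1..1} (\<lambda>x. of_real (theta_inf k x) * (of_real (T / sqrt (1 - x\<^sup>2)) * H_fun (T / sqrt (1 - x\<^sup>2))) * exp (\<i> * of_real (lam * x))) \<and>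
     norm (LINT x:{-1..1}|lborel. of_real (theta_inf k x) * (of_real (T / sqrt (1 - x\<^sup>2)) * H_fun (T / sqrt (1 - x\<^sup>2))) * exp (\<i> * of_real (lam * x)))
      \<le> 36 * real k ^ 2 * (norm c * W) * \<bar>lam\<bar> powr (- 3/2)" if T: "T > 0" and k: "k \<ge> 2" and lam: "lam \<noteq> 0" for T k and lam :: real
  proof -
    define P where "P x v = exp (\<i> * of_real (- v * ln (pi * T / sqrt (1 - x\<^sup>2))))" for x v :: real
    define e where "e x = exp (\<i> * of_real (lam * x))" for x :: real
    define \<theta> where "\<theta> x = complex_of_real (theta_inf k x)" for x
    define \<Phi> where "\<Phi> = (\<lambda>(x, v). indicator {-1..1} x *\<^sub>R (\<theta> x * e x) * (mellin_weight v * P x v))"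
    have nP: "norm (P x v) = 1" for x v unfolding P_def by (rule norm_exp_i_times)
    have ne: "norm (e x) = 1" for x unfolding e_def by (rule norm_exp_i_times)
    have n\<Phi>: "norm (\<Phi> (x, v)) = (indicator {-1..1} x * \<bar>theta_inf k x\<bar>) * norm (mellin_weight v)" for x v
      by (simp add: \<Phi>_def norm_mult nP ne \<theta>_def)
    have m\<Phi>: "\<Phi> \<in> borel_measurable (lborel \<Otimes>\<^sub>M lborel)"
      unfolding \<Phi>_def P_def e_def \<theta>_def by measurable
    have mW: "(\<lambda>v. norm (mellin_weight v)) \<in> borel_measurable lborel" by measurable
    have i\<theta>: "integrable lborel (\<lambda>x. indicator {-1..1} x * \<bar>theta_inf k x\<bar>)"
    proof (rule Bochner_Integration.integrable_bound[of lborel "\<lambda>x. indicator {-1..1::real} x :: real"])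
      show "AE x in lborel. norm (indicator {-1..1} x * \<bar>theta_inf k x\<bar>) \<le> norm (indicator {-1..1::real} x :: real)"
        using abs_theta_inf_le by (intro AE_I2) (auto simp: indicator_def abs_le_iff)
    qed auto
    have int\<Phi>: "integrable (lborel \<Otimes>\<^sub>M lborel) \<Phi>"
    proof (rule lborel_pair.Fubini_integrable[OF m\<Phi>])
      show "integrable lborel (\<lambda>x. LINT v|lborel. norm (\<Phi> (x, v)))"
        unfolding n\<Phi> integral_mult_right_zero by (intro integrable_mult_left i\<theta>)
      show "AE x in lborel. integrable lborel (\<lambda>v. \<Phi> (x, v))"
      proof (rule AE_I2)
        fix x :: real
        show "integrable lborel (\<lambda>v. \<Phi> (x, v))"
        proof (rule Bochner_Integration.integrable_bound[OF integrable_mult_right[OF integrable_norm[OF intW], of "indicator {-1..1} x * \<bar>theta_inf k x\<bar>"]])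
          show "(\<lambda>v. \<Phi> (x, v)) \<in> borel_measurable lborel"
            unfolding \<Phi>_def P_def e_def \<theta>_def by simp
          show "AE v in lborel. norm (\<Phi> (x, v)) \<le> norm (indicator {-1..1} x * \<bar>theta_inf k x\<bar> * norm (mellin_weight v))"
            unfolding n\<Phi> by (intro AE_I2) simp
        qed
      qed
    qed
    have inner: "(LINT v|lborel. \<Phi> (x, v)) * c = indicator {-1..1} x *\<^sub>R (\<theta> x * (of_real (T / sqrt (1 - x\<^sup>2)) * H_fun (T / sqrt (1 - x\<^sup>2))) * e x)" for x
    proof (cases "\<bar>x\<bar> < 1")
      case True
      then have tp: "T / sqrt (1 - x\<^sup>2) > 0" using one_minus_square_pos[OF True] T by simp
      have "(LINT v|lborel. \<Phi> (x, v)) = indicator {-1..1} x *\<^sub>R (\<theta> x * e x) * (LINT v|lborel. mellin_weight v * P x v)"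
        unfolding \<Phi>_def prod.case by (rule integral_mult_right_zero)
      moreover have "of_real (T / sqrt (1 - x\<^sup>2)) * H_fun (T / sqrt (1 - x\<^sup>2)) = c * (LINT v|lborel. mellin_weight v * P x v)"
        unfolding t_H_fun_eq[OF tp] c_def P_def times_divide_eq_right ..
      ultimately show ?thesis by simp
    next
      \<comment> \<open>At the endpoints division by 0 makes the argument of \<open>H_fun\<close>
        equal to 0, but the weight vanishes there.\<close>
      case False
      then have "indicator {-1..1} x *\<^sub>R \<theta> x = 0" by (simp add: \<theta>_def theta_inf_def)
      then have z: "\<theta> x = 0 \<or> x \<notin> {-1..1}" by (auto simp: indicator_def split: if_splits)
      then have "\<Phi> (x, v) = 0" for v by (auto simp: \<Phi>_def)
      then show ?thesis using z by auto
    qed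
    have "integrable lborel (\<lambda>x. (LINT v|lborel. \<Phi> (x, v)) * c)"
      by (intro integrable_mult_left lborel_pair.integrable_fst'[OF int\<Phi>])
    then have A: "set_integrable lborel {-1..1} (\<lambda>x. \<theta> x * (of_real (T / sqrt (1 - x\<^sup>2)) * H_fun (T / sqrt (1 - x\<^sup>2))) * e x)"
      unfolding set_integrable_def inner .
    have "(LINT x:{-1..1}|lborel. \<theta> x * (of_real (T / sqrt (1 - x\<^sup>2)) * H_fun (T / sqrt (1 - x\<^sup>2))) * e x) = (LINT x|lborel. (LINT v|lborel. \<Phi> (x, v)) * c)"
      unfolding set_lebesgue_integral_def inner ..
    also have "\<dots> = (LINT x|lborel. LINT v|lborel. \<Phi> (x, v)) * c" by (rule integral_mult_left_zero)
    also have "(LINT x|lborel. LINT v|lborel. \<Phi> (x, v)) = (LINT v|lborel. LINT x|lborel. \<Phi> (x, v))"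
      using lborel_pair.Fubini_integral[of "\<lambda>x v. \<Phi> (x, v)"] int\<Phi> by simp
    finally have eq: "(LINT x:{-1..1}|lborel. \<theta> x * (of_real (T / sqrt (1 - x\<^sup>2)) * H_fun (T / sqrt (1 - x\<^sup>2))) * e x)
       = (LINT v|lborel. LINT x|lborel. \<Phi> (x, v)) * c" .
    define D where "D = 36 * real k ^ 2 * \<bar>lam\<bar> powr (- 3/2)"
    have bd: "norm (LINT x|lborel. \<Phi> (x, v)) \<le> (norm (mellin_weight v) * (1 + \<bar>v\<bar>) ^ 2) * D" for v
    proof -
      have "(LINT x|lborel. \<Phi> (x, v)) = (LINT x|lborel. mellin_weight v * (indicator {-1..1} x *\<^sub>R (\<theta> x * P x v * e x)))"
        by (rule Bochner_Integration.integral_cong) (auto simp: \<Phi>_def)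
      also have "\<dots> = mellin_weight v * (LINT x:{-1..1}|lborel. \<theta> x * P x v * e x)"
        unfolding set_lebesgue_integral_def by (rule integral_mult_right_zero)
      finally have "norm (LINT x|lborel. \<Phi> (x, v)) = norm (mellin_weight v) * norm (LINT x:{-1..1}|lborel. \<theta> x * P x v * e x)"
        by (simp only: norm_mult)
      also have "\<dots> \<le> norm (mellin_weight v) * (36 * real k ^ 2 * (1 + \<bar>v\<bar>) ^ 2 * \<bar>lam\<bar> powr (- 3/2))"
        unfolding \<theta>_def P_def e_def using T by (intro mult_left_mono power_oscillatory_bound k lam) auto
      finally show ?thesis by (simp only: D_def mult_ac)
    qed
    have "norm (LINT v|lborel. LINT x|lborel. \<Phi> (x, v)) \<le> (LINT v|lborel. (norm (mellin_weight v) * (1 + \<bar>v\<bar>) ^ 2) * D)"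
    proof (rule Bochner_Integration.integral_norm_bound_integral)
      show "integrable lborel (\<lambda>v. LINT x|lborel. \<Phi> (x, v))"
        using lborel_pair.integrable_snd[of "\<lambda>x v. \<Phi> (x, v)"] int\<Phi> by simp
    qed (intro integrable_mult_left mellin_weight_integrable bd)+
    also have "\<dots> = W * D" unfolding W_def by (rule integral_mult_left_zero)
    finally have "norm (LINT v|lborel. LINT x|lborel. \<Phi> (x, v)) * norm c \<le> W * D * norm c" by (rule mult_right_mono) simp
    then have "norm (LINT x:{-1..1}|lborel. \<theta> x * (of_real (T / sqrt (1 - x\<^sup>2)) * H_fun (T / sqrt (1 - x\<^sup>2))) * e x) \<le> W * D * norm c"
      unfolding eq norm_mult .
    then show ?thesis using A unfolding \<theta>_def e_def D_def by (simp only: mult_ac)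
  qed
  then show ?thesis using W0 by (intro exI[of _ "norm c * W"]) auto
qed

text \<open>The phase is lam * x with lam = -pi \<xi> sqrt n / (l f^2), and \<open>t_arg\<close> is
  T / sqrt (1 - x^2) with T independent of x. Both partial bounds are uniform in T, so the size is
  governed by lam.\<close>

theorem norm_I_int_le:
  "\<exists>C\<ge>0. \<forall>l f \<xi> n. l > 0 \<longrightarrow> f > 0 \<longrightarrow> \<xi> > 0 \<longrightarrow> n > 0 \<longrightarrow>
     norm (I_int k l f \<xi> n) \<le> C * (pi * of_int \<xi> * sqrt (real n) / (real l * (real f)\<^sup>2)) powr (- 3/2)" if k: "k \<ge> 2"
proof -
  obtain G1 where G1: "G1 \<ge> 0" "\<And>T lam. T > 0 \<Longrightarrow> lam \<noteq> 0 \<Longrightarrow>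
     set_integrable lborel {-1..1} (\<lambda>x. of_real (theta_inf k x) * of_real (F_cutoff (T / sqrt (1 - x\<^sup>2))) * exp (\<i> * of_real (lam * x))) \<and>
     norm (LINT x:{-1..1}|lborel. of_real (theta_inf k x) * of_real (F_cutoff (T / sqrt (1 - x\<^sup>2))) * exp (\<i> * of_real (lam * x)))
      \<le> 36 * real k ^ 2 * G1 * \<bar>lam\<bar> powr (- 3/2)" using F_cutoff_oscillatory_bound k by blast
  obtain G2 where G2: "G2 \<ge> 0" "\<And>T lam. T > 0 \<Longrightarrow> lam \<noteq> 0 \<Longrightarrow>
     set_integrable lborel {-1..1} (\<lambda>x. of_real (theta_inf k x) * (of_real (T / sqrt (1 - x\<^sup>2)) * H_fun (T / sqrt (1 - x\<^sup>2))) * exp (\<i> * of_real (lam * x))) \<and>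
     norm (LINT x:{-1..1}|lborel. of_real (theta_inf k x) * (of_real (T / sqrt (1 - x\<^sup>2)) * H_fun (T / sqrt (1 - x\<^sup>2))) * exp (\<i> * of_real (lam * x)))
      \<le> 36 * real k ^ 2 * G2 * \<bar>lam\<bar> powr (- 3/2)" using H_fun_oscillatory_bound k by blast
  have "norm (I_int k l f \<xi> n) \<le> (36 * real k ^ 2 * (G1 + G2)) * (pi * of_int \<xi> * sqrt (real n) / (real l * (real f)\<^sup>2)) powr (- 3/2)"
    if l: "l > 0" and f: "f > 0" and \<xi>: "\<xi> > 0" and n: "n > 0" for l f \<xi> n
  proof -
    define T where "T = real l * (real f)\<^sup>2 * (4 * real n) powr (- 1 / 2)"
    define lam where "lam = - (pi * of_int \<xi> * sqrt (real n) / (real l * (real f)\<^sup>2))"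
    have T: "T > 0" using l f n by (simp add: T_def)
    have lp: "pi * of_int \<xi> * sqrt (real n) / (real l * (real f)\<^sup>2) > 0" using l f n \<xi> by simp
    have lam: "lam \<noteq> 0" "\<bar>lam\<bar> = pi * of_int \<xi> * sqrt (real n) / (real l * (real f)\<^sup>2)" 
    proof -
      have "- m \<noteq> 0 \<and> \<bar>- m\<bar> = m" if "m > 0" for m :: real using that by simp
      from this[OF lp] show "lam \<noteq> 0" "\<bar>lam\<bar> = pi * of_int \<xi> * sqrt (real n) / (real l * (real f)\<^sup>2)"
        unfolding lam_def by blast+
    qed
    have ec: "e_char (- x * of_int \<xi> * sqrt (real n) / (2 * real l * (real f)\<^sup>2)) = exp (\<i> * of_real (lam * x))" for x
    proof -
      have "2 * pi * (- x * of_int \<xi> * sqrt (real n) / (2 * real l * (real f)\<^sup>2)) = lam * x" by (simp add: lam_def)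
      then have "2 * of_real pi * \<i> * of_real (- x * of_int \<xi> * sqrt (real n) / (2 * real l * (real f)\<^sup>2)) = \<i> * complex_of_real (lam * x)"
        by (metis (no_types, lifting) mult.assoc mult.commute of_real_mult of_real_numeral)
      then show ?thesis unfolding e_char_def by (simp only:)
    qed
    have ta: "t_arg l f n x = T / sqrt (1 - x\<^sup>2)" for x by (simp only: t_arg_def T_def)
    note g1 = G1(2)[OF T lam(1)] and g2 = G2(2)[OF T lam(1)]
    have "I_int k l f \<xi> n = (LINT x:{-1..1}|lborel. of_real (theta_inf k x) * of_real (F_cutoff (T / sqrt (1 - x\<^sup>2))) * exp (\<i> * of_real (lam * x))
        + of_real (theta_inf k x) * (of_real (T / sqrt (1 - x\<^sup>2)) * H_fun (T / sqrt (1 - x\<^sup>2))) * exp (\<i> * of_real (lam * x)))"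
      unfolding I_int_def ec ta by (simp only: distrib_left distrib_right)
    also have "\<dots> = (LINT x:{-1..1}|lborel. of_real (theta_inf k x) * of_real (F_cutoff (T / sqrt (1 - x\<^sup>2))) * exp (\<i> * of_real (lam * x)))
        + (LINT x:{-1..1}|lborel. of_real (theta_inf k x) * (of_real (T / sqrt (1 - x\<^sup>2)) * H_fun (T / sqrt (1 - x\<^sup>2))) * exp (\<i> * of_real (lam * x)))"
      using g1 g2 by (intro set_integral_add(2)) blast+
    finally have "norm (I_int k l f \<xi> n) \<le> 36 * real k ^ 2 * G1 * \<bar>lam\<bar> powr (- 3/2) + 36 * real k ^ 2 * G2 * \<bar>lam\<bar> powr (- 3/2)"
      using g1 g2 by (simp only:) (intro order_trans[OF norm_triangle_ineq] add_mono, blast+)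
    then show ?thesis unfolding lam(2) by (simp only: distrib_left distrib_right)
  qed
  then show ?thesis using G1(1) G2(1) by (intro exI[of _ "36 * real k ^ 2 * (G1 + G2)"]) auto
qed

section \<open>Assembly: logarithms and powers of n\<close>

lemma log_product_bound:
  fixes c \<kappa> :: real
  assumes c: "c > 0" and \<kappa>: "\<kappa> > 0"
  shows "\<exists>D\<ge>0. \<forall>n::nat. n \<ge> 2 \<longrightarrow> c * real n powr (1 / 4 - \<kappa>) \<ge> 1 \<longrightarrow>
    (1 + ln (c * real n powr (1 / 4 - \<kappa>))) * (1 + ln (4 * real n)) \<le> D * (ln (real n))\<^sup>2"
proof -
  define m where "m = ln (2::real)"
  have m: "m > 0" by (simp add: m_def)
  define a where "a = (1 + \<bar>ln c\<bar>) / m + 1"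
  define b where "b = (1 + ln 4) / m + 1"
  have a0: "a \<ge> 0" using m by (simp add: a_def)
  have b0: "b \<ge> 0" using m by (simp add: b_def)
  have "(1 + ln (c * real n powr (1 / 4 - \<kappa>))) * (1 + ln (4 * real n)) \<le> (a * b) * (ln (real n))\<^sup>2"
    if n: "n \<ge> 2" and ge: "c * real n powr (1 / 4 - \<kappa>) \<ge> 1" for n :: nat
  proof -
    define L where "L = ln (real n)"
    have Lm: "L \<ge> m" using n by (simp add: L_def m_def)
    have L0: "L > 0" using Lm m by linarith
    \<comment> \<open>As \<open>L\<close> is at least ln 2, a nonnegative constant u is at most u /
      ln 2 times \<open>L\<close>. This is where n \<ge> 2 is used.\<close>
    have scale: "u \<le> u / m * L" if "u \<ge> 0" for u :: real
    proof -
      have "u / m * m \<le> u / m * L" using that m Lm by (intro mult_left_mono) auto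
      then show ?thesis using m by simp
    qed
    have pn: "real n powr (1 / 4 - \<kappa>) > 0" using n by simp
    have "ln (c * real n powr (1 / 4 - \<kappa>)) = ln c + (1 / 4 - \<kappa>) * L"
      using ln_mult_pos[OF c pn] n by (simp add: L_def ln_powr)
    also have "(1 / 4 - \<kappa>) * L \<le> 1 * L" using \<kappa> L0 by (intro mult_right_mono) auto
    finally have 1: "1 + ln (c * real n powr (1 / 4 - \<kappa>)) \<le> a * L"
      using scale[of "1 + \<bar>ln c\<bar>"] unfolding a_def distrib_right by linarith
    have "ln (4 * real n) = ln 4 + L" using ln_mult_pos[of 4 "real n"] n by (simp add: L_def)
    then have 2: "1 + ln (4 * real n) \<le> b * L"
      using scale[of "1 + ln 4"] unfolding b_def distrib_right by simp
    have "(1 + ln (c * real n powr (1 / 4 - \<kappa>))) * (1 + ln (4 * real n)) \<le> (a * L) * (b * L)"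
      using 1 2 a0 b0 L0 ge n by (intro mult_mono) auto
    then show ?thesis by (simp add: L_def power2_eq_square mult_ac)
  qed
  then show ?thesis using a0 b0 by (intro exI[of _ "a * b"]) auto
qed

theorem theorem4p13:
  fixes k :: nat and c1 c2 \<kappa> \<alpha> :: real
  assumes "k > 2" and "even k"
    and "c1 > 0" and "c2 > 0"
    and "\<kappa> > 0" and "0 < \<alpha>" and "\<alpha> \<le> 1 / 12"
  shows "\<exists>C::real. \<forall>n::nat. n \<ge> 2 \<longrightarrow>
           norm (S2 k c1 c2 n \<kappa> \<alpha>) \<le> C * (ln (real n))\<^sup>2 * real n powr (- 1 / 2 - \<kappa>)"
proof -
  have k2: "k \<ge> 2" using assms(1) by simp
  obtain CI where CI: "CI \<ge> 0" "\<And>l f \<xi> n. l > 0 \<Longrightarrow> f > 0 \<Longrightarrow> \<xi> > 0 \<Longrightarrow> n > 0 \<Longrightarrow>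
     norm (I_int k l f \<xi> n) \<le> CI * (pi * of_int \<xi> * sqrt (real n) / (real l * (real f)\<^sup>2)) powr (- 3/2)"
    using norm_I_int_le[OF k2] by blast
  obtain CK where CK: "CK > 0" "\<And>n x Y. n > 0 \<Longrightarrow> x > 0 \<Longrightarrow> Y \<ge> 1 \<Longrightarrow>
     (\<Sum>(l, f) | l \<ge> 1 \<and> f \<ge> 1 \<and> real l * (real f)\<^sup>2 \<le> Y. norm (Kl_sum l f (int x) n) / sqrt (real l))
       \<le> CK * Y * (1 + ln Y) * (1 + ln (4 * real n)) * real (num_divisors x) ^ 3"
    using sum_norm_Kl_sum_le by blast
  obtain CD where CD: "CD > 0" "\<And>G. (\<Sum>g\<in>{1..G}. real (num_divisors g) ^ 3 * real g powr - (3/2)) \<le> CD"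
    using sum_divisor_powers_bounded[of "3/2" 3] by auto
  obtain D where D: "D \<ge> 0" "\<And>n::nat. n \<ge> 2 \<Longrightarrow> c1 * real n powr (1 / 4 - \<kappa>) \<ge> 1 \<Longrightarrow>
    (1 + ln (c1 * real n powr (1 / 4 - \<kappa>))) * (1 + ln (4 * real n)) \<le> D * (ln (real n))\<^sup>2"
    using log_product_bound[OF assms(3,5)] by blast
  define E where "E = CI * pi powr (- 3/2) * CK * c1 * CD * D"
  have E0: "E \<ge> 0" using CI(1) CK(1) CD(1) D(1) assms(3) by (simp add: E_def)
  have "norm (S2 k c1 c2 n \<kappa> \<alpha>) \<le> E * (ln (real n))\<^sup>2 * real n powr (- 1 / 2 - \<kappa>)"
    if n: "n \<ge> 2" for n :: nat
  proof -
    define Y where "Y = c1 * real n powr (1 / 4 - \<kappa>)"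
    define Z where "Z = c2 * real n powr (1 / 6 + \<kappa> + \<alpha>)"
    define P where "P = {(l::nat, f::nat). l \<ge> 1 \<and> f \<ge> 1 \<and> real l * (real f)\<^sup>2 \<le> Y}"
    define Q where "Q = {\<xi>::int. 0 < \<xi> \<and> of_int \<xi> \<le> Z}"
    have S2: "S2 k c1 c2 n \<kappa> \<alpha> = (\<Sum>(l, f)\<in>P. \<Sum>\<xi>\<in>Q. Kl_sum l f \<xi> n / of_real (sqrt (real l))
          * (I_int k l f \<xi> n / of_real ((real l * (real f)\<^sup>2) powr (3 / 2))))"
      unfolding S2_def P_def Q_def Y_def Z_def ..
    have n0: "n > 0" and rn0: "real n > 0" using n by auto
    show ?thesis
    proof (cases "Y \<ge> 1")
      \<comment> \<open>No pair satisfies l f^2 \<le> Y < 1, so the double sum is empty. This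
        happens for large n when \<kappa> exceeds 1/4; excluding it keeps ln Y nonnegative
        below.\<close>
      case False
      have "P = {}"
      proof (rule equals0I)
        fix p assume "p \<in> P"
        then obtain l f where lf: "l \<ge> 1" "f \<ge> 1" "real l * (real f)\<^sup>2 \<le> Y" by (auto simp: P_def)
        have "1 * 1 \<le> real l * (real f)\<^sup>2" using lf by (intro mult_mono one_le_power) auto
        then show False using lf(3) False by linarith
      qed
      then show ?thesis unfolding S2 using E0 by simp
    next
      case True
      \<comment> \<open>The exponent -3/4 is that of \<open>sqrt (real n)\<close> raised to the
        power -3/2.\<close>
      define A where "A = CI * pi powr (- 3/2) * real n powr (- 3/4)"
      have A0: "A \<ge> 0" using CI(1) by (simp add: A_def)
      have term_le: "norm (Kl_sum l f \<xi> n / of_real (sqrt (real l)) * (I_int k l f \<xi> n / of_real ((real l * (real f)\<^sup>2) powr (3 / 2))))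
          \<le> A * of_int \<xi> powr (- 3/2) * (norm (Kl_sum l f \<xi> n) / sqrt (real l))"
        if lf: "l \<ge> 1" "f \<ge> 1" and \<xi>: "\<xi> > 0" for l f \<xi>
      proof -
        define m where "m = real l * (real f)\<^sup>2"
        have m: "m > 0" using lf by (simp add: m_def)
        have x0: "real_of_int \<xi> > 0" using \<xi> by simp
        have "norm (I_int k l f \<xi> n) \<le> CI * (pi * of_int \<xi> * sqrt (real n) / m) powr (- 3/2)"
          unfolding m_def using lf \<xi> n0 by (intro CI(2)) auto
        also have "(pi * of_int \<xi> * sqrt (real n) / m) powr (- 3/2)
            = pi powr (- 3/2) * of_int \<xi> powr (- 3/2) * real n powr (- 3/4) * m powr (3/2)"
        proof -
          have s: "sqrt (real n) powr (- 3/2) = real n powr (- 3/4)"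
            using rn0 by (simp add: powr_half_sqrt[symmetric] powr_powr)
          have "m powr (- 3/2) = 1 / m powr (3/2)" using powr_minus_divide[of m "3/2"] by simp
          then show ?thesis using s m x0 rn0 by (simp add: powr_divide powr_mult)
        qed
        finally have "norm (I_int k l f \<xi> n) \<le> A * of_int \<xi> powr (- 3/2) * m powr (3/2)"
          by (simp only: A_def mult_ac)
        then have "norm (I_int k l f \<xi> n) / m powr (3/2) \<le> A * of_int \<xi> powr (- 3/2)"
          using m by (subst pos_divide_le_eq) auto
        then have "norm (Kl_sum l f \<xi> n) / sqrt (real l) * (norm (I_int k l f \<xi> n) / m powr (3/2))
            \<le> norm (Kl_sum l f \<xi> n) / sqrt (real l) * (A * of_int \<xi> powr (- 3/2))"
          by (intro mult_left_mono) auto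
        then show ?thesis unfolding m_def norm_mult norm_divide norm_of_real by (simp add: mult_ac)
      qed
      have finP: "finite P" unfolding P_def by (rule finite_S2_outer)
      have finQ: "finite Q" unfolding Q_def by (rule finite_S2_inner)
      have "norm (S2 k c1 c2 n \<kappa> \<alpha>) \<le> (\<Sum>(l, f)\<in>P. \<Sum>\<xi>\<in>Q. A * of_int \<xi> powr (- 3/2) * (norm (Kl_sum l f \<xi> n) / sqrt (real l)))"
        unfolding S2
      proof (rule sum_norm_le, clarify)
        fix l f assume "(l, f) \<in> P"
        then have lf: "l \<ge> 1" "f \<ge> 1" by (auto simp: P_def)
        show "norm (\<Sum>\<xi>\<in>Q. Kl_sum l f \<xi> n / of_real (sqrt (real l)) * (I_int k l f \<xi> n / of_real ((real l * (real f)\<^sup>2) powr (3 / 2))))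
           \<le> (\<Sum>\<xi>\<in>Q. A * of_int \<xi> powr (- 3/2) * (norm (Kl_sum l f \<xi> n) / sqrt (real l)))"
          by (rule sum_norm_le, rule term_le[OF lf]) (simp add: Q_def)
      qed
      \<comment> \<open>The order is exchanged so that the mean over l and f is taken for fixed
        \<xi>, on which it depends only through the number of divisors.\<close>
      also have "\<dots> = (\<Sum>\<xi>\<in>Q. A * of_int \<xi> powr (- 3/2) * (\<Sum>(l, f)\<in>P. norm (Kl_sum l f \<xi> n) / sqrt (real l)))"
        unfolding case_prod_unfold by (subst sum.swap) (simp only: sum_distrib_left)
      also have "\<dots> \<le> (\<Sum>\<xi>\<in>Q. A * CK * Y * (1 + ln Y) * (1 + ln (4 * real n)) * (real (num_divisors (nat \<xi>)) ^ 3 * real (nat \<xi>) powr - (3/2)))"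
      proof (rule sum_mono)
        fix \<xi> assume "\<xi> \<in> Q"
        then have \<xi>: "\<xi> > 0" by (simp add: Q_def)
        have "(\<Sum>(l, f)\<in>P. norm (Kl_sum l f (int (nat \<xi>)) n) / sqrt (real l))
            \<le> CK * Y * (1 + ln Y) * (1 + ln (4 * real n)) * real (num_divisors (nat \<xi>)) ^ 3"
          unfolding P_def using n0 \<xi> True by (intro CK(2)) auto
        then have "(\<Sum>(l, f)\<in>P. norm (Kl_sum l f \<xi> n) / sqrt (real l))
            \<le> CK * Y * (1 + ln Y) * (1 + ln (4 * real n)) * real (num_divisors (nat \<xi>)) ^ 3" using \<xi> by simp
        then have "A * of_int \<xi> powr (- 3/2) * (\<Sum>(l, f)\<in>P. norm (Kl_sum l f \<xi> n) / sqrt (real l))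
            \<le> A * of_int \<xi> powr (- 3/2) * (CK * Y * (1 + ln Y) * (1 + ln (4 * real n)) * real (num_divisors (nat \<xi>)) ^ 3)"
          using A0 by (intro mult_left_mono) auto
        moreover have "real_of_int \<xi> = real (nat \<xi>)" using \<xi> by simp
        ultimately show "A * of_int \<xi> powr (- 3/2) * (\<Sum>(l, f)\<in>P. norm (Kl_sum l f \<xi> n) / sqrt (real l))
            \<le> A * CK * Y * (1 + ln Y) * (1 + ln (4 * real n)) * (real (num_divisors (nat \<xi>)) ^ 3 * real (nat \<xi>) powr - (3/2))"
          by (simp only: mult_ac minus_divide_left)
      qed
      also have "\<dots> = A * CK * Y * (1 + ln Y) * (1 + ln (4 * real n)) * (\<Sum>\<xi>\<in>Q. real (num_divisors (nat \<xi>)) ^ 3 * real (nat \<xi>) powr - (3/2))"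
        by (simp only: sum_distrib_left)
      also have "\<dots> \<le> A * CK * Y * (1 + ln Y) * (1 + ln (4 * real n)) * CD"
      proof (rule mult_left_mono)
        have "(\<Sum>\<xi>\<in>Q. real (num_divisors (nat \<xi>)) ^ 3 * real (nat \<xi>) powr - (3/2))
           = (\<Sum>g\<in>nat ` Q. real (num_divisors g) ^ 3 * real g powr - (3/2))"
          by (subst sum.reindex) (auto simp: inj_on_def Q_def)
        also have "\<dots> \<le> (\<Sum>g\<in>{1..nat \<lfloor>Z\<rfloor>}. real (num_divisors g) ^ 3 * real g powr - (3/2))"
        proof (rule sum_mono2)
          show "nat ` Q \<subseteq> {1..nat \<lfloor>Z\<rfloor>}" by (auto simp: Q_def le_floor_iff intro!: nat_mono)
        qed auto
        also have "\<dots> \<le> CD" by (rule CD(2))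
        finally show "(\<Sum>\<xi>\<in>Q. real (num_divisors (nat \<xi>)) ^ 3 * real (nat \<xi>) powr - (3/2)) \<le> CD" .
        show "A * CK * Y * (1 + ln Y) * (1 + ln (4 * real n)) \<ge> 0"
          using True A0 CK(1) n by (intro mult_nonneg_nonneg add_nonneg_nonneg) auto
      qed
      also have "\<dots> = A * CK * CD * Y * ((1 + ln Y) * (1 + ln (4 * real n)))"
        by (simp only: mult_ac)
      also have "\<dots> \<le> A * CK * CD * Y * (D * (ln (real n))\<^sup>2)"
        using D(2)[OF n] True A0 CK(1) CD(1) unfolding Y_def[symmetric] by (intro mult_left_mono) auto
      also have "\<dots> = E * (ln (real n))\<^sup>2 * (real n powr (- 3/4) * real n powr (1 / 4 - \<kappa>))"
        by (simp only: A_def Y_def E_def mult_ac)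
      also have "real n powr (- 3/4) * real n powr (1 / 4 - \<kappa>) = real n powr (- 1 / 2 - \<kappa>)"
        by (simp add: powr_add[symmetric])
      finally show ?thesis .
    qed
  qed
  then show ?thesis by blast
qed

end
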